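(* Let $q=p^2$ for a prime $p\ge 17$. There exists a family of explicit bilinear forms $\{\mathbf{y}^T M_n\mathbf{x}\}_{n\ge1}$, where $M_n\in\mathbb{F}_q^{n\times n}$ and $\mathbf{x}=(x_1,\dots,x_n)^T$, $\mathbf{y}=(y_1,\dots,y_n)^T$, such that $C^r_p(\mathbf{y}^T M_n\mathbf{x})=\Omega(n^2)$.
   Context: An arithmetic circuit over $\mathbb{F}_q$ is a directed acyclic graph whose in-degree-0 vertices (input gates) are labelled by variables or field constants and whose other vertices are labelled $+$ or $\times$; wires may be labelled by field elements scaling the polynomial carried along them. Size is the number of gates. A circuit is planar if its underlying undirected graph is planar, and a planar circuit is read-once if each variable labels at most one input gate; $C^r_p(f)$ is the minimum size of a read-once planar circuit computing $f$. A family of bilinear forms $\{\mathbf{y}^T M_n\mathbf{x}\}$ is explicit if there is an algorithm that on input $n$ in unary outputs all entries of $M_n$ in time polynomial in $n$. *)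

theory Defs
  imports
    "HOL-Analysis.Analysis"
    "HOL-Library.Poly_Mapping"
    "HOL-Library.Extended_Nat"
    "HOL-Computational_Algebra.Primes"
    "HOL-Computational_Algebra.Polynomial"
    "Graph_Theory.Digraph"
    "Jordan_Normal_Form.Matrix"
begin

section \<open>Multivariate polynomials and bilinear forms\<close>

text \<open>A monomial is a finitely supported map from variables to exponents. Multiplication on
  \<^typ>\<open>'b \<Rightarrow>\<^sub>0 'a\<close> is convolution, so this type is the polynomial ring over \<^typ>\<open>'a\<close>.\<close>

type_synonym ('v, 'a) mpoly = "('v \<Rightarrow>\<^sub>0 nat) \<Rightarrow>\<^sub>0 'a"

definition pvar :: "'v \<Rightarrow> ('v, 'a::zero_neq_one) mpoly" where
  "pvar v = Poly_Mapping.single (Poly_Mapping.single v 1) 1"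

definition pconst :: "'a \<Rightarrow> ('v, 'a::zero) mpoly" where
  "pconst c = Poly_Mapping.single 0 c"

text \<open>Indices start at 0: \<open>X i\<close> and \<open>Y i\<close> are $x_{i+1}$ and $y_{i+1}$.\<close>

datatype xy = X nat | Y nat

definition bilinear_form :: "nat \<Rightarrow> 'a::field mat \<Rightarrow> (xy, 'a) mpoly" where
  "bilinear_form n M = (\<Sum>i<n. \<Sum>j<n. pvar (Y i) * pconst (M $$ (i, j)) * pvar (X j))"

section \<open>Planar arithmetic circuits\<close>

datatype ('v, 'a) gate = Input 'v | Constant 'a | Plus | Times

text \<open>Gates are the vertices and wires the arcs of a directed multigraph, so that a gate can
  feed another one along several wires (as in squaring), with unbounded fan-in and fan-out.
  A wire without a label has \<open>weight\<close> 1.\<close>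

record ('g, 'w, 'v, 'a) circuit = "('g, 'w) pre_digraph" +
  label :: "'g \<Rightarrow> ('v, 'a) gate"
  weight :: "'w \<Rightarrow> 'a"
  out_gate :: "'g"

definition underlying :: "('g, 'w, 'v, 'a) circuit \<Rightarrow> ('g, 'w) pre_digraph" where
  "underlying C = \<lparr>verts = verts C, arcs = arcs C, tail = tail C, head = head C\<rparr>"

definition is_input :: "('v, 'a) gate \<Rightarrow> bool" where
  "is_input l \<longleftrightarrow> (\<exists>v. l = Input v) \<or> (\<exists>c. l = Constant c)"

definition circuit :: "('g, 'w, 'v, 'a) circuit \<Rightarrow> bool" where
  "circuit C \<longleftrightarrow>
     fin_digraph (underlying C) \<and> acyclic (arcs_ends (underlying C)) \<and> out_gate C \<in> verts C \<and>
     (\<forall>g\<in>verts C. in_degree (underlying C) g = 0 \<longleftrightarrow> is_input (label C g))"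

text \<open>On a circuit, acyclicity makes \<open>P\<close> unique on the set of gates: \<open>P g\<close> is the
  polynomial computed at gate \<open>g\<close>.\<close>

definition gate_polys ::
    "('g, 'w, 'v, 'a::field) circuit \<Rightarrow> ('g \<Rightarrow> ('v, 'a) mpoly) \<Rightarrow> bool" where
  "gate_polys C P \<longleftrightarrow>
     (\<forall>g\<in>verts C. P g =
       (case label C g of
          Input v \<Rightarrow> pvar v
        | Constant c \<Rightarrow> pconst c
        | Plus \<Rightarrow> (\<Sum>e\<in>in_arcs (underlying C) g. pconst (weight C e) * P (tail C e))
        | Times \<Rightarrow> (\<Prod>e\<in>in_arcs (underlying C) g. pconst (weight C e) * P (tail C e))))"

definition computes :: "('g, 'w, 'v, 'a::field) circuit \<Rightarrow> ('v, 'a) mpoly \<Rightarrow> bool" where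
  "computes C f \<longleftrightarrow> (\<exists>P. gate_polys C P \<and> P (out_gate C) = f)"

text \<open>A drawing without crossings: vertices are sent to distinct points and each arc, its
  direction being ignored, to a simple curve joining its two ends that meets vertices and
  other curves only at its ends. Simple curves have distinct end points, which suffices
  for graphs without loops, in particular for acyclic ones.\<close>

definition planar :: "('g, 'w) pre_digraph \<Rightarrow> bool" where
  "planar G \<longleftrightarrow>
     (\<exists>(pos :: 'g \<Rightarrow> complex) (curve :: 'w \<Rightarrow> real \<Rightarrow> complex).
        inj_on pos (verts G) \<and>
        (\<forall>e\<in>arcs G. Path_Connected.arc (curve e) \<and>
           pathstart (curve e) = pos (tail G e) \<and> pathfinish (curve e) = pos (head G e) \<and>
           path_image (curve e) \<inter> pos ` verts G = {pos (tail G e), pos (head G e)}) \<and>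
        (\<forall>e\<in>arcs G. \<forall>e'\<in>arcs G. e \<noteq> e' \<longrightarrow>
           path_image (curve e) \<inter> path_image (curve e') \<subseteq> pos ` verts G))"

definition read_once :: "('g, 'w, 'v, 'a) circuit \<Rightarrow> bool" where
  "read_once C \<longleftrightarrow>
     (\<forall>g\<in>verts C. \<forall>h\<in>verts C. \<forall>v. label C g = Input v \<and> label C h = Input v \<longrightarrow> g = h)"

definition size_circuit :: "('g, 'w, 'v, 'a) circuit \<Rightarrow> nat" where
  "size_circuit C = card (verts C)"

text \<open>The minimum, in \<^typ>\<open>enat\<close>, of a nonempty set is attained; it would be \<open>\<infinity>\<close> if no such
  circuit existed. Circuits being finite, natural numbers suffice as names of gates and
  wires.\<close>

definition read_once_planar_complexity :: "('v, 'a::field) mpoly \<Rightarrow> enat" where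
  "read_once_planar_complexity f =
     (INF C \<in> {C :: (nat, nat, 'v, 'a) circuit.
                 circuit C \<and> planar (underlying C) \<and> read_once C \<and> computes C f}.
        enat (size_circuit C))"

section \<open>Polynomial-time algorithms\<close>

text \<open>A random access machine on natural numbers with addition, truncated subtraction and
  indirect addressing. The instruction set has no multiplication, so lengths of numbers stay
  linear in the number of steps, and polynomial time with each step costing 1 is polynomial
  time on Turing machines (Cook and Reckhow). A state consists of the registers and the
  memory.\<close>

type_synonym ram_state = "(nat \<Rightarrow> nat) \<times> (nat \<Rightarrow> nat)"

datatype ram =
    Set nat nat
  | Add nat nat nat
  | Sub nat nat nat
  | Load nat nat
  | Store nat nat
  | Seq ram ram
  | Cond nat ram ram
  | Loop nat ram

inductive exec :: "ram \<Rightarrow> ram_state \<Rightarrow> nat \<Rightarrow> ram_state \<Rightarrow> bool" where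
  "exec (Set r k) (s, m) 1 (s(r := k), m)"
| "exec (Add r a b) (s, m) 1 (s(r := s a + s b), m)"
| "exec (Sub r a b) (s, m) 1 (s(r := s a - s b), m)"
| "exec (Load r a) (s, m) 1 (s(r := m (s a)), m)"
| "exec (Store a r) (s, m) 1 (s, m(s a := s r))"
| "exec c st t st' \<Longrightarrow> exec d st' u st'' \<Longrightarrow> exec (Seq c d) st (t + u) st''"
| "s r \<noteq> 0 \<Longrightarrow> exec c (s, m) t st' \<Longrightarrow> exec (Cond r c d) (s, m) (t + 1) st'"
| "s r = 0 \<Longrightarrow> exec d (s, m) t st' \<Longrightarrow> exec (Cond r c d) (s, m) (t + 1) st'"
| "s r = 0 \<Longrightarrow> exec (Loop r c) (s, m) 1 (s, m)"
| "s r \<noteq> 0 \<Longrightarrow> exec c (s, m) t st' \<Longrightarrow> exec (Loop r c) st' u st'' \<Longrightarrow>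
     exec (Loop r c) (s, m) (t + u + 1) st''"

definition unary_input :: "nat \<Rightarrow> ram_state" where
  "unary_input n = ((\<lambda>r. 0), (\<lambda>a. if a < n then 1 else 0))"

text \<open>One program for all \<open>n\<close>, which leaves the matrix in memory row by row. Its entries
  come from a fixed finite field, so the choice of the code for field elements is
  immaterial: a finite table translates between any two codes.\<close>

definition explicit :: "(nat \<Rightarrow> 'a::{field,finite} mat) \<Rightarrow> bool" where
  "explicit M \<longleftrightarrow>
     (\<exists>(c :: ram) (code :: 'a \<Rightarrow> nat) (T :: nat poly). inj code \<and>
       (\<forall>n\<ge>1. \<exists>t s m. exec c (unary_input n) t (s, m) \<and> t \<le> poly T n \<and>
          (\<forall>i<n. \<forall>j<n. m (i * n + j) = code (M n $$ (i, j)))))"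

end

theory Submission
  imports Defs "HOL-Library.Discrete_Functions" "HOL-Number_Theory.Cong"
begin

text \<open>Let \<open>M\<^sub>n\<close> be the 0/1 matrix with ones on the diagonal and on the edges of a Margulis-type
  expander of bounded degree, whose vertices are the points of the torus \<open>\<int>\<^sub>m \<times> \<int>\<^sub>m\<close>
  with \<open>m = \<lfloor>\<surd>n\<rfloor>\<close>. A planar graph has no \<open>K\<^sub>6\<close> minor, so by Alon, Seymour and Thomas a planar
  circuit with \<open>N\<close> gates has a balanced separator \<open>S\<close> with \<open>O(\<surd>N)\<close> gates, balanced with respect to the
  input gates. By expansion and because of the diagonal, linearly many nonzero entries of \<open>M\<^sub>n\<close> belong to
  variables on different sides of \<open>S\<close>, and by bounded degree a constant fraction of them forms a
  diagonal submatrix, of linear rank over any field. But all products of an \<open>x\<close> of one side with a \<open>y\<close>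
  of the other pass through \<open>S\<close>, which bounds this rank by \<open>3 |S|\<close>. So \<open>n = O(\<surd>N)\<close>.\<close>

section \<open>Theta curves\<close>

text \<open>Since every variable labels a single gate, a vertex separator gives it a side, unless
  its gate lies in the separator. Balance is measured on the input gates because a side with many
  gates may hold few variables. A priori \<open>X i\<close> and \<open>Y i\<close> may fall on
  different sides. Rows where they do are charged to the separator through the diagonal entry, so
  expansion has to be applied only to the set of all \<open>i\<close> with \<open>X i\<close> on one
  side. The factor 3 counts linear conditions per separator gate: two on the values given to the
  x-variables and one on those of the y-variables. A diagonal form of larger rank cannot vanish on
  all solutions. The expander is chosen so that additions and comparisons suffice to compute its
  entries and so that its gap has an elementary proof: the Fourier transform turns shears of the
  torus into shears of the frequencies. The K6 minor contradicts planarity after splitting its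
  branch sets into three and three, which reduces the topology to theta curves.\<close>

lemma connected_subset_open_disjoint:
  assumes "connected Q" "open S" "open T" "S \<inter> T = {}" "Q \<subseteq> S \<union> T"
  shows "Q \<subseteq> S \<or> Q \<subseteq> T"
  using connectedD[OF assms(1-3)] assms(4,5) by blast

lemma closure_Int_open_empty:
  assumes "x \<in> closure Q" "open S" "Q \<inter> S = {}"
  shows "x \<notin> S"
  using assms open_Int_closure_eq_empty[of S Q] by blast

lemma Jordan_inside_arcs:
  fixes c1 c2 :: "real \<Rightarrow> complex"
  assumes "arc c1" "arc c2" "pathstart c1 = a" "pathfinish c1 = b" "pathstart c2 = a" "pathfinish c2 = b"
    and "path_image c1 \<inter> path_image c2 = {a, b}"
  defines "K \<equiv> path_image c1 \<union> path_image c2"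
  shows "inside K \<noteq> {}" "connected (inside K)" "frontier (inside K) = K"
    "open (inside K)" "open (outside K)" "connected (outside K)" "compact K"
proof -
  define g where "g = c1 +++ reversepath c2"
  have "simple_path g"
    unfolding g_def using assms(1-7)
    by (intro simple_path_join_loop) (auto simp: arc_reversepath)
  moreover have "pathfinish g = pathstart g"
    unfolding g_def using assms by simp
  moreover have "path_image g = K"
    unfolding g_def K_def using assms by (simp add: path_image_join)
  ultimately show "inside K \<noteq> {}" "connected (inside K)" "frontier (inside K) = K"
    "open (inside K)" "open (outside K)" "connected (outside K)"
    using Jordan_inside_outside[of g] by auto
  show "compact K"
    unfolding K_def using assms by (auto intro!: compact_Un compact_path_image arc_imp_path)
qed

locale theta_curve =
  fixes c1 c2 c3 :: "real \<Rightarrow> complex" and a b :: complex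
  assumes arcs: "arc c1" "arc c2" "arc c3"
    and ends: "pathstart c1 = a" "pathfinish c1 = b" "pathstart c2 = a" "pathfinish c2 = b"
      "pathstart c3 = a" "pathfinish c3 = b"
    and disj: "path_image c1 \<inter> path_image c2 = {a, b}" "path_image c1 \<inter> path_image c3 = {a, b}"
      "path_image c2 \<inter> path_image c3 = {a, b}"
begin

lemmas J12 = Jordan_inside_arcs[OF arcs(1,2) ends(1-4) disj(1)]
lemmas J13 = Jordan_inside_arcs[OF arcs(1,3) ends(1,2,5,6) disj(2)]
lemmas J23 = Jordan_inside_arcs[OF arcs(2,3) ends(3-6) disj(3)]

text \<open>The arc \<open>c3\<close> cuts the inside of the cycle of \<open>c1\<close> and
  \<open>c2\<close> into two regions, and the closure of each misses the interior of one of these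
  two arcs. The point \<open>x3\<close> pulls \<open>Q\<close> inside, hence into one of the
  regions, so the closure of \<open>Q\<close> misses \<open>x1\<close> or \<open>x2\<close>.\<close>

lemma no_tripod_middle:
  assumes Q: "connected Q" "Q \<inter> (path_image c1 \<union> path_image c2 \<union> path_image c3) = {}"
    and x: "x1 \<in> closure Q" "x1 \<in> path_image c1 - {a, b}" "x2 \<in> closure Q" "x2 \<in> path_image c2 - {a, b}"
      "x3 \<in> closure Q" "x3 \<in> path_image c3 - {a, b}"
    and mid: "path_image c3 \<inter> inside (path_image c1 \<union> path_image c2) \<noteq> {}"
  shows False
proof -
  let ?K12 = "path_image c1 \<union> path_image c2" and ?K13 = "path_image c1 \<union> path_image c3"
    and ?K23 = "path_image c2 \<union> path_image c3"
  have "a \<noteq> b"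
    using arcs(1) ends by (metis arc_distinct_ends)
  then have split: "inside ?K13 \<inter> inside ?K23 = {}"
    "inside ?K13 \<union> inside ?K23 \<union> (path_image c3 - {a, b}) = inside ?K12"
    using split_inside_simple_closed_curve[of c1 a b c2 c3] arcs ends disj mid
    by (metis arc_imp_simple_path)+
  have "Q \<subseteq> inside ?K12 \<or> Q \<subseteq> outside ?K12"
    using Q inside_Un_outside[of ?K12] inside_Int_outside[of ?K12]
    by (intro connected_subset_open_disjoint J12) auto
  moreover have "\<not> Q \<subseteq> outside ?K12"
  proof
    assume "Q \<subseteq> outside ?K12"
    then have "Q \<inter> inside ?K12 = {}"
      using inside_Int_outside[of ?K12] by blast
    then show False
      using closure_Int_open_empty[OF x(5) J12(4)] x(6) split(2) by blast
  qed
  ultimately have "Q \<subseteq> inside ?K13 \<union> inside ?K23"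
    using split(2) Q(2) by blast
  then have "Q \<subseteq> inside ?K13 \<or> Q \<subseteq> inside ?K23"
    using split(1) by (intro connected_subset_open_disjoint Q(1) J13 J23) auto
  then show False
  proof
    assume "Q \<subseteq> inside ?K13"
    then have "x2 \<in> ?K13 \<union> inside ?K13"
      using closure_inside_subset[OF compact_imp_closed[OF J13(7)]] x(3) closure_mono by blast
    then show False
      using x(4) disj split(2) inside_no_overlap[of ?K12] by blast
  next
    assume "Q \<subseteq> inside ?K23"
    then have "x1 \<in> ?K23 \<union> inside ?K23"
      using closure_inside_subset[OF compact_imp_closed[OF J23(7)]] x(1) closure_mono by blast
    then show False
      using x(2) disj split(2) inside_no_overlap[of ?K12] by blast
  qed
qed

text \<open>If no arc of a theta curve lay inside the cycle formed by the other two, Janiszewski's theorem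
  would connect the inside of one of the cycles with infinity.\<close>

lemma ex_middle:
  assumes x: "x2 \<in> path_image c2 - {a, b}" "x3 \<in> path_image c3 - {a, b}"
  shows "path_image c3 \<inter> inside (path_image c1 \<union> path_image c2) \<noteq> {} \<or>
    path_image c2 \<inter> inside (path_image c1 \<union> path_image c3) \<noteq> {} \<or>
    path_image c1 \<inter> inside (path_image c2 \<union> path_image c3) \<noteq> {}"
proof (rule ccontr)
  let ?K12 = "path_image c1 \<union> path_image c2" and ?K13 = "path_image c1 \<union> path_image c3"
    and ?K23 = "path_image c2 \<union> path_image c3"
  let ?\<Theta> = "?K12 \<union> ?K13"
  assume "\<not> ?thesis"
  then have n: "path_image c3 \<inter> inside ?K12 = {}" "path_image c2 \<inter> inside ?K13 = {}"
    "path_image c1 \<inter> inside ?K23 = {}"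
    by blast+
  have out: "inside ?K23 \<subseteq> outside K"
    if "K = path_image c1 \<union> P" "P \<subseteq> ?K23" "open (inside K)" "open (outside K)" "compact K"
      "z \<in> ?K23" "z \<notin> K" "z \<notin> inside K" for K P z
  proof -
    have "inside ?K23 \<subseteq> inside K \<or> inside ?K23 \<subseteq> outside K"
    proof (intro connected_subset_open_disjoint J23 that)
      show "inside ?K23 \<subseteq> inside K \<union> outside K"
        using that n(3) inside_no_overlap[of ?K23] unfolding inside_Un_outside by blast
    qed (simp add: inside_Int_outside)
    moreover have "\<not> inside ?K23 \<subseteq> inside K"
    proof
      assume "inside ?K23 \<subseteq> inside K"
      then have "closure (inside ?K23) \<subseteq> K \<union> inside K"
        using closure_inside_subset[OF compact_imp_closed[OF that(5)]] closure_mono by blast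
      moreover have "?K23 \<subseteq> closure (inside ?K23)"
        using J23(3) unfolding frontier_def by blast
      ultimately show False
        using that by blast
    qed
    ultimately show ?thesis
      by blast
  qed
  have o12: "inside ?K23 \<subseteq> outside ?K12"
  proof (rule out[OF refl _ J12(4,5,7)])
    show "x3 \<in> ?K23" "x3 \<notin> ?K12" "x3 \<notin> inside ?K12"
      using x(2) disj n by blast+
  qed blast
  have o13: "inside ?K23 \<subseteq> outside ?K13"
  proof (rule out[OF refl _ J13(4,5,7)])
    show "x2 \<in> ?K23" "x2 \<notin> ?K13" "x2 \<notin> inside ?K13"
      using x(1) disj n by blast+
  qed blast
  obtain p where p: "p \<in> inside ?K23"
    using J23(1) by blast
  have "bounded ?\<Theta>"
    by (rule compact_imp_bounded[OF compact_Un[OF J12(7) J13(7)]])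
  then obtain q where q: "q \<in> outside ?\<Theta>"
    using outside_bounded_nonempty by blast
  have q': "q \<in> outside ?K12" "q \<in> outside ?K13" "q \<in> outside ?K23"
    using q outside_mono[of ?K12 ?\<Theta>] outside_mono[of ?K13 ?\<Theta>] outside_mono[of ?K23 ?\<Theta>] by blast+
  \<comment> \<open>Joined off each of two cycles, \<open>p\<close> and \<open>q\<close> are joined
    off their union as soon as the cycles meet in a connected set, here the arc
    \<open>c1\<close>.\<close>
  have "connected_component (- ?K12) p q"
    using J12(6) o12 p q' outside_no_overlap[of ?K12] unfolding connected_component_def by blast
  moreover have "connected_component (- ?K13) p q"
    using J13(6) o13 p q' outside_no_overlap[of ?K13] unfolding connected_component_def by blast
  moreover have "?K12 \<inter> ?K13 = path_image c1"
    using disj by blast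
  then have "connected (?K12 \<inter> ?K13)"
    using arcs(1) by (simp add: connected_arc_image)
  ultimately have "connected_component (- ?\<Theta>) p q"
    using Janiszewski J12(7) compact_imp_closed[OF J13(7)] by blast
  moreover have "- ?\<Theta> \<subseteq> - ?K23"
    by blast
  ultimately have "connected_component (- ?K23) q p"
    using connected_component_of_subset connected_component_sym by metis
  then have "p \<in> outside ?K23"
    using outside_same_component q'(3) by blast
  then show False
    using p inside_Int_outside by blast
qed

lemma no_tripod:
  assumes Q: "connected Q" "Q \<inter> (path_image c1 \<union> path_image c2 \<union> path_image c3) = {}"
    and x: "x1 \<in> closure Q" "x1 \<in> path_image c1 - {a, b}" "x2 \<in> closure Q" "x2 \<in> path_image c2 - {a, b}"
      "x3 \<in> closure Q" "x3 \<in> path_image c3 - {a, b}"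
  shows False
proof -
  note disj' = disj[unfolded Int_commute[of "path_image c1"] Int_commute[of "path_image c2" "path_image c3"]]
  have "theta_curve c1 c3 c2 a b" "theta_curve c2 c3 c1 a b"
    by (unfold_locales; fact arcs ends disj disj')+
  then interpret t2: theta_curve c1 c3 c2 a b + t1: theta_curve c2 c3 c1 a b .
  have Q': "Q \<inter> (path_image c1 \<union> path_image c3 \<union> path_image c2) = {}"
    "Q \<inter> (path_image c2 \<union> path_image c3 \<union> path_image c1) = {}"
    using Q(2) by blast+
  show False
    using ex_middle[OF x(4,6)] no_tripod_middle[OF Q x] t2.no_tripod_middle[OF Q(1) Q'(1) x(1,2,5,6,3,4)]
      t1.no_tripod_middle[OF Q(1) Q'(2) x(3,4,5,6,1,2)] by argo
qed

end

lemma arc_half_open: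
  fixes g :: "real \<Rightarrow> complex"
  assumes "arc g"
  shows "connected (g ` {0..<1})" "pathfinish g \<in> closure (g ` {0..<1})" "pathfinish g \<notin> g ` {0..<1}"
    "pathstart g \<in> g ` {0..<1}" "g ` {0..<1} \<subseteq> path_image g"
proof -
  have cont: "continuous_on {0..1} g" and inj: "inj_on g {0..1}"
    using assms by (auto simp: arc_def path_def)
  show "connected (g ` {0..<1})"
    by (intro connected_continuous_image continuous_on_subset[OF cont]) auto
  have "g ` closure {0..<1} \<subseteq> closure (g ` {0..<1})"
    using cont by (intro image_closure_subset) (auto simp: closure_subset)
  then show "pathfinish g \<in> closure (g ` {0..<1})"
    by (auto simp: pathfinish_def)
  show "pathfinish g \<notin> g ` {0..<1}"
    using inj_onD[OF inj, of 1] by (fastforce simp: pathfinish_def)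
qed (auto simp: pathstart_def path_image_def)

text \<open>The paths from \<open>a 0\<close> to \<open>a 1\<close> through \<open>b 0\<close>,
  \<open>b 1\<close> and \<open>b 2\<close> form a theta curve. The star at \<open>a 2\<close>
  touches each of its arcs at the inner point \<open>b j\<close>, against \<open>no_tripod\<close>.
  Removing the tips of the star keeps it off the curve and connected, while \<open>b j\<close> stays
  in its closure.\<close>

theorem K33_not_planar:
  fixes \<gamma> :: "nat \<Rightarrow> nat \<Rightarrow> real \<Rightarrow> complex"
  assumes arcs: "\<And>i j. i < 3 \<Longrightarrow> j < 3 \<Longrightarrow> arc (\<gamma> i j)"
    and start: "\<And>i j. i < 3 \<Longrightarrow> j < 3 \<Longrightarrow> pathstart (\<gamma> i j) = a i"
    and finish: "\<And>i j. i < 3 \<Longrightarrow> j < 3 \<Longrightarrow> pathfinish (\<gamma> i j) = b j"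
    and row: "\<And>i j j'. i < 3 \<Longrightarrow> j < 3 \<Longrightarrow> j' < 3 \<Longrightarrow> j \<noteq> j' \<Longrightarrow>
      path_image (\<gamma> i j) \<inter> path_image (\<gamma> i j') \<subseteq> {a i}"
    and col: "\<And>i i' j. i < 3 \<Longrightarrow> i' < 3 \<Longrightarrow> j < 3 \<Longrightarrow> i \<noteq> i' \<Longrightarrow>
      path_image (\<gamma> i j) \<inter> path_image (\<gamma> i' j) \<subseteq> {b j}"
    and other: "\<And>i i' j j'. i < 3 \<Longrightarrow> i' < 3 \<Longrightarrow> j < 3 \<Longrightarrow> j' < 3 \<Longrightarrow> i \<noteq> i' \<Longrightarrow> j \<noteq> j' \<Longrightarrow>
      path_image (\<gamma> i j) \<inter> path_image (\<gamma> i' j') = {}"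
  shows False
proof -
  define c where "c j = \<gamma> 0 j +++ reversepath (\<gamma> 1 j)" for j
  define Q where "Q = (\<Union>j\<in>{..<3}. \<gamma> 2 j ` {0..<1})"
  have img: "path_image (c j) = path_image (\<gamma> 0 j) \<union> path_image (\<gamma> 1 j)" if "j < 3" for j
    unfolding c_def using that finish by (simp add: path_image_join)
  have arc_c: "arc (c j)" if "j < 3" for j
    unfolding c_def using that arcs finish col[of 0 1 j] by (intro arc_join) (auto simp: arc_reversepath)
  have ends_c: "pathstart (c j) = a 0" "pathfinish (c j) = a 1" if "j < 3" for j
    unfolding c_def using that start by auto
  have a_in: "a i \<in> path_image (\<gamma> i j)" and b_in: "b j \<in> path_image (\<gamma> i j)" and ab: "a i \<noteq> b j"
    if "i < 3" "j < 3" for i j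
    using pathstart_in_path_image[of "\<gamma> i j"] pathfinish_in_path_image[of "\<gamma> i j"]
      arc_distinct_ends[OF arcs[OF that]] start[OF that] finish[OF that] by auto
  have disj_c: "path_image (c j) \<inter> path_image (c k) = {a 0, a 1}" if "j < 3" "k < 3" "j \<noteq> k" for j k
  proof
    show "path_image (c j) \<inter> path_image (c k) \<subseteq> {a 0, a 1}"
      using that row[of 0 j k] row[of 1 j k] other[of 0 1 j k] other[of 1 0 j k] unfolding img[OF that(1)] img[OF that(2)]
      by auto
    show "{a 0, a 1} \<subseteq> path_image (c j) \<inter> path_image (c k)"
      using that a_in unfolding img[OF that(1)] img[OF that(2)] by auto
  qed
  have Q_conn: "connected Q"
    unfolding Q_def
  proof (rule connected_Union)
    show "connected S" if "S \<in> (\<lambda>j. \<gamma> 2 j ` {0..<1}) ` {..<3}" for S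
      using that arcs by (auto intro: arc_half_open)
    have "a 2 \<in> \<gamma> 2 j ` {0..<1}" if "j < 3" for j
      using arc_half_open(4)[OF arcs, of 2 j] start that by auto
    then show "\<Inter> ((\<lambda>j. \<gamma> 2 j ` {0..<1}) ` {..<3}) \<noteq> {}"
      by blast
  qed
  have HC: "\<gamma> 2 j ` {0..<1} \<inter> path_image (c k) = {}" if "j < 3" "k < 3" for j k
  proof -
    have avoid: "H \<inter> C = {}" if "H \<subseteq> P" "P \<inter> C \<subseteq> {z}" "z \<notin> H" for H P C :: "complex set" and z
      using that by blast
    have "path_image (\<gamma> 2 j) \<inter> path_image (c k) \<subseteq> {b j}"
      using col[of 2 0 j] col[of 2 1 j] other[of 2 0 j k] other[of 2 1 j k] that
      unfolding img[OF that(2)] by (cases "j = k") auto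
    moreover have "b j \<notin> \<gamma> 2 j ` {0..<1}"
      using arc_half_open(3)[OF arcs[of 2 j]] finish[of 2 j] that by auto
    ultimately show ?thesis
      using arc_half_open(5)[OF arcs[of 2 j]] that by (intro avoid) auto
  qed
  have UN_disj: "(\<Union>j\<in>{..<3}. H j) \<inter> (C 0 \<union> C 1 \<union> C 2) = {}"
    if "\<And>j k. j < 3 \<Longrightarrow> k < 3 \<Longrightarrow> H j \<inter> C k = {}" for H C :: "nat \<Rightarrow> complex set"
  proof (rule equals0I)
    fix z assume "z \<in> (\<Union>j\<in>{..<3}. H j) \<inter> (C 0 \<union> C 1 \<union> C 2)"
    then obtain j where "j < 3" "z \<in> H j" "z \<in> C 0 \<or> z \<in> C 1 \<or> z \<in> C 2"
      by blast
    then show False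
      using that[of j 0] that[of j 1] that[of j 2] by auto
  qed
  have Q_disj: "Q \<inter> (path_image (c 0) \<union> path_image (c 1) \<union> path_image (c 2)) = {}"
    unfolding Q_def by (rule UN_disj[of "\<lambda>j. \<gamma> 2 j ` {0..<1}" "\<lambda>k. path_image (c k)", OF HC])
  have bQ: "b j \<in> closure Q" if "j < 3" for j
  proof -
    have "b j \<in> closure (\<gamma> 2 j ` {0..<1})"
      using arc_half_open(2)[OF arcs[of 2 j]] finish[of 2 j] that by auto
    moreover have "\<gamma> 2 j ` {0..<1} \<subseteq> Q"
      unfolding Q_def using that by (intro UN_upper) simp
    ultimately show ?thesis
      using closure_mono by blast
  qed
  have bc: "b j \<in> path_image (c j) - {a 0, a 1}" if "j < 3" for j
    using b_in[of 0 j] ab[of 0 j] ab[of 1 j] that unfolding img[OF that] by simp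
  show False
  proof (intro theta_curve.no_tripod[of "c 0" "c 1" "c 2" "a 0" "a 1" Q "b 0" "b 1" "b 2"])
    show "theta_curve (c 0) (c 1) (c 2) (a 0) (a 1)"
      by unfold_locales (rule arc_c ends_c disj_c; simp)+
    show "b 0 \<in> closure Q" "b 1 \<in> closure Q" "b 2 \<in> closure Q"
      by (rule bQ; simp)+
    show "b 0 \<in> path_image (c 0) - {a 0, a 1}" "b 1 \<in> path_image (c 1) - {a 0, a 1}"
      "b 2 \<in> path_image (c 2) - {a 0, a 1}"
      by (rule bc; simp)+
  qed (fact Q_conn Q_disj)+
qed

section \<open>Separators and complete minors\<close>

text \<open>The empty set is connected in this sense, hence the nonemptiness demanded in
  \<open>component\<close> and \<open>minor_model\<close>.\<close>

definition conn :: "('v \<times> 'v) set \<Rightarrow> 'v set \<Rightarrow> bool" where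
  "conn E U \<longleftrightarrow> (\<forall>u\<in>U. \<forall>v\<in>U. (u, v) \<in> (E \<inter> U \<times> U)\<^sup>*)"

lemma rtrancl_Restr_mono:
  "(u, v) \<in> (E \<inter> U \<times> U)\<^sup>* \<Longrightarrow> U \<subseteq> U' \<Longrightarrow> (u, v) \<in> (E \<inter> U' \<times> U')\<^sup>*"
  by (rule subsetD[OF rtrancl_mono]) auto

lemma sym_rtrancl_Restr: "sym E \<Longrightarrow> sym ((E \<inter> U \<times> U)\<^sup>*)"
  by (rule sym_rtrancl) (auto simp: sym_def)

lemma conn_rootI:
  assumes "sym E" and root: "\<And>v. v \<in> U \<Longrightarrow> (r, v) \<in> (E \<inter> U \<times> U)\<^sup>*"
  shows "conn E U"
  unfolding conn_def
proof (intro ballI)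
  fix u v assume "u \<in> U" "v \<in> U"
  then show "(u, v) \<in> (E \<inter> U \<times> U)\<^sup>*"
    using symD[OF sym_rtrancl_Restr[OF assms(1)] root] root by (meson rtrancl_trans)
qed

lemma conn_singleton: "conn E {v}"
  by (simp add: conn_def)

lemma conn_insert:
  assumes "sym E" "conn E U" "u \<in> U" "(u, w) \<in> E"
  shows "conn E (insert w U)"
proof (rule conn_rootI[OF assms(1), where r = u])
  let ?R = "E \<inter> insert w U \<times> insert w U"
  fix v assume "v \<in> insert w U"
  moreover have "(u, w) \<in> ?R\<^sup>*"
    using assms(3,4) by blast
  moreover have "(u, v) \<in> ?R\<^sup>*" if "v \<in> U"
    by (rule rtrancl_Restr_mono[of _ _ _ U]) (use that assms(2,3) in \<open>auto simp: conn_def\<close>)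
  ultimately show "(u, v) \<in> ?R\<^sup>*"
    by blast
qed

lemma conn_subset_closed:
  assumes "conn E U" "u \<in> U" "u \<in> D"
    and "\<And>u v. u \<in> D \<Longrightarrow> u \<in> U \<Longrightarrow> v \<in> U \<Longrightarrow> (u, v) \<in> E \<Longrightarrow> v \<in> D"
  shows "U \<subseteq> D"
proof
  fix v assume "v \<in> U"
  then have "(u, v) \<in> (E \<inter> U \<times> U)\<^sup>*"
    using assms(1,2) by (auto simp: conn_def)
  then show "v \<in> D"
    by (induction rule: rtrancl_induct) (use assms(3,4) in auto)
qed

definition component :: "('v \<times> 'v) set \<Rightarrow> 'v set \<Rightarrow> 'v set \<Rightarrow> bool" where
  "component E U D \<longleftrightarrow> D \<noteq> {} \<and> D \<subseteq> U \<and> conn E D \<and> (\<forall>u\<in>D. \<forall>v\<in>U. (u, v) \<in> E \<longrightarrow> v \<in> D)"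

lemma conn_subset_component:
  assumes "component E U D" "conn E U'" "U' \<subseteq> U" "U' \<inter> D \<noteq> {}"
  shows "U' \<subseteq> D"
proof -
  obtain u where "u \<in> U'" "u \<in> D"
    using assms(4) by blast
  then show ?thesis
    by (rule conn_subset_closed[OF assms(2)]) (use assms in \<open>auto simp: component_def\<close>)
qed

lemma ex_component:
  assumes "sym E" "conn E D" "D \<subseteq> U" "D \<noteq> {}"
  obtains D' where "component E U D'" "D \<subseteq> D'"
proof -
  obtain r where r: "r \<in> D"
    using assms by blast
  let ?R = "(E \<inter> U \<times> U)\<^sup>*"
  define D' where "D' = {v. (r, v) \<in> ?R}"
  have sub: "D' \<subseteq> U"
  proof
    fix v assume "v \<in> D'"
    then have "(r, v) \<in> ?R"
      by (simp add: D'_def)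
    then show "v \<in> U"
      by (induction rule: rtrancl_induct) (use r assms in auto)
  qed
  have "(r, v) \<in> (E \<inter> D' \<times> D')\<^sup>*" if "v \<in> D'" for v
  proof -
    have "(r, v) \<in> ?R"
      using that by (simp add: D'_def)
    then show ?thesis
    proof (induction rule: rtrancl_induct)
      case (step y z)
      have "y \<in> D'" "z \<in> D'"
        using rtrancl_into_rtrancl[OF step.hyps] step.hyps by (auto simp: D'_def)
      then have "(y, z) \<in> E \<inter> D' \<times> D'"
        using step.hyps by blast
      with step.IH show ?case
        by (rule rtrancl_into_rtrancl)
    qed simp
  qed
  then have "conn E D'"
    by (rule conn_rootI[OF assms(1)])
  moreover have "v \<in> D'" if "u \<in> D'" "v \<in> U" "(u, v) \<in> E" for u v
  proof -
    have "(u, v) \<in> E \<inter> U \<times> U"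
      using that sub by blast
    then show ?thesis
      using that(1) unfolding D'_def mem_Collect_eq by (rule rtrancl_into_rtrancl[rotated])
  qed
  moreover have "D \<subseteq> D'"
    using assms r unfolding D'_def conn_def by (auto intro: rtrancl_Restr_mono)
  moreover have "D' \<noteq> {}"
    using r \<open>D \<subseteq> D'\<close> by blast
  ultimately show thesis
    using sub by (intro that[of D']) (auto simp: component_def)
qed

text \<open>Consider the walks in \<open>D\<close> that meet \<open>A 0\<close>, \<dots>, \<open>A i\<close> in this order, \<open>t\<close> being their length:
  either a short one meets all sets, or one of the many distance levels is a small cutset.\<close>

inductive visit :: "('v \<times> 'v) set \<Rightarrow> 'v set \<Rightarrow> (nat \<Rightarrow> 'v set) \<Rightarrow> nat \<Rightarrow> nat \<Rightarrow> 'v \<Rightarrow> bool"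
  for E D A where
  start: "v \<in> D \<Longrightarrow> v \<in> A 0 \<Longrightarrow> visit E D A 0 0 v"
| switch: "visit E D A i t v \<Longrightarrow> v \<in> A (Suc i) \<Longrightarrow> visit E D A (Suc i) t v"
| step: "visit E D A i t v \<Longrightarrow> (v, w) \<in> E \<Longrightarrow> w \<in> D \<Longrightarrow> visit E D A i (Suc t) w"

lemma visit_conn:
  assumes "sym E" "visit E D A i t v"
  shows "\<exists>T\<subseteq>D. finite T \<and> card T \<le> Suc t \<and> conn E T \<and> v \<in> T \<and> (\<forall>l\<le>i. T \<inter> A l \<noteq> {})"
  using assms(2)
proof induction
  case (start v)
  then show ?case
    by (intro exI[of _ "{v}"]) (auto simp: conn_singleton)
next
  case (switch i t v)
  then obtain T where "T \<subseteq> D" "finite T" "card T \<le> Suc t" "conn E T" "v \<in> T"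
    "\<forall>l\<le>i. T \<inter> A l \<noteq> {}"
    by blast
  moreover from this have "\<forall>l\<le>Suc i. T \<inter> A l \<noteq> {}"
    using switch.hyps(2) by (auto simp: le_Suc_eq)
  ultimately show ?case
    by blast
next
  case (step i t v w)
  then obtain T where T: "T \<subseteq> D" "finite T" "card T \<le> Suc t" "conn E T" "v \<in> T"
    "\<forall>l\<le>i. T \<inter> A l \<noteq> {}"
    by blast
  have "conn E (insert w T)"
    using conn_insert[OF assms(1) T(4,5)] step.hyps by blast
  moreover have "card (insert w T) \<le> Suc (Suc t)"
    using T(2,3) by (simp add: card_insert_if)
  moreover have "\<forall>l\<le>i. insert w T \<inter> A l \<noteq> {}"
    using T(6) by blast
  ultimately show ?case
    using T(1,2) step.hyps(3) by (intro exI[of _ "insert w T"]) simp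
qed

text \<open>Call the least \<open>t\<close> with \<open>visit E D A i t v\<close> the distance of
  \<open>v\<close> in layer \<open>i\<close>. The vertices at distance \<open>j\<close> in some
  layer form \<open>Z j\<close>. A vertex lies in at most \<open>k\<close> of these sets, so one of
  the \<open>r\<close> first ones has at most \<open>k * card D / r\<close> elements. A connected
  set avoiding it and meeting all \<open>A i\<close> would stay at distance below \<open>j\<close>
  in one layer after the other, and so yield a walk shorter than \<open>r\<close>.\<close>

lemma connect_or_separate:
  fixes A :: "nat \<Rightarrow> 'v set" and k r :: nat
  assumes "sym E" "finite D" "D \<noteq> {}" "0 < r"
  shows "(\<exists>T\<subseteq>D. T \<noteq> {} \<and> card T \<le> r \<and> conn E T \<and> (\<forall>i<k. T \<inter> A i \<noteq> {})) \<or>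
    (\<exists>Z\<subseteq>D. r * card Z \<le> k * card D \<and> (\<forall>U\<subseteq>D - Z. conn E U \<longrightarrow> (\<exists>i<k. U \<inter> A i = {})))"
proof (cases "k = 0 \<or> (\<exists>t v. t < r \<and> visit E D A (k - 1) t v)")
  case True
  show ?thesis
  proof (cases "k = 0")
    case True
    obtain d where "d \<in> D"
      using assms by blast
    then show ?thesis
      using True assms(4) by (intro disjI1 exI[of _ "{d}"]) (simp add: conn_singleton)
  next
    case False
    then obtain t v where "t < r" and v: "visit E D A (k - 1) t v"
      using True by blast
    obtain T where "T \<subseteq> D" "card T \<le> Suc t" "conn E T" "v \<in> T" "\<forall>l\<le>k - 1. T \<inter> A l \<noteq> {}"
      using visit_conn[OF assms(1) v] by auto
    moreover from this have "\<forall>i<k. T \<inter> A i \<noteq> {}" "T \<noteq> {}"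
      by auto
    ultimately show ?thesis
      using \<open>t < r\<close> by (intro disjI1 exI[of _ T]) simp
  qed
next
  case False
  then have far: "r \<le> t" if "visit E D A (k - 1) t v" for t v
    using that not_le by blast
  have "0 < k"
    using False by simp
  define L where "L i j = {v\<in>D. visit E D A i j v \<and> (\<forall>t<j. \<not> visit E D A i t v)}" for i j
  define Z where "Z j = (\<Union>i<k. L i j)" for j
  have "(\<Sum>j<r. card (Z j)) \<le> (\<Sum>j<r. \<Sum>i<k. card (L i j))"
    unfolding Z_def by (intro sum_mono card_UN_le) auto
  also have "\<dots> = (\<Sum>i<k. \<Sum>j<r. card (L i j))"
    by (rule sum.swap)
  also have "\<dots> = (\<Sum>i<k. card (\<Union>j<r. L i j))"
  proof (intro sum.cong refl card_UN_disjoint[symmetric])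
    show "\<forall>j\<in>{..<r}. \<forall>j'\<in>{..<r}. j \<noteq> j' \<longrightarrow> L i j \<inter> L i j' = {}" for i
      unfolding L_def by (auto simp: nat_neq_iff)
  qed (use assms(2) in \<open>auto simp: L_def\<close>)
  also have "\<dots> \<le> (\<Sum>i<k. card D)"
    by (intro sum_mono card_mono assms) (auto simp: L_def)
  finally have total: "(\<Sum>j<r. card (Z j)) \<le> k * card D"
    by simp
  have "\<exists>j<r. r * card (Z j) \<le> k * card D"
  proof (rule ccontr)
    assume none: "\<not> ?thesis"
    have "k * card D < r * card (Z j)" if "j < r" for j
      using that none not_le by blast
    then have "(\<Sum>j<r. k * card D) < (\<Sum>j<r. r * card (Z j))"
      using assms(4) by (intro sum_strict_mono) auto
    then show False
      using total assms(4) by (simp add: sum_distrib_left[symmetric])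
  qed
  then obtain j where j: "j < r" "r * card (Z j) \<le> k * card D"
    by blast
  have "\<exists>i<k. U \<inter> A i = {}" if U: "U \<subseteq> D - Z j" "conn E U" for U
  proof (rule ccontr)
    assume "\<not> ?thesis"
    then have meet: "U \<inter> A i \<noteq> {}" if "i < k" for i
      using that by blast
    define near where "near i v \<longleftrightarrow> (\<exists>t<j. visit E D A i t v)" for i v
    \<comment> \<open>Distance exactly \<open>j\<close> would put \<open>v\<close> into
      \<open>Z j\<close>. So along an edge of \<open>U\<close>, where the distance grows by at most
      one, it cannot pass from below \<open>j\<close> to \<open>j\<close> or beyond.\<close>
    have least: "near i v" if "visit E D A i t v" "t \<le> j" "v \<in> U" "i < k" for i t v
    proof (rule ccontr)
      assume *: "\<not> near i v"
      then have "t = j"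
        using that unfolding near_def by (metis le_neq_implies_less)
      then have "v \<in> L i j"
        using that * U unfolding near_def L_def by auto
      then show False
        using that U unfolding Z_def by blast
    qed
    have spread: "\<forall>v\<in>U. near i v" if "u \<in> U" "near i u" "i < k" for i u
    proof -
      have "U \<subseteq> {v. near i v}"
      proof (rule conn_subset_closed[OF U(2) that(1)])
        fix x y assume "x \<in> {v. near i v}" and xy: "y \<in> U" "(x, y) \<in> E"
        then obtain t where t: "t < j" "visit E D A i t x"
          unfolding near_def by blast
        have "visit E D A i (Suc t) y"
          using visit.step[OF t(2) xy(2)] xy(1) U(1) by blast
        then show "y \<in> {v. near i v}"
          using least[of i "Suc t" y] t(1) xy(1) that(3) by simp
      qed (use that in simp)
      then show ?thesis
        by blast
    qed
    have "\<forall>v\<in>U. near i v" if "i < k" for i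
      using that
    proof (induction i)
      case 0
      obtain u where u: "u \<in> U" "u \<in> A 0"
        using meet \<open>0 < k\<close> by blast
      have "near 0 u"
        using u U \<open>0 < k\<close> by (intro least[of 0 0 u]) (auto intro: visit.start)
      then show ?case
        using spread[OF u(1)] \<open>0 < k\<close> by blast
    next
      case (Suc i)
      obtain u where u: "u \<in> U" "u \<in> A (Suc i)"
        using meet Suc.prems by blast
      \<comment> \<open>Switching layers costs no step, so nearness survives at a vertex of
        \<open>A (Suc i)\<close>.\<close>
      then have "near (Suc i) u"
        using Suc unfolding near_def by (auto intro: visit.switch)
      then show ?case
        using spread[OF u(1)] Suc.prems by blast
    qed
    then have "\<forall>v\<in>U. near (k - 1) v"
      using \<open>0 < k\<close> by simp
    moreover obtain u where "u \<in> U"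
      using meet[OF \<open>0 < k\<close>] by blast
    ultimately obtain t where "t < j" "visit E D A (k - 1) t u"
      unfolding near_def by blast
    then show False
      using far j(1) by fastforce
  qed
  then show ?thesis
    using j by (intro disjI2 exI[of _ "Z j"]) (auto simp: Z_def L_def)
qed

section \<open>Models of complete graphs, given by their branch sets, and the descent that finds
  one\<close>

definition minor_model :: "('v \<times> 'v) set \<Rightarrow> 'v set \<Rightarrow> 'v set set \<Rightarrow> bool" where
  "minor_model E V F \<longleftrightarrow> finite F \<and> (\<forall>C\<in>F. C \<noteq> {} \<and> C \<subseteq> V \<and> conn E C) \<and>
     (\<forall>C\<in>F. \<forall>C'\<in>F. C \<noteq> C' \<longrightarrow> C \<inter> C' = {} \<and> (\<exists>u\<in>C. \<exists>v\<in>C'. (u, v) \<in> E))"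

lemma minor_model_subset: "minor_model E V F \<Longrightarrow> F' \<subseteq> F \<Longrightarrow> minor_model E V F'"
  unfolding minor_model_def by (meson finite_subset subsetD)

lemma minor_model_insert:
  assumes "minor_model E V F" "sym E" "T \<noteq> {}" "T \<subseteq> V" "conn E T" "T \<inter> \<Union>F = {}"
    and "\<And>C. C \<in> F \<Longrightarrow> \<exists>u\<in>C. \<exists>v\<in>T. (u, v) \<in> E"
  shows "minor_model E V (insert T F)"
proof -
  have "T \<inter> C = {} \<and> C \<inter> T = {} \<and> (\<exists>u\<in>C. \<exists>v\<in>T. (u, v) \<in> E) \<and> (\<exists>u\<in>T. \<exists>v\<in>C. (u, v) \<in> E)"
    if "C \<in> F" for C
    using assms(6) assms(7)[OF that] symD[OF assms(2)] that by blast
  then show ?thesis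
    using assms(1,3,4,5) unfolding minor_model_def by auto
qed

text \<open>This describes a failure of the separator theorem, heavy meaning more than half of the
  weight. A covey removes at most \<open>5 * b\<close> vertices and a step adds at most
  \<open>b\<close>, which stays within \<open>7 * b\<close>. With at most five branch sets,
  \<open>connect_or_separate\<close> yields a cutset of at most \<open>5 * card V / b\<close>
  vertices, and the bound on \<open>card V\<close> makes this at most \<open>b\<close>.\<close>

locale heavy_components =
  fixes E :: "('v \<times> 'v) set" and V :: "'v set" and heavy :: "'v set \<Rightarrow> bool" and b :: nat
  assumes sym: "sym E" and fin: "finite V" and b: "0 < b" "6 * card V \<le> b * b"
    and heavy_mono: "heavy D \<Longrightarrow> D \<subseteq> D' \<Longrightarrow> D' \<subseteq> V \<Longrightarrow> heavy D'"
    and heavy_meet: "heavy D \<Longrightarrow> heavy D' \<Longrightarrow> D \<inter> D' \<noteq> {}"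
    and heavy_ex: "S \<subseteq> V \<Longrightarrow> card S \<le> 7 * b \<Longrightarrow> \<exists>D. component E (V - S) D \<and> heavy D"
begin

text \<open>The removed set \<open>S\<close> is spread over the branch sets with a quota of
  \<open>b\<close> each, which bounds it throughout the descent. The heavy component
  \<open>D\<close> is the reserve from which branch sets are formed or enlarged.\<close>

definition covey :: "'v set set \<Rightarrow> 'v set \<Rightarrow> 'v set \<Rightarrow> bool" where
  "covey F S D \<longleftrightarrow> minor_model E V F \<and> card F \<le> 5 \<and> S \<subseteq> \<Union>F \<and> (\<forall>C\<in>F. card (S \<inter> C) \<le> b) \<and>
     component E (V - S) D \<and> heavy D \<and> D \<inter> \<Union>F = {}"

lemma card_le_covey:
  assumes "finite F" "S \<subseteq> \<Union>F" "\<And>C. C \<in> F \<Longrightarrow> card (S \<inter> C) \<le> b"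
  shows "card S \<le> card F * b"
proof -
  have "card S = card (\<Union>C\<in>F. S \<inter> C)"
    using assms(2) by (intro arg_cong[of _ _ card]) auto
  also have "\<dots> \<le> (\<Sum>C\<in>F. card (S \<inter> C))"
    by (rule card_UN_le[OF assms(1)])
  also have "\<dots> \<le> (\<Sum>C\<in>F. b)"
    by (intro sum_mono assms(3))
  finally show ?thesis
    by simp
qed

text \<open>The descent of Alon, Seymour and Thomas. A branch set without neighbours in \<open>D\<close> is dropped.
  Otherwise, either a small connected part of \<open>D\<close> touches all branch sets and becomes a new one, or a
  small cutset of \<open>D\<close> shields a heavy component from some branch set, which swallows the part of \<open>D\<close>
  on its side of the cutset.\<close>

lemma covey_step:
  assumes "covey F S D"
  shows "(\<exists>F. card F = 6 \<and> minor_model E V F) \<or>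
    (\<exists>F' S' D'. covey F' S' D' \<and> 6 * card D' + card F' < 6 * card D + card F)"
proof -
  have mm: "minor_model E V F" and F5: "card F \<le> 5" and SF: "S \<subseteq> \<Union>F"
    and Sb: "\<And>C. C \<in> F \<Longrightarrow> card (S \<inter> C) \<le> b" and D: "component E (V - S) D" "heavy D"
    and DF: "D \<inter> \<Union>F = {}"
    using assms unfolding covey_def by auto
  have finF: "finite F" and FV: "\<Union>F \<subseteq> V"
    using mm unfolding minor_model_def by auto
  have D0: "D \<noteq> {}" "D \<subseteq> V - S" "conn E D"
    and Dcl: "\<And>u v. u \<in> D \<Longrightarrow> v \<in> V - S \<Longrightarrow> (u, v) \<in> E \<Longrightarrow> v \<in> D"
    using D(1) unfolding component_def by auto
  have finS: "finite S" and finD: "finite D"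
    using finite_subset[OF _ fin] SF FV D0(2) by blast+
  have cS: "card S \<le> 5 * b"
    using card_le_covey[OF finF SF Sb] F5 by (meson le_trans mult_le_mono1)
  show ?thesis
  proof (cases "\<exists>C\<in>F. \<forall>c\<in>C. \<forall>d\<in>D. (c, d) \<notin> E")
    case True
    then obtain C where C: "C \<in> F" and none: "\<And>c d. c \<in> C \<Longrightarrow> d \<in> D \<Longrightarrow> (c, d) \<notin> E"
      by blast
    \<comment> \<open>Putting \<open>S \<inter> C\<close> back does not enlarge \<open>D\<close>,
      which has no neighbours there.\<close>
    have "component E (V - (S - C)) D"
      using D0 Dcl none symD[OF sym] unfolding component_def by blast
    moreover have "card (F - {C}) < card F"
      using C finF by (metis card_Diff1_less)
    moreover have "card ((S - C) \<inter> C') \<le> b" if "C' \<in> F" for C'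
      using card_mono[of "S \<inter> C'" "(S - C) \<inter> C'"] Sb[OF that] finS by fastforce
    moreover have "S - C \<subseteq> \<Union>(F - {C})"
      using SF by blast
    moreover have "minor_model E V (F - {C})"
      using minor_model_subset[OF mm] by blast
    ultimately have "covey (F - {C}) (S - C) D"
      using F5 D DF unfolding covey_def by auto
    then show ?thesis
      using \<open>card (F - {C}) < card F\<close> by (intro disjI2 exI) auto
  next
    case False
    then have touch: "\<exists>c\<in>C. \<exists>d\<in>D. (c, d) \<in> E" if "C \<in> F" for C
      using that by blast
    define N where "N C = {d\<in>D. \<exists>c\<in>C. (c, d) \<in> E}" for C
    obtain h where h: "bij_betw h {0..<card F} F"
      using ex_bij_betw_nat_finite[OF finF] by blast
    consider (connect) T where "T \<subseteq> D" "T \<noteq> {}" "card T \<le> b" "conn E T"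
          "\<And>C. C \<in> F \<Longrightarrow> T \<inter> N C \<noteq> {}"
      | (separate) Z where "Z \<subseteq> D" "b * card Z \<le> card F * card D"
          "\<And>U. U \<subseteq> D - Z \<Longrightarrow> conn E U \<Longrightarrow> \<exists>C\<in>F. U \<inter> N C = {}"
    proof -
      have all: "(\<forall>C\<in>F. P C) \<longleftrightarrow> (\<forall>i<card F. P (h i))" for P
        using bij_betw_ball[OF h, of P] by auto
      have ex: "(\<exists>C\<in>F. P C) \<longleftrightarrow> (\<exists>i<card F. P (h i))" for P
        using all[of "\<lambda>C. \<not> P C"] by blast
      show thesis
        using connect_or_separate[OF sym finD D0(1) b(1), of "card F" "\<lambda>i. N (h i)"]
      proof (elim disjE exE conjE)
        fix T assume T: "T \<subseteq> D" "T \<noteq> {}" "card T \<le> b" "conn E T" "\<forall>i<card F. T \<inter> N (h i) \<noteq> {}"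
        have "\<forall>C\<in>F. T \<inter> N C \<noteq> {}"
          using T(5) unfolding all[of "\<lambda>C. T \<inter> N C \<noteq> {}"] .
        then show thesis
          using connect[OF T(1-4)] by blast
      next
        fix Z assume Z: "Z \<subseteq> D" "b * card Z \<le> card F * card D"
          "\<forall>U\<subseteq>D - Z. conn E U \<longrightarrow> (\<exists>i<card F. U \<inter> N (h i) = {})"
        have "\<exists>C\<in>F. U \<inter> N C = {}" if "U \<subseteq> D - Z" "conn E U" for U
          using Z(3) that unfolding ex[of "\<lambda>C. U \<inter> N C = {}"] by blast
        then show thesis
          using separate[OF Z(1,2)] by blast
      qed
    qed
    then show ?thesis
    proof cases
      case connect
      have TF: "T \<inter> \<Union>F = {}"
        using connect DF by blast
      have mT: "minor_model E V (insert T F)"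
      proof (rule minor_model_insert[OF mm sym connect(2) _ connect(4) TF])
        show "T \<subseteq> V"
          using connect D0 by blast
        show "\<exists>u\<in>C. \<exists>v\<in>T. (u, v) \<in> E" if "C \<in> F" for C
          using connect(5)[OF that] unfolding N_def by blast
      qed
      have "T \<notin> F"
        using TF connect(2) by blast
      then have cT: "card (insert T F) = Suc (card F)"
        using finF by simp
      show ?thesis
      proof (cases "card F = 5")
        case True
        then show ?thesis
          using mT cT by auto
      next
        case False
        have "card (S \<union> T) \<le> 7 * b"
          using card_Un_le[of S T] cS connect(3) by linarith
        moreover have "S \<union> T \<subseteq> V"
          using SF FV connect(1) D0 by blast
        ultimately obtain D' where D': "component E (V - (S \<union> T)) D'" "heavy D'"
          using heavy_ex by blast
        have "D' \<subseteq> D"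
          using conn_subset_component[OF D(1), of D'] D' heavy_meet[OF D'(2) D(2)]
          unfolding component_def by blast
        moreover have "D' \<inter> T = {}"
          using D'(1) unfolding component_def by blast
        ultimately have "D' \<subset> D"
          using connect(1,2) by blast
        then have "card D' < card D"
          using finD by (rule psubset_card_mono[rotated])
        moreover have "covey (insert T F) (S \<union> T) D'"
        proof -
          have "card ((S \<union> T) \<inter> C) \<le> b" if "C \<in> F" for C
          proof -
            have "(S \<union> T) \<inter> C = S \<inter> C"
              using TF that by blast
            then show ?thesis
              using Sb[OF that] by simp
          qed
          moreover have "(S \<union> T) \<inter> T = T"
            by blast
          ultimately show ?thesis
            using mT cT False F5 SF connect(3) D' \<open>D' \<inter> T = {}\<close> \<open>D' \<subseteq> D\<close> DF unfolding covey_def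
            by auto
        qed
        ultimately show ?thesis
          using cT F5 False by (intro disjI2 exI[of _ "insert T F"] exI[of _ "S \<union> T"] exI[of _ D']) auto
      qed
    next
      case separate
      have finZ: "finite Z"
        using separate(1) finD finite_subset by blast
      have cZ: "card Z \<le> b"
      proof -
        have "card D \<le> card V"
          using D0 fin by (intro card_mono) auto
        then have "b * card Z \<le> 5 * card V"
          using separate(2) F5 by (meson le_trans mult_le_mono)
        then have "b * card Z \<le> b * b"
          using b(2) by linarith
        then show ?thesis
          using b(1) by simp
      qed
      have "card (S \<union> Z) \<le> 7 * b"
        using card_Un_le[of S Z] cS cZ by linarith
      moreover have "S \<union> Z \<subseteq> V"
        using SF FV separate(1) D0 by blast
      ultimately obtain D1 where D1: "component E (V - (S \<union> Z)) D1" "heavy D1"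
        using heavy_ex by blast
      have D1': "D1 \<noteq> {}" "conn E D1" "D1 \<inter> Z = {}" "D1 \<subseteq> V - S"
        and D1cl: "\<And>u v. u \<in> D1 \<Longrightarrow> v \<in> V - (S \<union> Z) \<Longrightarrow> (u, v) \<in> E \<Longrightarrow> v \<in> D1"
        using D1(1) unfolding component_def by blast+
      have D1D: "D1 \<subseteq> D"
        using conn_subset_component[OF D(1) D1'(2,4)] heavy_meet[OF D1(2) D(2)] by blast
      obtain C where C: "C \<in> F" "D1 \<inter> N C = {}"
        using separate(3)[of D1] D1' D1D by blast
      have Cprop: "C \<noteq> {}" "C \<subseteq> V" "conn E C" "C \<inter> D = {}"
        using mm C(1) DF unfolding minor_model_def by blast+
      \<comment> \<open>\<open>H\<close> is what \<open>C\<close> reaches in \<open>D\<close>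
        without passing through \<open>D1\<close>. It is nonempty because \<open>C\<close> has a
        neighbour in \<open>D\<close> but none in \<open>D1\<close>.\<close>
      define W where "W = C \<union> (D - D1)"
      define H where "H = {v\<in>D - D1. \<exists>c\<in>C. (c, v) \<in> (E \<inter> W \<times> W)\<^sup>*}"
      have HI: "v \<in> H" if "u \<in> C \<union> H" "v \<in> D - D1" "(u, v) \<in> E" for u v
      proof -
        have "\<exists>c\<in>C. (c, u) \<in> (E \<inter> W \<times> W)\<^sup>*"
          using that(1) unfolding H_def by blast
        moreover have "(u, v) \<in> E \<inter> W \<times> W"
          using that unfolding W_def H_def by blast
        ultimately show ?thesis
          using that(2) unfolding H_def by (blast intro: rtrancl_into_rtrancl)
      qed
      have connCH: "conn E (C \<union> H)"
      proof -
        obtain r where r: "r \<in> C"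
          using Cprop by blast
        let ?R = "(E \<inter> (C \<union> H) \<times> (C \<union> H))\<^sup>*"
        have rC: "(r, c) \<in> ?R" if "c \<in> C" for c
          by (rule rtrancl_Restr_mono[of _ _ _ C]) (use Cprop(3) r that in \<open>auto simp: conn_def\<close>)
        show ?thesis
        proof (rule conn_rootI[OF sym, where r = r])
          fix v assume "v \<in> C \<union> H"
          then show "(r, v) \<in> ?R"
          proof
            assume "v \<in> H"
            then obtain c where c: "c \<in> C" "(c, v) \<in> (E \<inter> W \<times> W)\<^sup>*"
              unfolding H_def by blast
            from c(2) have "v \<in> C \<union> H \<and> (r, v) \<in> ?R"
            proof (induction rule: rtrancl_induct)
              case base
              then show ?case
                using c(1) rC by blast
            next
              case (step y z)
              have z: "z \<in> C \<union> H"
                using HI[of y z] step unfolding W_def by blast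
              then have "(y, z) \<in> E \<inter> (C \<union> H) \<times> (C \<union> H)"
                using step by blast
              then show ?case
                using z step.IH by (blast intro: rtrancl_into_rtrancl)
            qed
            then show ?thesis
              by blast
          qed (use rC in blast)
        qed
      qed
      have HD: "H \<subseteq> D" "H \<inter> D1 = {}"
        unfolding H_def by auto
      have "H \<noteq> {}"
      proof -
        obtain c d where cd: "c \<in> C" "d \<in> D" "(c, d) \<in> E"
          using touch[OF C(1)] by blast
        then have "d \<notin> D1"
          using C(2) unfolding N_def by blast
        then show ?thesis
          using HI[of c d] cd by blast
      qed
      \<comment> \<open>Once \<open>C\<close> is enlarged to \<open>C \<union> H\<close>, the part
        of \<open>Z\<close> inside \<open>H\<close> shields \<open>D1\<close> from it and replaces
        \<open>S \<inter> C\<close>. The quota of the new branch set is respected since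
        \<open>card Z \<le> b\<close>.\<close>
      define S' where "S' = (S - C) \<union> (Z \<inter> H)"
      have "D1 \<subseteq> V - S'"
        using D1' unfolding S'_def by blast
      then obtain D' where D': "component E (V - S') D'" "D1 \<subseteq> D'"
        using ex_component[OF sym D1'(2) _ D1'(1)] by blast
      \<comment> \<open>An edge of \<open>D'\<close> that leaves \<open>D - H\<close> has three
        possible ends. In \<open>C\<close>, it puts its start into \<open>H\<close> or into
        \<open>D1 \<inter> N C\<close>. Outside \<open>C\<close> and \<open>D\<close>, it
        contradicts that \<open>D\<close> is a component. In \<open>H\<close>, a start in
        \<open>D1\<close> forces the end into \<open>Z \<inter> H\<close>, which is removed, and any
        other start already belongs to \<open>H\<close>.\<close>
      have "D' \<subseteq> D - H"
      proof -
        obtain r where r: "r \<in> D1"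
          using D1' by blast
        show ?thesis
        proof (rule conn_subset_closed[of E D' r])
          show "conn E D'" "r \<in> D'" "r \<in> D - H"
            using D' r HD D1D unfolding component_def by auto
          fix u v assume uv: "u \<in> D - H" "u \<in> D'" "v \<in> D'" "(u, v) \<in> E"
          have v: "v \<in> V" "v \<notin> S'"
            using uv(3) D'(1) unfolding component_def by auto
          have "v \<notin> C"
          proof
            assume "v \<in> C"
            then have vu: "(v, u) \<in> E"
              using symD[OF sym uv(4)] by simp
            then have "u \<in> N C"
              using uv(1) \<open>v \<in> C\<close> unfolding N_def by blast
            then show False
              using HI[of v u] uv(1) C(2) vu \<open>v \<in> C\<close> by blast
          qed
          then have "v \<in> D"
            using Dcl[of u v] uv v unfolding S'_def by blast
          moreover have "v \<notin> H"
          proof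
            assume vH: "v \<in> H"
            show False
            proof (cases "u \<in> D1")
              case True
              then have "v \<in> D1"
                using D1cl[of u v] uv(4) v vH HD(1) D0(2) unfolding S'_def by blast
              then show False
                using vH HD by blast
            next
              case False
              then show False
                using HI[of v u] uv vH symD[OF sym uv(4)] by blast
            qed
          qed
          ultimately show "v \<in> D - H"
            by blast
        qed
      qed
      have "D' \<subset> D"
        using \<open>D' \<subseteq> D - H\<close> \<open>H \<noteq> {}\<close> HD by blast
      then have "card D' < card D"
        using finD by (rule psubset_card_mono[rotated])
      moreover have "card (insert (C \<union> H) (F - {C})) = card F"
      proof -
        have "C \<union> H \<notin> F"
          using DF HD(1) \<open>H \<noteq> {}\<close> by blast
        then show ?thesis
          using card.remove[OF finF C(1)] finF by simp
      qed
      moreover have "covey (insert (C \<union> H) (F - {C})) S' D'"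
      proof -
        have "minor_model E V (insert (C \<union> H) (F - {C}))"
        proof (rule minor_model_insert[OF minor_model_subset[OF mm] sym _ _ connCH])
          show "C \<union> H \<noteq> {}" "C \<union> H \<subseteq> V"
            using Cprop HD D0 by auto
          show "(C \<union> H) \<inter> \<Union>(F - {C}) = {}"
            using mm C(1) HD(1) DF unfolding minor_model_def by blast
          show "\<exists>u\<in>C'. \<exists>v\<in>C \<union> H. (u, v) \<in> E" if "C' \<in> F - {C}" for C'
            using mm C(1) that unfolding minor_model_def by blast
        qed blast
        moreover have "S' \<subseteq> \<Union>(insert (C \<union> H) (F - {C}))"
          using SF unfolding S'_def by blast
        moreover have "card (S' \<inter> C') \<le> b" if "C' \<in> insert (C \<union> H) (F - {C})" for C'
        proof (cases "C' = C \<union> H")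
          case True
          then have "S' \<inter> C' \<subseteq> Z"
            using HD D0 unfolding S'_def by blast
          then show ?thesis
            using cZ card_mono[OF finZ] le_trans by blast
        next
          case False
          then have C': "C' \<in> F"
            using that by blast
          then have "S' \<inter> C' \<subseteq> S \<inter> C'"
            using HD DF unfolding S'_def by blast
          then show ?thesis
            using Sb[OF C'] card_mono[of "S \<inter> C'"] finS by (meson finite_Int le_trans)
        qed
        moreover have "heavy D'"
          using heavy_mono[OF D1(2) D'(2)] D'(1) unfolding component_def by blast
        moreover have "D' \<inter> \<Union>(insert (C \<union> H) (F - {C})) = {}"
          using \<open>D' \<subseteq> D - H\<close> DF C(1) by blast
        ultimately show ?thesis
          using D'(1) F5 \<open>card (insert (C \<union> H) (F - {C})) = card F\<close> unfolding covey_def by auto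
      qed
      ultimately show ?thesis
        by (intro disjI2 exI[of _ "insert (C \<union> H) (F - {C})"] exI[of _ S'] exI[of _ D']) simp
    qed
  qed
qed

theorem ex_K6_minor: "\<exists>F. card F = 6 \<and> minor_model E V F"
proof -
  \<comment> \<open>Dropping a branch set keeps \<open>D\<close>; the other steps shrink
    \<open>D\<close> and add at most one branch set. So the weighted sum decreases in every
    case.\<close>
  have "\<exists>F. card F = 6 \<and> minor_model E V F" if "covey F S D" for F S D
    using that
  proof (induction "6 * card D + card F" arbitrary: F S D rule: less_induct)
    case less
    show ?case
      using covey_step[OF less.prems] less.hyps by blast
  qed
  moreover obtain D where "component E (V - {}) D" "heavy D"
    using heavy_ex[of "{}"] by auto
  then have "covey {} {} D"
    unfolding covey_def minor_model_def by simp
  ultimately show ?thesis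
    by blast
qed

end

section \<open>Planar graphs\<close>

definition gpath :: "('v \<times> 'v) set \<Rightarrow> 'v list \<Rightarrow> bool" where
  "gpath E p \<longleftrightarrow> p \<noteq> [] \<and> distinct p \<and> successively (\<lambda>u v. (u, v) \<in> E) p"

lemma gpath_append:
  "gpath E (p @ q) \<longleftrightarrow> (p = [] \<and> gpath E q) \<or> (q = [] \<and> gpath E p) \<or>
    (gpath E p \<and> gpath E q \<and> set p \<inter> set q = {} \<and> (last p, hd q) \<in> E)"
  unfolding gpath_def by (auto simp: successively_append_iff)

lemma gpath_singleton: "gpath E [v]"
  by (simp add: gpath_def)

lemma gpath_Cons_Cons: "gpath E (u # v # p) \<longleftrightarrow> u \<notin> set (v # p) \<and> (u, v) \<in> E \<and> gpath E (v # p)"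
  unfolding gpath_def by auto

lemma gpath_split:
  assumes "gpath E (p @ v # q)"
  shows "gpath E (p @ [v])" "gpath E (v # q)"
  using assms gpath_append[of E "p @ [v]" q] gpath_append[of E p "v # q"] by auto

lemma gpath_rev: "sym E \<Longrightarrow> gpath E (rev p) \<longleftrightarrow> gpath E p"
  unfolding gpath_def successively_rev
  by (simp add: sym_def) (metis (no_types, lifting) successively_mono)

lemma conn_gpath:
  assumes "conn E U" "u \<in> U" "v \<in> U"
  obtains p where "gpath E p" "hd p = u" "last p = v" "set p \<subseteq> U"
proof -
  have "(u, v) \<in> (E \<inter> U \<times> U)\<^sup>*"
    using assms by (simp add: conn_def)
  then have "\<exists>p. gpath E p \<and> hd p = u \<and> last p = v \<and> set p \<subseteq> U"
  proof (induction rule: rtrancl_induct)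
    case base
    then show ?case
      using assms(2) by (intro exI[of _ "[u]"]) (simp add: gpath_def)
  next
    case (step y z)
    then obtain p where p: "gpath E p" "hd p = u" "last p = y" "set p \<subseteq> U"
      by blast
    have p0: "p \<noteq> []"
      using p(1) by (simp add: gpath_def)
    show ?case
    proof (cases "z \<in> set p")
      case True
      then obtain p1 p2 where p12: "p = p1 @ z # p2"
        by (meson split_list)
      moreover have "hd (p1 @ [z]) = u"
        using p(2) p12 by (cases p1) auto
      ultimately show ?thesis
        using gpath_split(1)[of E p1 z p2] p by (intro exI[of _ "p1 @ [z]"]) auto
    next
      case False
      then have "gpath E (p @ [z])"
        using p step.hyps p0 unfolding gpath_append by (simp add: gpath_singleton)
      then show ?thesis
        using p p0 step.hyps by (intro exI[of _ "p @ [z]"]) auto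
    qed
  qed
  then show thesis
    using that by blast
qed

text \<open>The centre \<open>a\<close> is the first vertex of a path from \<open>z\<close> to
  \<open>x\<close> that lies on a path from \<open>x\<close> to \<open>y\<close>. Legs may consist
  of \<open>a\<close> alone.\<close>

lemma tripod:
  assumes "conn E U" "sym E" "x \<in> U" "y \<in> U" "z \<in> U"
  obtains a p q r where "gpath E p" "gpath E q" "gpath E r" "hd p = a" "hd q = a" "hd r = a"
    "last p = x" "last q = y" "last r = z" "set p \<union> set q \<union> set r \<subseteq> U"
    "set p \<inter> set q = {a}" "set p \<inter> set r = {a}" "set q \<inter> set r = {a}"
proof -
  obtain l where l: "gpath E l" "hd l = x" "last l = y" "set l \<subseteq> U"
    using conn_gpath[OF assms(1,3,4)] by blast
  obtain m where m: "gpath E m" "hd m = z" "last m = x" "set m \<subseteq> U"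
    using conn_gpath[OF assms(1,5,3)] by blast
  have "x \<in> set l" "x \<in> set m"
    using l m unfolding gpath_def by (metis hd_in_set, metis last_in_set)
  then have "\<exists>v\<in>set m. v \<in> set l"
    by blast
  then obtain m1 a m2 where a: "m = m1 @ a # m2" "a \<in> set l" "\<forall>v\<in>set m1. v \<notin> set l"
    using split_list_first_prop[of m "\<lambda>v. v \<in> set l"] by blast
  obtain l1 l2 where l12: "l = l1 @ a # l2"
    using a(2) by (meson split_list)
  have "distinct l" "distinct m"
    using l m by (auto simp: gpath_def)
  show thesis
  proof (rule that[of "rev (l1 @ [a])" "a # l2" "rev (m1 @ [a])" a])
    show "gpath E (rev (l1 @ [a]))" "gpath E (a # l2)" "gpath E (rev (m1 @ [a]))"
      using gpath_split[of E] l(1) m(1) a(1) l12 gpath_rev[OF assms(2)] by metis+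
    show "last (rev (l1 @ [a])) = x"
      using l(2) l12 by (cases l1) auto
    show "last (a # l2) = y"
      using l(3) l12 by simp
    show "last (rev (m1 @ [a])) = z"
      using m(2) a(1) by (cases m1) auto
    show "set (rev (l1 @ [a])) \<union> set (a # l2) \<union> set (rev (m1 @ [a])) \<subseteq> U"
      using l(4) m(4) a(1) l12 by auto
    show "set (rev (l1 @ [a])) \<inter> set (a # l2) = {a}"
      using \<open>distinct l\<close> l12 by auto
    show "set (rev (l1 @ [a])) \<inter> set (rev (m1 @ [a])) = {a}"
      "set (a # l2) \<inter> set (rev (m1 @ [a])) = {a}"
      using a(3) l12 by auto
  qed simp_all
qed

definition tripod_paths :: "('v \<times> 'v) set \<Rightarrow> 'v set \<Rightarrow> (nat \<Rightarrow> 'v) \<Rightarrow> (nat \<Rightarrow> 'v list) \<Rightarrow> bool" where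
  "tripod_paths E U x P \<longleftrightarrow>
    (\<forall>i<3. gpath E (P i) \<and> hd (P i) = hd (P 0) \<and> last (P i) = x i \<and> set (P i) \<subseteq> U) \<and>
    (\<forall>i<3. \<forall>j<3. i \<noteq> j \<longrightarrow> set (P i) \<inter> set (P j) = {hd (P 0)})"

lemma ex_tripod_paths:
  fixes x :: "nat \<Rightarrow> 'v"
  assumes "conn E U" "sym E" "\<And>i. i < 3 \<Longrightarrow> x i \<in> U"
  shows "\<exists>P. tripod_paths E U x P"
proof -
  have "x 0 \<in> U" "x 1 \<in> U" "x 2 \<in> U"
    using assms(3) by auto
  then obtain a p q r where *: "gpath E p" "gpath E q" "gpath E r" "hd p = a" "hd q = a" "hd r = a"
    "last p = x 0" "last q = x 1" "last r = x 2" "set p \<union> set q \<union> set r \<subseteq> U"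
    "set p \<inter> set q = {a}" "set p \<inter> set r = {a}" "set q \<inter> set r = {a}"
    by (rule tripod[OF assms(1,2)])
  have "set q \<inter> set p = {a}" "set r \<inter> set p = {a}" "set r \<inter> set q = {a}"
    using * by (simp_all add: Int_commute)
  with * show ?thesis
    unfolding tripod_paths_def
    by (intro exI[of _ "\<lambda>i. if i = 0 then p else if i = 1 then q else r"])
      (simp add: numeral_3_eq_3 numeral_2_eq_2 All_less_Suc)
qed

section \<open>Drawings and excluded minors\<close>

definition edges :: "('g, 'w) pre_digraph \<Rightarrow> ('g \<times> 'g) set" where
  "edges G = arcs_ends G \<union> (arcs_ends G)\<inverse>"

lemma sym_edges: "sym (edges G)"
  by (auto simp: edges_def sym_def)

lemma edgesE:
  assumes "(u, v) \<in> edges G"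
  obtains e where "e \<in> arcs G" "tail G e = u \<and> head G e = v \<or> tail G e = v \<and> head G e = u"
  using assms unfolding edges_def arcs_ends_def arc_to_ends_def by auto

abbreviation simple_arc :: "(real \<Rightarrow> complex) \<Rightarrow> bool" where
  "simple_arc \<equiv> Path_Connected.arc"

locale drawing = wf_digraph G for G :: "('g, 'w) pre_digraph" +
  fixes pos :: "'g \<Rightarrow> complex" and curve :: "'w \<Rightarrow> real \<Rightarrow> complex"
  assumes inj: "inj_on pos (verts G)"
    and curve: "\<And>e. e \<in> arcs G \<Longrightarrow> simple_arc (curve e) \<and>
           pathstart (curve e) = pos (tail G e) \<and> pathfinish (curve e) = pos (head G e) \<and>
           path_image (curve e) \<inter> pos ` verts G = {pos (tail G e), pos (head G e)}"
    and cross: "\<And>e e'. e \<in> arcs G \<Longrightarrow> e' \<in> arcs G \<Longrightarrow> e \<noteq> e' \<Longrightarrow>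
           path_image (curve e) \<inter> path_image (curve e') \<subseteq> pos ` verts G"
begin

definition region :: "'g set \<Rightarrow> complex set" where
  "region S = \<Union> {path_image (curve e) | e. e \<in> arcs G \<and> tail G e \<in> S \<and> head G e \<in> S}"

lemma region_mono: "S \<subseteq> S' \<Longrightarrow> region S \<subseteq> region S'"
  unfolding region_def by blast

text \<open>Sets with at most one common vertex share no arc, as the ends of a simple arc differ. So
  curves of the two sets can meet only at vertices. In this form, disjointness of vertex sets passes
  to the drawing.\<close>

lemma region_Int:
  assumes "S \<inter> S' \<subseteq> {x}"
  shows "region S \<inter> region S' \<subseteq> pos ` (S \<inter> S')"
proof
  fix z assume "z \<in> region S \<inter> region S'"
  then obtain e e' where e: "e \<in> arcs G" "tail G e \<in> S" "head G e \<in> S" "z \<in> path_image (curve e)"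
    and e': "e' \<in> arcs G" "tail G e' \<in> S'" "head G e' \<in> S'" "z \<in> path_image (curve e')"
    unfolding region_def by blast
  have "tail G e \<noteq> head G e"
    using curve[OF e(1)] arc_distinct_ends[of "curve e"] by metis
  then have "e \<noteq> e'"
    using assms e e' by blast
  then have z: "z \<in> pos ` verts G"
    using cross[OF e(1) e'(1)] e(4) e'(4) by blast
  have "z \<in> {pos (tail G e), pos (head G e)}" "z \<in> {pos (tail G e'), pos (head G e')}"
    using z curve[OF e(1)] curve[OF e'(1)] e(4) e'(4) by blast+
  then obtain v v' where v: "v \<in> {tail G e, head G e}" "v' \<in> {tail G e', head G e'}" "z = pos v" "z = pos v'"
    by blast
  then have "v = v'"
    using inj_onD[OF inj, of v v'] e(1) e'(1) tail_in_verts head_in_verts by auto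
  then have "v \<in> S \<inter> S'"
    using v(1,2) e(2,3) e'(2,3) by auto
  then show "z \<in> pos ` (S \<inter> S')"
    unfolding v(3) by (rule imageI)
qed

lemma arc_of_edge:
  assumes "(u, v) \<in> edges G"
  obtains g where "simple_arc g" "pathstart g = pos u" "pathfinish g = pos v"
    "path_image g \<subseteq> region {u, v}"
proof -
  obtain e where e: "e \<in> arcs G" "tail G e = u \<and> head G e = v \<or> tail G e = v \<and> head G e = u"
    using assms by (rule edgesE)
  have img: "path_image (curve e) \<subseteq> region {u, v}"
    unfolding region_def using e by blast
  from e(2) show thesis
  proof
    assume "tail G e = u \<and> head G e = v"
    then show thesis
      using that[of "curve e"] curve[OF e(1)] img by simp
  next
    assume "tail G e = v \<and> head G e = u"
    then show thesis
      using that[of "reversepath (curve e)"] curve[OF e(1)] img by (simp add: arc_reversepath)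
  qed
qed

lemma arc_of_gpath:
  assumes "gpath (edges G) p" "2 \<le> length p"
  shows "\<exists>g. simple_arc g \<and> pathstart g = pos (hd p) \<and> pathfinish g = pos (last p) \<and>
    path_image g \<subseteq> region (set p)"
  using assms
proof (induction p rule: induct_list012)
  case (3 u v p)
  have uv: "u \<notin> set (v # p)" "(u, v) \<in> edges G" "gpath (edges G) (v # p)"
    using "3.prems" unfolding gpath_Cons_Cons by auto
  obtain c where c: "simple_arc c" "pathstart c = pos u" "pathfinish c = pos v"
    "path_image c \<subseteq> region {u, v}"
    using uv(2) by (rule arc_of_edge)
  show ?case
  proof (cases p)
    case Nil
    then show ?thesis
      using c by auto
  next
    case (Cons w q)
    then obtain g where g: "simple_arc g" "pathstart g = pos v" "pathfinish g = pos (last (v # p))"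
      "path_image g \<subseteq> region (set (v # p))"
      using "3.IH"(2) uv(3) by auto
    have "region {u, v} \<inter> region (set (v # p)) \<subseteq> pos ` ({u, v} \<inter> set (v # p))"
      using uv(1) by (intro region_Int[of _ _ v]) auto
    also have "\<dots> \<subseteq> {pos v}"
      using uv(1) by auto
    finally have "path_image c \<inter> path_image g \<subseteq> {pathstart g}"
      using c g by auto
    then have "simple_arc (c +++ g)"
      using c g by (intro arc_join) auto
    moreover have "path_image (c +++ g) \<subseteq> region (set (u # v # p))"
      using c g region_mono[of "{u, v}" "set (u # v # p)"] region_mono[of "set (v # p)" "set (u # v # p)"]
      by (subst path_image_join) auto
    ultimately show ?thesis
      using c g by (intro exI[of _ "c +++ g"]) auto
  qed
qed simp_all

text \<open>In each branch set a tripod joins the ends of three chosen edges to a centre. Two legs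
  and the edge between them form a path from the centre of \<open>A i\<close> to that of
  \<open>B j\<close>, and any two of these nine paths share at most a common centre. Their drawings
  are a forbidden configuration of \<open>K33_not_planar\<close>.\<close>

theorem no_K33_minor:
  fixes A B :: "nat \<Rightarrow> 'g set"
  assumes conn: "\<And>i. i < 3 \<Longrightarrow> conn (edges G) (A i)" "\<And>j. j < 3 \<Longrightarrow> conn (edges G) (B j)"
    and AA: "\<And>i i'. i < 3 \<Longrightarrow> i' < 3 \<Longrightarrow> i \<noteq> i' \<Longrightarrow> A i \<inter> A i' = {}"
    and BB: "\<And>i i'. i < 3 \<Longrightarrow> i' < 3 \<Longrightarrow> i \<noteq> i' \<Longrightarrow> B i \<inter> B i' = {}"
    and AB: "\<And>i j. i < 3 \<Longrightarrow> j < 3 \<Longrightarrow> A i \<inter> B j = {}"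
    and edge: "\<And>i j. i < 3 \<Longrightarrow> j < 3 \<Longrightarrow> \<exists>u\<in>A i. \<exists>v\<in>B j. (u, v) \<in> edges G"
  shows False
proof -
  define z where "z i j = (SOME z. fst z \<in> A i \<and> snd z \<in> B j \<and> z \<in> edges G)" for i j
  have z: "fst (z i j) \<in> A i \<and> snd (z i j) \<in> B j \<and> z i j \<in> edges G" if "i < 3" "j < 3" for i j
    unfolding z_def by (rule someI_ex) (use edge[OF that] in auto)
  define P where "P i = (SOME P. tripod_paths (edges G) (A i) (\<lambda>j. fst (z i j)) P)" for i
  have P: "tripod_paths (edges G) (A i) (\<lambda>j. fst (z i j)) (P i)" if "i < 3" for i
    unfolding P_def
    by (rule someI_ex[OF ex_tripod_paths[OF conn(1)[OF that] sym_edges]]) (use z that in simp)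
  define R where "R j = (SOME P. tripod_paths (edges G) (B j) (\<lambda>i. snd (z i j)) P)" for j
  have R: "tripod_paths (edges G) (B j) (\<lambda>i. snd (z i j)) (R j)" if "j < 3" for j
    unfolding R_def
    by (rule someI_ex[OF ex_tripod_paths[OF conn(2)[OF that] sym_edges]]) (use z that in simp)
  note P = P[unfolded tripod_paths_def] and R = R[unfolded tripod_paths_def]
  define p where "p i j = P i j @ rev (R j i)" for i j
  have Pij: "gpath (edges G) (P i j)" "hd (P i j) = hd (P i 0)" "last (P i j) = fst (z i j)" "set (P i j) \<subseteq> A i"
    and Rji: "gpath (edges G) (R j i)" "hd (R j i) = hd (R j 0)" "last (R j i) = snd (z i j)" "set (R j i) \<subseteq> B j"
    if "i < 3" "j < 3" for i j
    using conjunct1[OF P[OF that(1)], rule_format, OF that(2)] conjunct1[OF R[OF that(2)], rule_format, OF that(1)]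
    by simp_all
  have nonempty: "P i j \<noteq> []" "R j i \<noteq> []" if "i < 3" "j < 3" for i j
    using Pij(1)[OF that] Rji(1)[OF that] by (auto simp: gpath_def)
  have p: "gpath (edges G) (p i j)" "2 \<le> length (p i j)" "hd (p i j) = hd (P i 0)"
    "last (p i j) = hd (R j 0)" if ij: "i < 3" "j < 3" for i j
  proof -
    have "set (P i j) \<inter> set (R j i) = {}"
      using Pij(4)[OF ij] Rji(4)[OF ij] AB[OF ij] by blast
    then show "gpath (edges G) (p i j)" "hd (p i j) = hd (P i 0)" "last (p i j) = hd (R j 0)"
      using z[OF ij] nonempty[OF ij] Pij(1-3)[OF ij] Rji(1-3)[OF ij] unfolding p_def
      by (simp_all add: gpath_append gpath_rev[OF sym_edges] hd_rev last_rev)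
    show "2 \<le> length (p i j)"
      using nonempty[OF ij] unfolding p_def by (cases "P i j"; cases "R j i") auto
  qed
  define \<gamma> where "\<gamma> i j = (SOME g. simple_arc g \<and> pathstart g = pos (hd (p i j)) \<and>
    pathfinish g = pos (last (p i j)) \<and> path_image g \<subseteq> region (set (p i j)))" for i j
  have \<gamma>: "simple_arc (\<gamma> i j) \<and> pathstart (\<gamma> i j) = pos (hd (p i j)) \<and>
    pathfinish (\<gamma> i j) = pos (last (p i j)) \<and> path_image (\<gamma> i j) \<subseteq> region (set (p i j))"
    if "i < 3" "j < 3" for i j
    unfolding \<gamma>_def by (rule someI_ex[OF arc_of_gpath]) (use p that in auto)
  have img: "path_image (\<gamma> i j) \<inter> path_image (\<gamma> i' j') \<subseteq> pos ` (set (p i j) \<inter> set (p i' j'))"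
    if "i < 3" "j < 3" "i' < 3" "j' < 3" "set (p i j) \<inter> set (p i' j') \<subseteq> {x}" for i j i' j' x
    using \<gamma>[of i j] \<gamma>[of i' j'] region_Int[OF that(5)] that by blast
  have p_set: "set (p i j) = set (P i j) \<union> set (R j i)" for i j
    unfolding p_def by simp
  have row: "set (p i j) \<inter> set (p i j') \<subseteq> {hd (P i 0)}" if "i < 3" "j < 3" "j' < 3" "j \<noteq> j'" for i j j'
  proof -
    have "set (P i j) \<inter> set (P i j') = {hd (P i 0)}"
      using conjunct2[OF P[OF that(1)], rule_format, OF that(2,3,4)] .
    then show ?thesis
      using Pij(4)[of i j] Pij(4)[of i j'] Rji(4)[of i j] Rji(4)[of i j'] AB[of i j] AB[of i j'] BB[of j j'] that
      unfolding p_set by blast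
  qed
  have col: "set (p i j) \<inter> set (p i' j) \<subseteq> {hd (R j 0)}" if "i < 3" "i' < 3" "j < 3" "i \<noteq> i'" for i i' j
  proof -
    have "set (R j i) \<inter> set (R j i') = {hd (R j 0)}"
      using conjunct2[OF R[OF that(3)], rule_format, OF that(1,2,4)] .
    then show ?thesis
      using Pij(4)[of i j] Pij(4)[of i' j] Rji(4)[of i j] Rji(4)[of i' j] AB[of i j] AB[of i' j] AA[of i i'] that
      unfolding p_set by blast
  qed
  have other: "set (p i j) \<inter> set (p i' j') = {}"
    if "i < 3" "i' < 3" "j < 3" "j' < 3" "i \<noteq> i'" "j \<noteq> j'" for i i' j j'
    using Pij(4)[of i j] Pij(4)[of i' j'] Rji(4)[of i j] Rji(4)[of i' j'] AB[of i j'] AB[of i' j] AA[of i i'] BB[of j j'] that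
    unfolding p_set by blast
  show False
  proof (rule K33_not_planar[of \<gamma> "\<lambda>i. pos (hd (P i 0))" "\<lambda>j. pos (hd (R j 0))"])
    show "simple_arc (\<gamma> i j)" "pathstart (\<gamma> i j) = pos (hd (P i 0))"
      "pathfinish (\<gamma> i j) = pos (hd (R j 0))" if "i < 3" "j < 3" for i j
      using \<gamma>[OF that] p(3,4)[OF that] by auto
    show "path_image (\<gamma> i j) \<inter> path_image (\<gamma> i j') \<subseteq> {pos (hd (P i 0))}"
      if "i < 3" "j < 3" "j' < 3" "j \<noteq> j'" for i j j'
      using img[OF that(1,2,1,3) row[OF that]] row[OF that] by blast
    show "path_image (\<gamma> i j) \<inter> path_image (\<gamma> i' j) \<subseteq> {pos (hd (R j 0))}"
      if "i < 3" "i' < 3" "j < 3" "i \<noteq> i'" for i i' j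
      using img[OF that(1,3,2,3) col[OF that]] col[OF that] by blast
    show "path_image (\<gamma> i j) \<inter> path_image (\<gamma> i' j') = {}"
      if "i < 3" "i' < 3" "j < 3" "j' < 3" "i \<noteq> i'" "j \<noteq> j'" for i i' j j'
      \<comment> \<open>The vertex sets are disjoint, so any vertex serves as the possible common
        one.\<close>
      using img[OF that(1,3,2,4), of undefined] other[OF that] by simp
  qed
qed

theorem no_K6_minor:
  assumes "minor_model (edges G) V F"
  shows "card F \<noteq> 6"
proof
  assume "card F = 6"
  moreover have "finite F"
    using assms by (simp add: minor_model_def)
  ultimately obtain h :: "nat \<Rightarrow> 'g set" where h: "bij_betw h {0..<6} F"
    using ex_bij_betw_nat_finite by metis
  have hF: "h i \<in> F" if "i < 6" for i
    using h that by (auto dest: bij_betwE)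
  have h_ne: "h i \<noteq> h j" if "i < 6" "j < 6" "i \<noteq> j" for i j :: nat
    using bij_betw_imp_inj_on[OF h] that by (auto dest: inj_onD)
  have ij: "h i \<inter> h j = {}" "\<exists>u\<in>h i. \<exists>v\<in>h j. (u, v) \<in> edges G" if "i < 6" "j < 6" "i \<noteq> j" for i j
    using assms hF[OF that(1)] hF[OF that(2)] h_ne[OF that] unfolding minor_model_def by blast+
  show False
    by (rule no_K33_minor[of h "\<lambda>j. h (3 + j)"])
      (use assms hF ij in \<open>auto simp: minor_model_def\<close>)
qed

end

lemma planar_no_K6_minor:
  fixes G :: "('g, 'w) pre_digraph"
  assumes "planar G" "wf_digraph G" "minor_model (edges G) V F"
  shows "card F \<noteq> 6"
proof -
  obtain pos :: "'g \<Rightarrow> complex" and curve :: "'w \<Rightarrow> real \<Rightarrow> complex" where *: "inj_on pos (verts G)"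
    "\<forall>e\<in>arcs G. simple_arc (curve e) \<and>
       pathstart (curve e) = pos (tail G e) \<and> pathfinish (curve e) = pos (head G e) \<and>
       path_image (curve e) \<inter> pos ` verts G = {pos (tail G e), pos (head G e)}"
    "\<forall>e\<in>arcs G. \<forall>e'\<in>arcs G. e \<noteq> e' \<longrightarrow>
       path_image (curve e) \<inter> path_image (curve e') \<subseteq> pos ` verts G"
    using assms(1) unfolding planar_def by (elim exE conjE)
  have "drawing G pos curve"
    by (intro drawing.intro drawing_axioms.intro assms(2) *(1) bspec[OF *(2)]
        mp[OF bspec[OF bspec[OF *(3)]]])
  then show ?thesis
    using assms(3) by (rule drawing.no_K6_minor)
qed

text \<open>Let \<open>A\<close> be a union of components of greatest weight up to one half. If the
  rest weighed more than 3/4, then \<open>A\<close> would weigh less than 1/4. Adding a component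
  \<open>C\<close> that meets \<open>W\<close> would exceed one half, so \<open>C\<close> would
  weigh more than 1/4. But \<open>C\<close> alone is also admissible, against the choice of
  \<open>A\<close>.\<close>

lemma sparse_components_balance:
  fixes E :: "('v \<times> 'v) set"
  assumes "sym E" "finite U" "finite W"
    and sparse: "\<And>D. component E U D \<Longrightarrow> 2 * card (D \<inter> W) \<le> card W"
  obtains A where "A \<subseteq> U" "\<And>u v. u \<in> A \<Longrightarrow> v \<in> U - A \<Longrightarrow> (u, v) \<notin> E"
    "2 * card (A \<inter> W) \<le> card W" "4 * card ((U - A) \<inter> W) \<le> 3 * card W"
proof -
  define closed_part where "closed_part A \<longleftrightarrow> A \<subseteq> U \<and> (\<forall>u\<in>A. \<forall>v\<in>U - A. (u, v) \<notin> E)" for A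
  define good where "good A \<longleftrightarrow> closed_part A \<and> 2 * card (A \<inter> W) \<le> card W" for A
  have "good {}"
    by (simp add: good_def closed_part_def)
  moreover have "\<forall>A. good A \<longrightarrow> card (A \<inter> W) < Suc (card W)"
    using assms(3) by (auto simp: less_Suc_eq_le intro: card_mono)
  ultimately obtain A where A: "good A" and max: "\<And>A'. good A' \<Longrightarrow> card (A' \<inter> W) \<le> card (A \<inter> W)"
    using ex_has_greatest_nat[of good "{}" "\<lambda>A. card (A \<inter> W)" "Suc (card W)"] by (metis less_imp_le)
  have AU: "A \<subseteq> U" and Acl: "\<And>u v. u \<in> A \<Longrightarrow> v \<in> U \<Longrightarrow> (u, v) \<in> E \<Longrightarrow> v \<in> A"
    using A unfolding good_def closed_part_def by blast+
  have "4 * card ((U - A) \<inter> W) \<le> 3 * card W"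
  proof (rule ccontr)
    assume big: "\<not> ?thesis"
    have "card (A \<inter> W) + card ((U - A) \<inter> W) = card ((A \<inter> W) \<union> ((U - A) \<inter> W))"
      using assms(3) by (intro card_Un_disjoint[symmetric]) auto
    also have "\<dots> \<le> card W"
      using assms(3) by (intro card_mono) auto
    finally have small: "4 * card (A \<inter> W) < card W"
      using big by linarith
    have "(U - A) \<inter> W \<noteq> {}"
      using big by auto
    then obtain w where w: "w \<in> U" "w \<notin> A" "w \<in> W"
      by blast
    obtain C where C: "component E U C" "{w} \<subseteq> C"
      using ex_component[OF assms(1) conn_singleton, of w U] w by blast
    have C': "C \<subseteq> U" "conn E C" "\<And>u v. u \<in> C \<Longrightarrow> v \<in> U \<Longrightarrow> (u, v) \<in> E \<Longrightarrow> v \<in> C"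
      using C(1) unfolding component_def by blast+
    have disj: "A \<inter> C = {}"
    proof (rule equals0I)
      fix u assume u: "u \<in> A \<inter> C"
      have "C \<subseteq> A"
        by (rule conn_subset_closed[OF C'(2), of u]) (use u Acl C'(1) in blast)+
      then show False
        using w C by blast
    qed
    have "closed_part (A \<union> C)" "closed_part C"
      using AU Acl C' unfolding closed_part_def by blast+
    have Un: "card ((A \<union> C) \<inter> W) = card (A \<inter> W) + card (C \<inter> W)"
      using disj assms(3) by (subst card_Un_disjoint[symmetric]) (auto simp: Int_Un_distrib2)
    have "0 < card (C \<inter> W)"
      using w C assms(3) by (auto simp: card_gt_0_iff)
    then have "\<not> good (A \<union> C)"
      using max[of "A \<union> C"] Un by linarith
    then have "card W < 2 * card (A \<inter> W) + 2 * card (C \<inter> W)"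
      using \<open>closed_part (A \<union> C)\<close> Un unfolding good_def by simp
    moreover have "good C"
      using sparse[OF C(1)] \<open>closed_part C\<close> unfolding good_def by simp
    then have "card (C \<inter> W) \<le> card (A \<inter> W)"
      by (rule max)
    ultimately show False
      using small by linarith
  qed
  then show thesis
    using that[of A] A unfolding good_def closed_part_def by blast
qed

text \<open>If every small \<open>S\<close> left a component with more than half of
  \<open>W\<close>, these components would be heavy sets, any two of which meet, and
  \<open>heavy_components\<close> would provide a K6 minor.\<close>

theorem planar_separator:
  fixes G :: "('g, 'w) pre_digraph"
  assumes "planar G" "fin_digraph G" "0 < b" "6 * card (verts G) \<le> b * b" "W \<subseteq> verts G"
  obtains A B S where "verts G = A \<union> B \<union> S" "A \<inter> B = {}" "A \<inter> S = {}" "B \<inter> S = {}"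
    "card S \<le> 7 * b" "\<And>u v. u \<in> A \<Longrightarrow> v \<in> B \<Longrightarrow> (u, v) \<notin> edges G"
    "2 * card (A \<inter> W) \<le> card W" "4 * card (B \<inter> W) \<le> 3 * card W"
proof -
  interpret fin_digraph G
    by (rule assms)
  have finW: "finite W"
    by (rule finite_subset[OF assms(5) finite_verts])
  have "\<exists>S\<subseteq>verts G. card S \<le> 7 * b \<and>
    (\<forall>D. component (edges G) (verts G - S) D \<longrightarrow> 2 * card (D \<inter> W) \<le> card W)"
  proof (rule ccontr)
    assume none: "\<not> ?thesis"
    have "heavy_components (edges G) (verts G) (\<lambda>D. card W < 2 * card (D \<inter> W)) b"
    proof
      show "card W < 2 * card (D' \<inter> W)" if "card W < 2 * card (D \<inter> W)" "D \<subseteq> D'" for D D'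
        using that card_mono[of "D' \<inter> W" "D \<inter> W"] finW by fastforce
      show "D \<inter> D' \<noteq> {}" if "card W < 2 * card (D \<inter> W)" "card W < 2 * card (D' \<inter> W)" for D D'
      proof
        assume "D \<inter> D' = {}"
        then have "card (D \<inter> W) + card (D' \<inter> W) = card ((D \<inter> W) \<union> (D' \<inter> W))"
          using finW by (intro card_Un_disjoint[symmetric]) auto
        also have "\<dots> \<le> card W"
          using finW by (intro card_mono) auto
        finally show False
          using that by linarith
      qed
      show "\<exists>D. component (edges G) (verts G - S) D \<and> card W < 2 * card (D \<inter> W)"
        if "S \<subseteq> verts G" "card S \<le> 7 * b" for S
        using none that not_less by blast
    qed (use assms sym_edges in auto)
    then obtain F where "card F = 6" "minor_model (edges G) (verts G) F"
      using heavy_components.ex_K6_minor by blast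
    then show False
      using planar_no_K6_minor[OF assms(1) wf_digraph_axioms] by blast
  qed
  then obtain S where S: "S \<subseteq> verts G" "card S \<le> 7 * b"
    "\<And>D. component (edges G) (verts G - S) D \<Longrightarrow> 2 * card (D \<inter> W) \<le> card W"
    by blast
  have "finite (verts G - S)"
    by simp
  then obtain A where "A \<subseteq> verts G - S" "\<And>u v. u \<in> A \<Longrightarrow> v \<in> verts G - S - A \<Longrightarrow> (u, v) \<notin> edges G"
    "2 * card (A \<inter> W) \<le> card W" "4 * card ((verts G - S - A) \<inter> W) \<le> 3 * card W"
    using sparse_components_balance[OF sym_edges _ finW S(3)] by blast
  then show thesis
    using S(1,2) by (intro that[of A "verts G - S - A" S]) blast+
qed

section \<open>Bilinear forms of separated circuits\<close>

text \<open>If this fails, the diagonal form with entries \<open>d\<close> vanishes on the product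
  of the common kernels of \<open>\<Phi>\<close> and of \<open>\<Psi>\<close>, and so has rank at
  most \<open>length \<Phi> + length \<Psi>\<close>. This expresses a rank bound without matrix
  rank.\<close>

definition nonzero_on_kernels :: "'i set \<Rightarrow> ('i \<Rightarrow> 'a::field) \<Rightarrow> ('i \<Rightarrow> 'a) list \<Rightarrow> ('i \<Rightarrow> 'a) list \<Rightarrow> bool" where
  "nonzero_on_kernels T d \<Phi> \<Psi> \<longleftrightarrow> (\<exists>w z. (\<forall>\<phi>\<in>set \<Phi>. (\<Sum>t\<in>T. \<phi> t * w t) = 0) \<and>
     (\<forall>\<psi>\<in>set \<Psi>. (\<Sum>t\<in>T. \<psi> t * z t) = 0) \<and> (\<Sum>t\<in>T. d t * w t * z t) \<noteq> 0)"

lemma nonzero_on_kernels_swap: "nonzero_on_kernels T d \<Phi> \<Psi> \<Longrightarrow> nonzero_on_kernels T d \<Psi> \<Phi>"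
proof -
  assume "nonzero_on_kernels T d \<Phi> \<Psi>"
  then obtain w z where "\<forall>\<phi>\<in>set \<Phi>. (\<Sum>t\<in>T. \<phi> t * w t) = 0" "\<forall>\<psi>\<in>set \<Psi>. (\<Sum>t\<in>T. \<psi> t * z t) = 0"
    "(\<Sum>t\<in>T. d t * w t * z t) \<noteq> 0"
    unfolding nonzero_on_kernels_def by blast
  moreover have "(\<Sum>t\<in>T. d t * z t * w t) = (\<Sum>t\<in>T. d t * w t * z t)"
    by (simp add: mult.commute mult.left_commute)
  ultimately show ?thesis
    unfolding nonzero_on_kernels_def by (intro exI[of _ z] exI[of _ w]) simp
qed

text \<open>One step of Gaussian elimination: \<open>\<phi>\<close> is solved for the coordinate
  \<open>w i\<close>. Setting \<open>z i = 0\<close> keeps this coordinate out of the form and of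
  the conditions in \<open>\<Psi>\<close>.\<close>

lemma nonzero_on_kernels_eliminate:
  assumes "finite T" "i \<in> T" "\<phi> i \<noteq> 0"
    and "nonzero_on_kernels (T - {i}) d (map (\<lambda>\<xi> t. \<xi> t - \<xi> i / \<phi> i * \<phi> t) \<Phi>) \<Psi>"
  shows "nonzero_on_kernels T d (\<phi> # \<Phi>) \<Psi>"
proof -
  let ?T = "T - {i}"
  obtain w z where w: "\<And>\<xi>. \<xi> \<in> set \<Phi> \<Longrightarrow> (\<Sum>t\<in>?T. (\<xi> t - \<xi> i / \<phi> i * \<phi> t) * w t) = 0"
    and z: "\<And>\<psi>. \<psi> \<in> set \<Psi> \<Longrightarrow> (\<Sum>t\<in>?T. \<psi> t * z t) = 0" and d: "(\<Sum>t\<in>?T. d t * w t * z t) \<noteq> 0"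
    using assms(4) unfolding nonzero_on_kernels_def by auto
  define c where "c = - (\<Sum>t\<in>?T. \<phi> t * w t) / \<phi> i"
  define w' z' where "w' = w(i := c)" and "z' = z(i := 0)"
  have split: "(\<Sum>t\<in>T. h t) = h i + (\<Sum>t\<in>?T. h t)" for h :: "'a \<Rightarrow> 'b"
    using assms(1,2) by (rule sum.remove)
  have sum_w': "(\<Sum>t\<in>T. \<xi> t * w' t) = \<xi> i * c + (\<Sum>t\<in>?T. \<xi> t * w t)" for \<xi>
    unfolding split w'_def by (auto intro: sum.cong)
  have "(\<Sum>t\<in>T. \<xi> t * w' t) = 0" if "\<xi> \<in> set (\<phi> # \<Phi>)" for \<xi>
  proof (cases "\<xi> = \<phi>")
    case True
    then show ?thesis
      using assms(3) unfolding sum_w' c_def by simp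
  next
    case False
    then have "(\<Sum>t\<in>?T. (\<xi> t - \<xi> i / \<phi> i * \<phi> t) * w t) = 0"
      using w that by simp
    then have "(\<Sum>t\<in>?T. \<xi> t * w t) - \<xi> i / \<phi> i * (\<Sum>t\<in>?T. \<phi> t * w t) = 0"
      by (simp add: left_diff_distrib sum_subtractf sum_distrib_left mult.assoc)
    then show ?thesis
      unfolding sum_w' c_def by simp
  qed
  moreover have "(\<Sum>t\<in>T. \<psi> t * z' t) = 0" if "\<psi> \<in> set \<Psi>" for \<psi>
  proof -
    have "(\<Sum>t\<in>?T. \<psi> t * z' t) = (\<Sum>t\<in>?T. \<psi> t * z t)"
      unfolding z'_def by (intro sum.cong) auto
    then show ?thesis
      using z[OF that] unfolding split by (simp add: z'_def)
  qed
  moreover have "(\<Sum>t\<in>T. d t * w' t * z' t) = (\<Sum>t\<in>?T. d t * w t * z t)"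
    unfolding split w'_def z'_def by (auto intro: sum.cong)
  ultimately show ?thesis
    using d unfolding nonzero_on_kernels_def by (intro exI[of _ w'] exI[of _ z']) simp
qed

text \<open>Every functional uses up at most one coordinate, and functionals vanishing on
  \<open>T\<close> use none. A coordinate survives, and its unit vector serves as \<open>w\<close>
  and as \<open>z\<close>.\<close>

lemma ex_nonzero_on_kernels:
  fixes d :: "'i \<Rightarrow> 'a::field"
  assumes "finite T" "\<And>t. t \<in> T \<Longrightarrow> d t \<noteq> 0" "length \<Phi> + length \<Psi> < card T"
  shows "nonzero_on_kernels T d \<Phi> \<Psi>"
  using assms
proof (induction "length \<Phi> + length \<Psi>" arbitrary: T \<Phi> \<Psi> rule: less_induct)
  case less
  have elim: "nonzero_on_kernels T d (\<phi> # \<Phi>') \<Psi>'"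
    if len: "Suc (length \<Phi>' + length \<Psi>') = length \<Phi> + length \<Psi>" for \<phi> \<Phi>' \<Psi>'
  proof (cases "\<exists>t\<in>T. \<phi> t \<noteq> 0")
    case True
    then obtain i where i: "i \<in> T" "\<phi> i \<noteq> 0"
      by blast
    have "nonzero_on_kernels (T - {i}) d (map (\<lambda>\<xi> t. \<xi> t - \<xi> i / \<phi> i * \<phi> t) \<Phi>') \<Psi>'"
      using len i less.prems by (intro less.hyps) auto
    then show ?thesis
      by (rule nonzero_on_kernels_eliminate[of T i \<phi> d \<Phi>' \<Psi>', OF less.prems(1) i])
  next
    case False
    have "nonzero_on_kernels T d \<Phi>' \<Psi>'"
      using len less.prems by (intro less.hyps) auto
    then show ?thesis
      using False unfolding nonzero_on_kernels_def by (auto intro!: sum.neutral exI)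
  qed
  show ?case
  proof (cases \<Phi>)
    case (Cons \<phi> \<Phi>')
    then show ?thesis
      using elim[of \<Phi>' \<Psi> \<phi>] by simp
  next
    case Phi: Nil
    show ?thesis
    proof (cases \<Psi>)
      case (Cons \<psi> \<Psi>')
      then show ?thesis
        using elim[of \<Psi>' \<Phi> \<psi>] Phi by (auto intro: nonzero_on_kernels_swap)
    next
      case Nil
      obtain i where "i \<in> T"
        using less.prems(3) by fastforce
      then have "(\<Sum>t\<in>T. d t * of_bool (t = i) * of_bool (t = i)) = d i"
        using less.prems(1) by (simp add: of_bool_def if_distrib cong: if_cong)
      then show ?thesis
        using Phi Nil less.prems(2)[OF \<open>i \<in> T\<close>] unfolding nonzero_on_kernels_def
        by (intro exI[of _ "\<lambda>t. of_bool (t = i)"]) simp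
    qed
  qed
qed

section \<open>Coefficients of squarefree monomials of degree at most two\<close>

abbreviation coef :: "('k \<Rightarrow>\<^sub>0 'b::zero) \<Rightarrow> 'k \<Rightarrow> 'b" where
  "coef \<equiv> Poly_Mapping.lookup"

lemma lookup_mult_sum:
  fixes f g :: "('v \<Rightarrow>\<^sub>0 nat) \<Rightarrow>\<^sub>0 'a::comm_semiring_1"
  assumes "finite S" "\<And>a b. a + b = k \<longleftrightarrow> (a, b) \<in> S"
  shows "coef (f * g) k = (\<Sum>(a, b)\<in>S. coef f a * coef g b)"
proof -
  have "coef (f * g) k
      = (\<Sum>(a, b). coef f a * coef g b when k = a + b)"
    by (simp add: times_poly_mapping.rep_eq prod_fun_unfold_prod)
  also have "\<dots> = (\<Sum>(a, b)\<in>S. coef f a * coef g b when k = a + b)"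
    by (intro Sum_any.expand_superset assms(1)) (auto simp: assms(2)[symmetric])
  also have "\<dots> = (\<Sum>(a, b)\<in>S. coef f a * coef g b)"
    by (intro sum.cong refl) (auto simp: assms(2)[symmetric])
  finally show ?thesis .
qed

definition var :: "'v \<Rightarrow> 'v \<Rightarrow>\<^sub>0 nat" where
  "var x = Poly_Mapping.single x 1"

lemma lookup_var [simp]: "coef (var x) y = (if y = x then 1 else 0)"
  by (simp add: var_def lookup_single)

lemma add_eq_var_iff: "a + b = var x \<longleftrightarrow> (a, b) \<in> {(var x, 0), (0, var x)}"
proof
  assume eq: "a + b = var x"
  then have sum: "coef a y + coef b y = (if y = x then 1 else 0)" for y
    by (metis lookup_add lookup_var)
  have off: "coef a y = 0 \<and> coef b y = 0" if "y \<noteq> x" for y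
    using sum[of y] that by simp
  have "coef a x = 0 \<or> coef b x = 0"
    using sum[of x] by auto
  then have "a = 0 \<or> b = 0"
  proof
    assume "coef a x = 0"
    then have "a = 0"
      using off by (intro poly_mapping_eqI) (metis lookup_zero)
    then show ?thesis ..
  next
    assume "coef b x = 0"
    then have "b = 0"
      using off by (intro poly_mapping_eqI) (metis lookup_zero)
    then show ?thesis ..
  qed
  then show "(a, b) \<in> {(var x, 0), (0, var x)}"
    using eq by auto
qed auto

lemma add_eq_var_var_iff:
  assumes "x \<noteq> y"
  shows "a + b = var x + var y \<longleftrightarrow>
    (a, b) \<in> {(var x + var y, 0), (0, var x + var y), (var x, var y), (var y, var x)}"
proof
  assume eq: "a + b = var x + var y"
  then have sum: "coef a z + coef b z = (if z = x \<or> z = y then 1 else 0)" for z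
    using assms arg_cong[OF eq, of "\<lambda>c. coef c z", unfolded lookup_add] by auto
  define on where "on i j = Poly_Mapping.single x i + Poly_Mapping.single y j" for i j :: nat
  have form: "c = on (coef c x) (coef c y)"
    if "\<And>z. z \<noteq> x \<Longrightarrow> z \<noteq> y \<Longrightarrow> coef c z = 0" for c
  proof (rule poly_mapping_eqI)
    fix z
    show "coef c z = coef (on (coef c x) (coef c y)) z"
      using that[of z] assms by (cases "z = x"; cases "z = y") (auto simp: on_def lookup_add lookup_single_not_eq)
  qed
  have "coef a z = 0 \<and> coef b z = 0" if "z \<noteq> x" "z \<noteq> y" for z
    using sum[of z] that by simp
  then have ab: "a = on (coef a x) (coef a y)"
    "b = on (coef b x) (coef b y)"
    using form by blast+
  have "coef a x = 0 \<and> coef b x = 1 \<or> coef a x = 1 \<and> coef b x = 0"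
    "coef a y = 0 \<and> coef b y = 1 \<or> coef a y = 1 \<and> coef b y = 0"
    using sum[of x] sum[of y] by auto
  then show "(a, b) \<in> {(var x + var y, 0), (0, var x + var y), (var x, var y), (var y, var x)}"
    using ab unfolding on_def var_def by (elim disjE) auto
qed (auto simp: add.commute)

lemma var_ne_0: "var x \<noteq> 0" "var x + var y \<noteq> 0"
proof -
  show "var x \<noteq> 0"
    by (metis lookup_var lookup_zero zero_neq_one)
  have "coef (var x + var y) x \<noteq> 0"
    by (simp add: lookup_add)
  then show "var x + var y \<noteq> 0"
    by auto
qed

lemma var_eq_iff: "var x = var y \<longleftrightarrow> x = y"
  by (metis lookup_var zero_neq_one)

lemma lookup_mult_0:
  fixes f g :: "('v, 'a::comm_semiring_1) mpoly"
  shows "coef (f * g) 0 = coef f 0 * coef g 0"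
proof -
  have "a + b = 0 \<longleftrightarrow> (a, b) \<in> {(0, 0)}" for a b :: "'v \<Rightarrow>\<^sub>0 nat"
  proof
    assume "a + b = 0"
    then have "coef a z + coef b z = 0" for z
      by (metis lookup_add lookup_zero)
    then have "a = 0" "b = 0"
      by (simp_all add: poly_mapping_eq_iff fun_eq_iff)
    then show "(a, b) \<in> {(0, 0)}"
      by simp
  qed auto
  then show ?thesis
    by (subst lookup_mult_sum[of "{(0, 0)}"]) auto
qed

lemma lookup_mult_var:
  fixes f g :: "('v, 'a::comm_semiring_1) mpoly"
  shows "coef (f * g) (var x) =
    coef f (var x) * coef g 0 + coef f 0 * coef g (var x)"
  by (subst lookup_mult_sum[OF _ add_eq_var_iff]) (auto simp: var_ne_0)

lemma lookup_mult_var_var: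
  fixes f g :: "('v, 'a::comm_semiring_1) mpoly"
  assumes "x \<noteq> y"
  shows "coef (f * g) (var x + var y) =
    coef f (var x + var y) * coef g 0 +
    coef f 0 * coef g (var x + var y) +
    coef f (var x) * coef g (var y) +
    coef f (var y) * coef g (var x)"
  using assms var_ne_0[symmetric]
  by (subst lookup_mult_sum[OF _ add_eq_var_var_iff[OF assms]]) (simp_all add: var_ne_0 var_eq_iff add.assoc)

lemma pvar_eq: "pvar v = Poly_Mapping.single (var v) 1"
  by (simp add: pvar_def var_def)

lemma var_ne_var_add: "x \<noteq> y \<Longrightarrow> var v \<noteq> var x + var y"
proof
  assume "x \<noteq> y" "var v = var x + var y"
  then have "coef (var v) z = coef (var x) z + coef (var y) z" for z
    by (simp only: lookup_add)
  then have "(if x = v then 1 else 0 :: nat) = 1" "(if y = v then 1 else 0 :: nat) = 1"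
    using \<open>x \<noteq> y\<close> by (metis add.right_neutral lookup_var, metis add.left_neutral lookup_var)
  then show False
    using \<open>x \<noteq> y\<close> by (metis zero_neq_one)
qed

lemma lookup_pvar:
  "coef (pvar v :: ('v, 'a::zero_neq_one) mpoly) 0 = 0"
  "coef (pvar v :: ('v, 'a::zero_neq_one) mpoly) (var x) = (if x = v then 1 else 0)"
  "x \<noteq> y \<Longrightarrow> coef (pvar v :: ('v, 'a::zero_neq_one) mpoly) (var x + var y) = 0"
  by (auto simp: pvar_eq lookup_single when_def var_eq_iff var_ne_0 dest: var_ne_var_add)

lemma lookup_pconst:
  "coef (pconst c :: ('v, 'a::zero_neq_one) mpoly) 0 = c"
  "coef (pconst c :: ('v, 'a::zero_neq_one) mpoly) (var x) = 0"
  "coef (pconst c :: ('v, 'a::zero_neq_one) mpoly) (var x + var y) = 0"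
  by (auto simp: pconst_def lookup_single when_def var_ne_0 var_ne_0[symmetric])

lemma lookup_sum_apply: "coef (\<Sum>e\<in>A. f e) k = (\<Sum>e\<in>A. coef (f e) k)"
  by (induction A rule: infinite_finite_induct) (simp_all add: lookup_add)

lemma lookup_bilinear_form:
  assumes "i < n" "j < n"
  shows "coef (bilinear_form n M) (var (Y i) + var (X j)) = M $$ (i, j)"
proof -
  have "coef (pvar (Y i') * pconst c * pvar (X j') :: (xy, 'a) mpoly) (var (Y i) + var (X j))
      = (if i' = i \<and> j' = j then c else 0)" for i' j' and c :: "'a::field"
    by (simp add: lookup_mult_var_var lookup_mult_var lookup_mult_0 lookup_pvar lookup_pconst)
  then have "coef (bilinear_form n M) (var (Y i) + var (X j))
      = (\<Sum>i'<n. \<Sum>j'<n. if i' = i \<and> j' = j then M $$ (i', j') else 0)"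
    by (simp add: bilinear_form_def lookup_sum_apply)
  also have "\<dots> = (\<Sum>i'<n. if i' = i then M $$ (i', j) else 0)"
    using assms by (intro sum.cong refl) auto
  also have "\<dots> = M $$ (i, j)"
    using assms by simp
  finally show ?thesis .
qed

section \<open>Coefficients after a bilinear substitution\<close>

locale bilinear_test =
  fixes K :: "(nat \<times> nat) set" and w z :: "nat \<times> nat \<Rightarrow> 'a::field"
  assumes fin: "finite K"
begin

text \<open>These are the coefficients of \<open>a\<close>, \<open>b\<close> and \<open>a b\<close> modulo \<open>a\<^sup>2\<close> and \<open>b\<^sup>2\<close> after the substitution
  \<open>x\<^sub>j = a (\<Sum> w k)\<close> (over \<open>k\<close> with \<open>snd k = j\<close>) and \<open>y\<^sub>i = b (\<Sum> z k)\<close> (over \<open>k\<close> with \<open>fst k = i\<close>).\<close>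

definition \<alpha> :: "(xy, 'a) mpoly \<Rightarrow> 'a" where
  "\<alpha> f = (\<Sum>k\<in>K. w k * coef f (var (X (snd k))))"

definition \<beta> :: "(xy, 'a) mpoly \<Rightarrow> 'a" where
  "\<beta> f = (\<Sum>k\<in>K. z k * coef f (var (Y (fst k))))"

definition \<gamma> :: "(xy, 'a) mpoly \<Rightarrow> 'a" where
  "\<gamma> f = (\<Sum>k\<in>K. \<Sum>l\<in>K. z k * w l * coef f (var (Y (fst k)) + var (X (snd l))))"

lemma \<alpha>_mult: "\<alpha> (f * g) = \<alpha> f * coef g 0 + coef f 0 * \<alpha> g"
  by (simp add: \<alpha>_def lookup_mult_var sum.distrib sum_distrib_left sum_distrib_right algebra_simps)

lemma \<beta>_mult: "\<beta> (f * g) = \<beta> f * coef g 0 + coef f 0 * \<beta> g"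
  by (simp add: \<beta>_def lookup_mult_var sum.distrib sum_distrib_left sum_distrib_right algebra_simps)

lemma \<gamma>_mult: "\<gamma> (f * g) = \<gamma> f * coef g 0 + coef f 0 * \<gamma> g + \<beta> f * \<alpha> g + \<alpha> f * \<beta> g"
proof -
  have "\<alpha> f * \<beta> g = \<beta> g * \<alpha> f"
    by (rule mult.commute)
  then show ?thesis
    by (simp add: \<gamma>_def \<alpha>_def \<beta>_def lookup_mult_var_var sum_product sum.distrib sum_distrib_left
        sum_distrib_right algebra_simps)
qed

lemma coeffs_sum:
  "\<alpha> (\<Sum>e\<in>A. f e) = (\<Sum>e\<in>A. \<alpha> (f e))" "\<beta> (\<Sum>e\<in>A. f e) = (\<Sum>e\<in>A. \<beta> (f e))"
  "\<gamma> (\<Sum>e\<in>A. f e) = (\<Sum>e\<in>A. \<gamma> (f e))"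
proof -
  show "\<alpha> (\<Sum>e\<in>A. f e) = (\<Sum>e\<in>A. \<alpha> (f e))" "\<beta> (\<Sum>e\<in>A. f e) = (\<Sum>e\<in>A. \<beta> (f e))"
    unfolding \<alpha>_def \<beta>_def lookup_sum_apply sum_distrib_left by (rule sum.swap)+
  show "\<gamma> (\<Sum>e\<in>A. f e) = (\<Sum>e\<in>A. \<gamma> (f e))"
    by (induction A rule: infinite_finite_induct) (simp_all add: \<gamma>_def lookup_add ring_distribs sum.distrib)
qed

lemma coeffs_pconst [simp]: "\<alpha> (pconst c) = 0" "\<beta> (pconst c) = 0" "\<gamma> (pconst c) = 0"
  by (simp_all add: \<alpha>_def \<beta>_def \<gamma>_def lookup_pconst)

lemma coeffs_one [simp]: "\<alpha> 1 = 0" "\<beta> 1 = 0" "\<gamma> 1 = 0"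
proof -
  have one: "(1 :: (xy, 'a) mpoly) = pconst 1"
    by (simp add: pconst_def)
  show "\<alpha> 1 = 0" "\<beta> 1 = 0" "\<gamma> 1 = 0"
    unfolding one by (rule coeffs_pconst)+
qed

lemma coeffs_pconst_mult: "\<alpha> (pconst c * f) = c * \<alpha> f" "\<beta> (pconst c * f) = c * \<beta> f" "\<gamma> (pconst c * f) = c * \<gamma> f"
  by (simp_all add: \<alpha>_mult \<beta>_mult \<gamma>_mult lookup_pconst)

lemma coeffs_pvar:
  "\<beta> (pvar (X j)) = 0" "\<alpha> (pvar (Y i)) = 0" "\<gamma> (pvar v) = 0"
  "j \<notin> snd ` K \<Longrightarrow> \<alpha> (pvar (X j)) = 0" "i \<notin> fst ` K \<Longrightarrow> \<beta> (pvar (Y i)) = 0"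
  by (force simp: \<alpha>_def \<beta>_def \<gamma>_def lookup_pvar intro!: sum.neutral)+

text \<open>Closure under products holds because each mixed term of \<open>\<gamma>_mult\<close>
  contains a \<open>\<beta>\<close>.\<close>

lemma prod_\<beta>_\<gamma>:
  assumes "\<And>e. e \<in> A \<Longrightarrow> \<beta> (f e) = 0 \<and> \<gamma> (f e) = 0"
  shows "\<beta> (\<Prod>e\<in>A. f e) = 0 \<and> \<gamma> (\<Prod>e\<in>A. f e) = 0"
  using assms by (induction A rule: infinite_finite_induct) (simp_all add: \<beta>_mult \<gamma>_mult)

lemma prod_\<alpha>_\<gamma>:
  assumes "\<And>e. e \<in> A \<Longrightarrow> \<alpha> (f e) = 0 \<and> \<gamma> (f e) = 0"
  shows "\<alpha> (\<Prod>e\<in>A. f e) = 0 \<and> \<gamma> (\<Prod>e\<in>A. f e) = 0"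
  using assms by (induction A rule: infinite_finite_induct) (simp_all add: \<alpha>_mult \<gamma>_mult)

end

text \<open>A product gate in \<open>S\<close> can multiply an \<open>x\<close> from \<open>A\<close> with a \<open>y\<close> from \<open>B\<close>. One further linear
  condition per gate of \<open>S\<close>, on the part of its product that comes from \<open>A\<close>, prevents this.\<close>

definition left_product :: "('g, 'w, 'v, 'a::field) circuit \<Rightarrow> ('g \<Rightarrow> ('v, 'a) mpoly) \<Rightarrow> 'g set \<Rightarrow> 'g \<Rightarrow> ('v, 'a) mpoly" where
  "left_product C P A g =
    (\<Prod>e\<in>{e \<in> in_arcs (underlying C) g. tail C e \<in> A}. pconst (weight C e) * P (tail C e))"

locale separated_circuit =
  fixes C :: "('g, 'w, xy, 'a::field) circuit" and A B S :: "'g set"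
  assumes circuit: "circuit C" and verts: "verts C = A \<union> B \<union> S"
    and disj: "A \<inter> B = {}" "A \<inter> S = {}" "B \<inter> S = {}"
    and no_edge: "\<And>u v. u \<in> A \<Longrightarrow> v \<in> B \<Longrightarrow> (u, v) \<notin> edges (underlying C)"
begin

sublocale G: fin_digraph "underlying C"
  using circuit by (simp add: circuit_def)

lemma underlying_simps [simp]:
  "verts (underlying C) = verts C" "arcs (underlying C) = arcs C"
  "tail (underlying C) = tail C" "head (underlying C) = head C"
  by (simp_all add: underlying_def)

lemma finite_S: "finite S"
  using G.finite_verts verts by simp

text \<open>Along the circuit, gates outside \<open>B\<close> have \<open>\<beta> = 0\<close> and
  gates outside \<open>A\<close> have \<open>\<alpha> = 0\<close>; on \<open>S\<close> both are
  assumed. Wires never join \<open>A\<close> to \<open>B\<close>, so the mixed terms of a product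
  vanish, except possibly at gates of \<open>S\<close>.\<close>

lemma gates_vanish:
  assumes "bilinear_test K" and P: "gate_polys C P"
    and labels: "\<And>g k. g \<in> verts C \<Longrightarrow> k \<in> K \<Longrightarrow> label C g = Input (X (snd k)) \<Longrightarrow> g \<in> A"
      "\<And>g k. g \<in> verts C \<Longrightarrow> k \<in> K \<Longrightarrow> label C g = Input (Y (fst k)) \<Longrightarrow> g \<in> B"
    and S: "\<And>s. s \<in> S \<Longrightarrow> bilinear_test.\<alpha> K w (P s) = 0" "\<And>s. s \<in> S \<Longrightarrow> bilinear_test.\<beta> K z (P s) = 0"
      "\<And>s. s \<in> S \<Longrightarrow> bilinear_test.\<alpha> K w (left_product C P A s) = 0"
    and "g \<in> verts C"
  shows "bilinear_test.\<gamma> K w z (P g) = 0"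
proof -
  interpret bilinear_test K w z
    by (rule assms)
  have "wf (arcs_ends (underlying C))"
  proof (rule finite_acyclic_wf)
    show "finite (arcs_ends (underlying C))"
      using G.finite_arcs by (simp add: arcs_ends_def)
    show "acyclic (arcs_ends (underlying C))"
      using circuit by (simp add: circuit_def)
  qed
  then have "g \<in> verts C \<longrightarrow> (g \<notin> B \<longrightarrow> \<beta> (P g) = 0) \<and> (g \<notin> A \<longrightarrow> \<alpha> (P g) = 0) \<and> \<gamma> (P g) = 0"
  proof (induction g rule: wf_induct_rule)
    case (less g)
    show ?case
    proof
      assume g: "g \<in> verts C"
      define q where "q e = pconst (weight C e) * P (tail C e)" for e
      let ?in = "in_arcs (underlying C) g"
      have fin_in: "finite ?in"
        by (rule G.finite_in_arcs)
      have tail: "tail C e \<in> verts C" "(tail C e, g) \<in> arcs_ends (underlying C)"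
        "(tail C e, g) \<in> edges (underlying C)" if "e \<in> ?in" for e
        using that G.tail_in_verts[of e] unfolding in_arcs_def edges_def arcs_ends_def arc_to_ends_def by auto
      have qA: "tail C e \<notin> B \<Longrightarrow> \<beta> (q e) = 0" and qB: "tail C e \<notin> A \<Longrightarrow> \<alpha> (q e) = 0" and q\<gamma>: "\<gamma> (q e) = 0"
        if "e \<in> ?in" for e
        using less.IH[OF tail(2)[OF that]] tail(1)[OF that] by (auto simp: q_def coeffs_pconst_mult)
      have sideA: "tail C e \<notin> B" if "e \<in> ?in" "g \<in> A" for e
        using no_edge[of g "tail C e"] tail(3)[OF that(1)] sym_edges[of "underlying C"] that(2)
        by (auto dest: symD)
      have sideB: "tail C e \<notin> A" if "e \<in> ?in" "g \<in> B" for e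
        using no_edge[of "tail C e" g] tail(3)[OF that(1)] that(2) by auto
      have Pg: "P g = (case label C g of Input v \<Rightarrow> pvar v | Constant c \<Rightarrow> pconst c
        | Plus \<Rightarrow> (\<Sum>e\<in>?in. q e) | Times \<Rightarrow> (\<Prod>e\<in>?in. q e))"
        using P g unfolding gate_polys_def q_def by blast
      have gS: "g \<in> S" if "g \<notin> A" "g \<notin> B"
        using g that verts by auto
      show "(g \<notin> B \<longrightarrow> \<beta> (P g) = 0) \<and> (g \<notin> A \<longrightarrow> \<alpha> (P g) = 0) \<and> \<gamma> (P g) = 0"
      proof (cases "label C g")
        case (Input v)
        show ?thesis
        proof (cases v)
          case (X j)
          have "j \<notin> snd ` K" if "g \<notin> A"
            using labels(1)[OF g] Input X that by auto
          then show ?thesis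
            using Pg Input X by (auto simp: coeffs_pvar)
        next
          case (Y i)
          have "i \<notin> fst ` K" if "g \<notin> B"
            using labels(2)[OF g] Input Y that by auto
          then show ?thesis
            using Pg Input Y by (auto simp: coeffs_pvar)
        qed
      next
        case (Constant c)
        then show ?thesis
          using Pg by simp
      next
        case Plus
        have "\<gamma> (P g) = 0"
          using Pg Plus q\<gamma> by (simp add: coeffs_sum)
        moreover have "\<beta> (P g) = 0" if "g \<notin> B"
          using Pg Plus qA sideA S(2)[OF gS] that by (cases "g \<in> A") (simp_all add: coeffs_sum)
        moreover have "\<alpha> (P g) = 0" if "g \<notin> A"
          using Pg Plus qB sideB S(1)[OF gS] that by (cases "g \<in> B") (simp_all add: coeffs_sum)
        ultimately show ?thesis
          by blast
      next
        case Times
        consider "g \<in> A" | "g \<in> B" | "g \<in> S" "g \<notin> A" "g \<notin> B"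
          using gS by blast
        then show ?thesis
        proof cases
          case 1
          then have "\<beta> (P g) = 0 \<and> \<gamma> (P g) = 0"
            using Pg Times prod_\<beta>_\<gamma>[of ?in q] qA sideA q\<gamma> by simp
          then show ?thesis
            using 1 by blast
        next
          case 2
          then have "\<alpha> (P g) = 0 \<and> \<gamma> (P g) = 0"
            using Pg Times prod_\<alpha>_\<gamma>[of ?in q] qB sideB q\<gamma> by simp
          then show ?thesis
            using 2 by blast
        next
          case 3
          \<comment> \<open>Wires from \<open>A\<close> form the left product, with
            \<open>\<beta> = \<gamma> = 0\<close>, and the others a factor with
            \<open>\<alpha> = \<gamma> = 0\<close>. In \<open>\<gamma>_mult\<close> only
            \<open>\<alpha>\<close> of the first times \<open>\<beta>\<close> of the second remains,
            and the condition on left products removes it.\<close>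
          let ?A = "{e \<in> ?in. tail C e \<in> A}" and ?R = "{e \<in> ?in. tail C e \<notin> A}"
          have "P g = (\<Prod>e\<in>?A \<union> ?R. q e)"
            using Pg Times by (auto intro: arg_cong[of _ _ "prod q"])
          also have "\<dots> = left_product C P A g * (\<Prod>e\<in>?R. q e)"
            unfolding left_product_def q_def
            by (intro prod.union_disjoint finite_subset[OF _ fin_in]) blast+
          finally have split: "P g = left_product C P A g * (\<Prod>e\<in>?R. q e)" .
          have "\<beta> (left_product C P A g) = 0 \<and> \<gamma> (left_product C P A g) = 0"
            unfolding left_product_def using qA q\<gamma> disj by (intro prod_\<beta>_\<gamma>) (auto simp: q_def)
          moreover have "\<alpha> (\<Prod>e\<in>?R. q e) = 0 \<and> \<gamma> (\<Prod>e\<in>?R. q e) = 0"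
            using qB q\<gamma> by (intro prod_\<alpha>_\<gamma>) auto
          ultimately have "\<gamma> (P g) = 0"
            using S(3)[OF 3(1)] unfolding split \<gamma>_mult by simp
          then show ?thesis
            using S(1,2)[OF 3(1)] by blast
        qed
      qed
    qed
  qed
  then show ?thesis
    using assms by blast
qed

text \<open>With more than \<open>3 * card S\<close> pairs, there are \<open>w\<close> and
  \<open>z\<close> satisfying all conditions of \<open>gates_vanish\<close> for which the diagonal
  form of the entries \<open>M $$ k\<close> is nonzero. The off-diagonal zeros make this form equal
  to \<open>\<gamma>\<close> of the output, which vanishes.\<close>

theorem induced_matching_le:
  assumes "computes C (bilinear_form n M)" and K: "K \<subseteq> {..<n} \<times> {..<n}"
    and diag: "\<And>k. k \<in> K \<Longrightarrow> M $$ k \<noteq> 0"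
    and off: "\<And>k l. k \<in> K \<Longrightarrow> l \<in> K \<Longrightarrow> k \<noteq> l \<Longrightarrow> M $$ (fst k, snd l) = 0"
    and labels: "\<And>g k. g \<in> verts C \<Longrightarrow> k \<in> K \<Longrightarrow> label C g = Input (X (snd k)) \<Longrightarrow> g \<in> A"
      "\<And>g k. g \<in> verts C \<Longrightarrow> k \<in> K \<Longrightarrow> label C g = Input (Y (fst k)) \<Longrightarrow> g \<in> B"
  shows "card K \<le> 3 * card S"
proof (rule ccontr)
  assume large: "\<not> card K \<le> 3 * card S"
  have finK: "finite K"
    using K finite_subset by blast
  obtain P where P: "gate_polys C P" "P (out_gate C) = bilinear_form n M"
    using assms(1) unfolding computes_def by blast
  obtain xs where xs: "set xs = S" "length xs = card S"
    using finite_distinct_list[OF finite_S] distinct_card by metis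
  define \<Phi> :: "(nat \<times> nat \<Rightarrow> 'a) list" where "\<Phi> = map (\<lambda>s k. coef (P s) (var (X (snd k)))) xs @
    map (\<lambda>s k. coef (left_product C P A s) (var (X (snd k)))) xs"
  define \<Psi> :: "(nat \<times> nat \<Rightarrow> 'a) list" where "\<Psi> = map (\<lambda>s k. coef (P s) (var (Y (fst k)))) xs"
  have "nonzero_on_kernels K (\<lambda>k. M $$ k) \<Phi> \<Psi>"
    using large xs finK diag by (intro ex_nonzero_on_kernels) (auto simp: \<Phi>_def \<Psi>_def)
  then obtain w z where wz: "\<forall>\<phi>\<in>set \<Phi>. (\<Sum>k\<in>K. \<phi> k * w k) = 0" "\<forall>\<psi>\<in>set \<Psi>. (\<Sum>k\<in>K. \<psi> k * z k) = 0"
    "(\<Sum>k\<in>K. M $$ k * w k * z k) \<noteq> 0"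
    unfolding nonzero_on_kernels_def by blast
  interpret bilinear_test K w z
    by standard (rule finK)
  have "\<gamma> (P (out_gate C)) = 0"
  proof (rule gates_vanish[OF bilinear_test_axioms P(1) labels])
    fix s assume "s \<in> S"
    then show "\<alpha> (P s) = 0" "\<beta> (P s) = 0" "\<alpha> (left_product C P A s) = 0"
      using wz(1,2) xs(1) unfolding \<Phi>_def \<Psi>_def \<alpha>_def \<beta>_def by (simp_all add: ball_Un mult.commute)
  qed (use circuit in \<open>auto simp: circuit_def\<close>)
  moreover have "\<gamma> (bilinear_form n M) = (\<Sum>k\<in>K. M $$ k * w k * z k)"
  proof -
    have "\<gamma> (bilinear_form n M) = (\<Sum>k\<in>K. \<Sum>l\<in>K. z k * w l * M $$ (fst k, snd l))"
      unfolding \<gamma>_def using K by (intro sum.cong refl) (subst lookup_bilinear_form, auto)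
    also have "\<dots> = (\<Sum>k\<in>K. \<Sum>l\<in>K. if l = k then M $$ k * w k * z k else 0)"
      using off by (intro sum.cong refl) auto
    also have "\<dots> = (\<Sum>k\<in>K. M $$ k * w k * z k)"
      using finK by simp
    finally show ?thesis .
  qed
  ultimately show False
    using P(2) wz(3) by simp
qed

end

section \<open>An expander on the torus\<close>

locale torus =
  fixes m :: nat
  assumes m_pos: "0 < m"
begin

abbreviation I :: "int set" where "I \<equiv> {0..<int m}"

text \<open>Functions on the integers modulo \<open>m\<close> are represented by periodic functions
  on all integers, so that shifts and shears are written without reduction.\<close>

definition periodic :: "(int \<Rightarrow> 'b) \<Rightarrow> bool" where
  "periodic h \<longleftrightarrow> (\<forall>x. h (x + int m) = h x)"

lemma periodic_mult:
  assumes "periodic h"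
  shows "h (x + int m * k) = h x"
proof (induction k arbitrary: x rule: int_induct[where k = 0])
  case (step1 i)
  have "h (x + int m * (i + 1)) = h ((x + int m * i) + int m)"
    by (simp add: algebra_simps)
  then show ?case
    using step1 assms by (simp add: periodic_def)
next
  case (step2 i)
  have "h (x + int m * (i - 1)) = h ((x + int m * (i - 1)) + int m)"
    using assms by (simp add: periodic_def)
  then show ?case
    using step2 by (simp add: algebra_simps)
qed simp

lemma periodic_mod: "periodic h \<Longrightarrow> h (x mod int m) = h x"
  using periodic_mult[of h "x mod int m" "x div int m"] by simp

lemma sum_shift:
  fixes h :: "int \<Rightarrow> 'b::comm_monoid_add"
  assumes "periodic h"
  shows "(\<Sum>x\<in>I. h (x + k)) = (\<Sum>x\<in>I. h x)"
proof -
  have "bij_betw (\<lambda>x. (x + k) mod int m) I I"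
    using m_pos
    by (intro bij_betwI[where g = "\<lambda>x. (x - k) mod int m"]) (auto simp: mod_simps)
  then have "(\<Sum>x\<in>I. h ((x + k) mod int m)) = (\<Sum>x\<in>I. h x)"
    by (rule sum.reindex_bij_betw)
  then show ?thesis
    by (simp add: periodic_mod[OF assms])
qed

lemma sum_window:
  fixes h :: "int \<Rightarrow> 'b::comm_monoid_add"
  assumes "periodic h"
  shows "(\<Sum>x\<in>{l..<l + int m}. h x) = (\<Sum>x\<in>I. h x)"
proof -
  have "(\<Sum>x\<in>I. h (x + l)) = (\<Sum>x\<in>{l..<l + int m}. h x)"
    by (rule sum.reindex_bij_witness[of _ "\<lambda>x. x - l" "\<lambda>x. x + l"]) auto
  then show ?thesis
    using sum_shift[OF assms, of l] by simp
qed

section \<open>Characters and the Fourier transform on the torus\<close>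

definition e :: "int \<Rightarrow> complex" where
  "e k = cis (2 * pi * real_of_int k / real m)"

lemma e_add: "e (j + k) = e j * e k"
  by (simp add: e_def cis_mult add_divide_distrib ring_distribs)

lemma e_0 [simp]: "e 0 = 1"
  by (simp add: e_def)

lemma cnj_e: "cnj (e k) = e (- k)"
  by (simp add: e_def cis_cnj)

lemma e_eq_1_iff: "e k = 1 \<longleftrightarrow> int m dvd k"
proof
  assume "e k = 1"
  then have "cos (2 * pi * real_of_int k / real m) = 1"
    by (simp add: e_def complex_eq_iff)
  then obtain n :: int where "2 * pi * real_of_int k / real m = real_of_int n * 2 * pi"
    using cos_one_2pi_int by blast
  then have "real_of_int k = real_of_int n * real m"
    using m_pos by (simp add: field_simps)
  then have "k = n * int m"
    by (metis of_int_eq_iff of_int_mult of_int_of_nat_eq)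
  then show "int m dvd k"
    by simp
next
  assume "int m dvd k"
  then obtain n where "k = int m * n"
    by (rule dvdE)
  then have "2 * pi * real_of_int k / real m = 2 * pi * real_of_int n"
    using m_pos by simp
  then show "e k = 1"
    by (simp add: e_def cis_multiple_2pi)
qed

lemma periodic_e: "periodic (\<lambda>x. e (a * x + b))"
proof -
  have "e (a * int m) = 1"
    by (simp add: e_eq_1_iff)
  then show ?thesis
    by (simp add: periodic_def ring_distribs e_add)
qed

lemma sum_e: "(\<Sum>a\<in>I. e (a * k)) = (if int m dvd k then of_nat m else 0)"
proof (cases "int m dvd k")
  case True
  then have "e (a * k) = 1" for a
    by (simp add: e_eq_1_iff)
  then show ?thesis
    using True by simp
next
  case False
  have "e k * (\<Sum>a\<in>I. e (a * k)) = (\<Sum>a\<in>I. e ((a + 1) * k))"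
    by (simp add: sum_distrib_left ring_distribs e_add mult.commute)
  also have "\<dots> = (\<Sum>a\<in>I. e (a * k))"
    using sum_shift[of "\<lambda>a. e (a * k)" 1] periodic_e[of k 0] by (simp add: mult.commute)
  finally show ?thesis
    using False e_eq_1_iff[of k] by simp
qed

lemma parseval_1:
  fixes g :: "int \<Rightarrow> complex"
  shows "(\<Sum>a\<in>I. (norm (\<Sum>x\<in>I. g x * e (a * x)))\<^sup>2) = real m * (\<Sum>x\<in>I. (norm (g x))\<^sup>2)"
proof -
  have "complex_of_real (\<Sum>a\<in>I. (norm (\<Sum>x\<in>I. g x * e (a * x)))\<^sup>2)
      = (\<Sum>a\<in>I. (\<Sum>x\<in>I. g x * e (a * x)) * cnj (\<Sum>y\<in>I. g y * e (a * y)))"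
    unfolding of_real_sum complex_norm_square ..
  also have "\<dots> = (\<Sum>a\<in>I. \<Sum>x\<in>I. \<Sum>y\<in>I. g x * cnj (g y) * e (a * (x - y)))"
    unfolding cnj_sum sum_product
    by (intro sum.cong refl) (simp add: cnj_e right_diff_distrib e_add[of _ "- _", simplified])
  also have "\<dots> = (\<Sum>x\<in>I. \<Sum>y\<in>I. \<Sum>a\<in>I. g x * cnj (g y) * e (a * (x - y)))"
    by (subst sum.swap, rule sum.cong[OF refl], rule sum.swap)
  also have "\<dots> = (\<Sum>x\<in>I. \<Sum>y\<in>I. if y = x then g x * cnj (g x) * of_nat m else 0)"
  proof (intro sum.cong refl)
    fix x y assume "x \<in> I" "y \<in> I"
    then have "int m dvd x - y \<longleftrightarrow> y = x"
      by (auto simp: mod_eq_dvd_iff[symmetric])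
    then show "(\<Sum>a\<in>I. g x * cnj (g y) * e (a * (x - y))) = (if y = x then g x * cnj (g x) * of_nat m else 0)"
      by (simp add: sum_distrib_left[symmetric] sum_e)
  qed
  also have "\<dots> = complex_of_real (real m * (\<Sum>x\<in>I. (norm (g x))\<^sup>2))"
    by (simp add: sum_distrib_left complex_norm_square[symmetric] mult.commute)
  finally show ?thesis
    unfolding of_real_eq_iff .
qed

definition periodic2 :: "(int \<Rightarrow> int \<Rightarrow> 'b) \<Rightarrow> bool" where
  "periodic2 f \<longleftrightarrow> (\<forall>x y. f (x + int m) y = f x y \<and> f x (y + int m) = f x y)"

lemma periodic2D: "periodic2 f \<Longrightarrow> periodic (\<lambda>x. f x y)" "periodic2 f \<Longrightarrow> periodic (f x)"
  by (auto simp: periodic2_def periodic_def)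

definition energy :: "(int \<Rightarrow> int \<Rightarrow> complex) \<Rightarrow> real" where
  "energy f = (\<Sum>x\<in>I. \<Sum>y\<in>I. (norm (f x y))\<^sup>2)"

definition F :: "(int \<Rightarrow> int \<Rightarrow> complex) \<Rightarrow> int \<Rightarrow> int \<Rightarrow> complex" where
  "F f a b = (\<Sum>x\<in>I. \<Sum>y\<in>I. f x y * e (a * x + b * y))"

lemma F_diff: "F (\<lambda>x y. f x y - g x y) a b = F f a b - F g a b"
  by (simp add: F_def left_diff_distrib sum_subtractf)

lemma F_swap: "F (\<lambda>x y. f y x) a b = F f b a"
  unfolding F_def by (subst sum.swap) (simp add: add.commute)

lemma energy_swap: "energy (\<lambda>x y. f y x) = energy f"
  unfolding energy_def by (rule sum.swap)

lemma F_nested: "F f a b = (\<Sum>y\<in>I. (\<Sum>x\<in>I. f x y * e (a * x)) * e (b * y))"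
  unfolding F_def by (subst sum.swap) (simp add: e_add sum_distrib_right mult.assoc)

lemma parseval: "energy (F f) = (real m)\<^sup>2 * energy f"
proof -
  have "energy (F f) = (\<Sum>a\<in>I. \<Sum>b\<in>I. (norm (\<Sum>y\<in>I. (\<Sum>x\<in>I. f x y * e (a * x)) * e (b * y)))\<^sup>2)"
    unfolding energy_def F_nested ..
  also have "\<dots> = real m * (\<Sum>a\<in>I. \<Sum>y\<in>I. (norm (\<Sum>x\<in>I. f x y * e (a * x)))\<^sup>2)"
    by (simp add: parseval_1 sum_distrib_left)
  also have "\<dots> = real m * (\<Sum>y\<in>I. \<Sum>a\<in>I. (norm (\<Sum>x\<in>I. f x y * e (a * x)))\<^sup>2)"
    by (subst sum.swap) simp
  also have "\<dots> = real m * (\<Sum>y\<in>I. real m * (\<Sum>x\<in>I. (norm (f x y))\<^sup>2))"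
    by (simp only: parseval_1)
  also have "\<dots> = (real m)\<^sup>2 * (\<Sum>y\<in>I. \<Sum>x\<in>I. (norm (f x y))\<^sup>2)"
    by (simp add: sum_distrib_left[symmetric] power2_eq_square[of "real m"])
  also have "\<dots> = (real m)\<^sup>2 * energy f"
    unfolding energy_def by (subst sum.swap) simp
  finally show ?thesis .
qed

lemma periodic2_F: "periodic2 (F f)"
proof -
  have 1: "e ((a + int m) * x + b * y) = e (a * x + b * y)" for a b x y
    using periodic_e[of x "b * y"] by (simp add: periodic_def mult.commute)
  have 2: "e (a * x + (b + int m) * y) = e (a * x + b * y)" for a b x y
    using periodic_e[of y "a * x", unfolded periodic_def, rule_format, of b] by (simp add: algebra_simps)
  show ?thesis
    by (simp add: periodic2_def F_def 1 2)
qed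

lemma periodic_shear_term:
  assumes "periodic2 f"
  shows "periodic (\<lambda>x. f x y * e (a * x + b))"
  using periodic2D(1)[OF assms, of y] periodic_e[of a b] by (simp add: periodic_def)

text \<open>A change of variables moves the shear into the character, where it becomes a shear of
  the frequencies in the other direction.\<close>

lemma F_shear:
  assumes "periodic2 f"
  shows "F (\<lambda>x y. f (x + k * y) y) a b = F f a (b - k * a)"
proof -
  have "(\<Sum>x\<in>I. f (x + k * y) y * e (a * x + b * y)) = (\<Sum>x\<in>I. f x y * e (a * x + (b - k * a) * y))" for y
    using sum_shift[OF periodic_shear_term[OF assms, of y a "(b - k * a) * y"], of "k * y"]
    by (simp add: algebra_simps)
  then show ?thesis
    unfolding F_def by (subst (1 2) sum.swap) simp
qed

lemma F_shift:
  assumes "periodic2 f"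
  shows "F (\<lambda>x y. f (x + 1) y) a b = e (- a) * F f a b"
proof -
  have "(\<Sum>x\<in>I. f (x + 1) y * e (a * x + b * y)) = e (- a) * (\<Sum>x\<in>I. f x y * e (a * x + b * y))" for y
    using sum_shift[OF periodic_shear_term[OF assms, of y a "b * y - a"], of 1]
    by (simp add: algebra_simps sum_distrib_left e_add[symmetric])
  then show ?thesis
    unfolding F_def by (subst (1 2) sum.swap) (simp add: sum_distrib_left)
qed

lemma energy_shear:
  assumes "periodic2 f"
  shows "energy (\<lambda>x y. f (x + k * y) y) = energy f"
proof -
  have "(\<Sum>x\<in>I. (norm (f (x + k * y) y))\<^sup>2) = (\<Sum>x\<in>I. (norm (f x y))\<^sup>2)" for y
    using periodic2D(1)[OF assms, of y] by (intro sum_shift) (simp add: periodic_def)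
  then show ?thesis
    unfolding energy_def by (subst (1 2) sum.swap) simp
qed

text \<open>The left side is the product of sum and difference of the norms, and the weighted
  inequality of means splits it. The weight 1/16 is small enough that the four variation bounds in
  \<open>spectral_gap\<close> together cost only half of the energy.\<close>

lemma norm_square_diff:
  fixes u v :: complex
  shows "\<bar>(norm u)\<^sup>2 - (norm v)\<^sup>2\<bar> \<le> 8 * (norm (u - v))\<^sup>2 + ((norm u)\<^sup>2 + (norm v)\<^sup>2) / 16"
proof -
  define s d where "s = norm u + norm v" and "d = \<bar>norm u - norm v\<bar>"
  have "\<bar>(norm u)\<^sup>2 - (norm v)\<^sup>2\<bar> = s * d"
    unfolding s_def d_def by (simp add: square_diff_square_factored power2_eq_square abs_mult)
  also have "s * d \<le> 8 * d\<^sup>2 + s\<^sup>2 / 32"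
    using zero_le_power2[of "16 * d - s"] by (simp add: power2_eq_square field_simps)
  also have "d\<^sup>2 \<le> (norm (u - v))\<^sup>2"
    unfolding d_def by (intro power_mono norm_triangle_ineq3) simp
  also have "s\<^sup>2 \<le> 2 * ((norm u)\<^sup>2 + (norm v)\<^sup>2)"
    using sum_squares_bound[of "norm u" "norm v"] unfolding s_def by (simp add: power2_sum)
  finally show ?thesis
    by linarith
qed

lemma shear_variation:
  assumes "periodic2 f" and "energy (\<lambda>x y. f (x + k * y) y - f x y) \<le> \<delta>"
  shows "(\<Sum>a\<in>I. \<Sum>b\<in>I. \<bar>(norm (F f a b))\<^sup>2 - (norm (F f a (b - k * a)))\<^sup>2\<bar>)
    \<le> (real m)\<^sup>2 * (8 * \<delta> + energy f / 8)"
proof -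
  let ?g = "\<lambda>x y. f (x + k * y) y"
  have "(\<Sum>a\<in>I. \<Sum>b\<in>I. \<bar>(norm (F f a b))\<^sup>2 - (norm (F f a (b - k * a)))\<^sup>2\<bar>)
      = (\<Sum>a\<in>I. \<Sum>b\<in>I. \<bar>(norm (F ?g a b))\<^sup>2 - (norm (F f a b))\<^sup>2\<bar>)"
    by (simp add: F_shear[OF assms(1)] abs_minus_commute)
  also have "\<dots> \<le> (\<Sum>a\<in>I. \<Sum>b\<in>I. 8 * (norm (F ?g a b - F f a b))\<^sup>2 +
      ((norm (F ?g a b))\<^sup>2 + (norm (F f a b))\<^sup>2) / 16)"
    by (intro sum_mono norm_square_diff)
  also have "\<dots> = 8 * energy (F (\<lambda>x y. ?g x y - f x y)) + (energy (F ?g) + energy (F f)) / 16"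
    unfolding energy_def F_diff by (simp add: sum.distrib sum_distrib_left add_divide_distrib sum_divide_distrib)
  also have "\<dots> = (real m)\<^sup>2 * (8 * energy (\<lambda>x y. ?g x y - f x y) + energy f / 8)"
    unfolding parseval energy_shear[OF assms(1)] by (simp add: field_simps)
  also have "\<dots> \<le> (real m)\<^sup>2 * (8 * \<delta> + energy f / 8)"
    using assms(2) by (intro mult_left_mono) auto
  finally show ?thesis .
qed

end

text \<open>Up to \<open>t\<close> each, the disjoint images of \<open>P \<inter> B\<close> under
  \<open>\<sigma>\<close> and \<open>\<tau>\<close> carry its mass twice within \<open>P\<close>. So
  \<open>P \<inter> B\<close> has at most the mass of \<open>P - B\<close> plus
  \<open>2 * t\<close>.\<close>

lemma ping_pong:
  fixes \<mu> :: "'a \<Rightarrow> real"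
  assumes "finite W" "P \<subseteq> W" "\<And>z. 0 \<le> \<mu> z"
    and "inj_on \<sigma> (P \<inter> B)" "inj_on \<tau> (P \<inter> B)" "\<sigma> ` (P \<inter> B) \<subseteq> P" "\<tau> ` (P \<inter> B) \<subseteq> P"
    and "\<sigma> ` (P \<inter> B) \<inter> \<tau> ` (P \<inter> B) = {}"
    and var: "(\<Sum>z\<in>W. \<bar>\<mu> z - \<mu> (\<sigma> z)\<bar>) \<le> t" "(\<Sum>z\<in>W. \<bar>\<mu> z - \<mu> (\<tau> z)\<bar>) \<le> t"
  shows "sum \<mu> P \<le> 2 * sum \<mu> (P - B) + 2 * t"
proof -
  have fin: "finite P"
    using assms(1,2) finite_subset by blast
  have image: "sum \<mu> (P \<inter> B) - t \<le> sum \<mu> (\<rho> ` (P \<inter> B))"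
    if "inj_on \<rho> (P \<inter> B)" "(\<Sum>z\<in>W. \<bar>\<mu> z - \<mu> (\<rho> z)\<bar>) \<le> t" for \<rho>
  proof -
    have "sum \<mu> (P \<inter> B) - sum \<mu> (\<rho> ` (P \<inter> B)) = (\<Sum>z\<in>P \<inter> B. \<mu> z - \<mu> (\<rho> z))"
      by (simp add: sum.reindex[OF that(1)] sum_subtractf)
    also have "\<dots> \<le> (\<Sum>z\<in>P \<inter> B. \<bar>\<mu> z - \<mu> (\<rho> z)\<bar>)"
      by (intro sum_mono) simp
    also have "\<dots> \<le> (\<Sum>z\<in>W. \<bar>\<mu> z - \<mu> (\<rho> z)\<bar>)"
      using assms(1,2) by (intro sum_mono2) auto
    finally show ?thesis
      using that(2) by linarith
  qed
  have "sum \<mu> (\<sigma> ` (P \<inter> B)) + sum \<mu> (\<tau> ` (P \<inter> B)) = sum \<mu> (\<sigma> ` (P \<inter> B) \<union> \<tau> ` (P \<inter> B))"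
    using fin assms(8) by (intro sum.union_disjoint[symmetric]) auto
  also have "\<dots> \<le> sum \<mu> P"
    using fin assms(3,6,7) by (intro sum_mono2) auto
  finally have "2 * sum \<mu> (P \<inter> B) - 2 * t \<le> sum \<mu> P"
    using image[OF assms(4) var(1)] image[OF assms(5) var(2)] by linarith
  moreover have "sum \<mu> P = sum \<mu> (P \<inter> B) + sum \<mu> (P - B)"
    using fin by (metis sum.Int_Diff)
  ultimately show ?thesis
    by linarith
qed

section \<open>Frequencies near the origin and the spectral gap\<close>

context torus
begin

definition \<omega> :: "int \<Rightarrow> real" where
  "\<omega> a = (norm (e (- a) - 1))\<^sup>2"

lemma \<omega>_nonneg [simp]: "0 \<le> \<omega> a"
  by (simp add: \<omega>_def)

text \<open>\<open>\<omega> a\<close> equals \<open>2 - 2 * cos \<theta>\<close>, and for these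
  frequencies the angle lies between a right and a straight one, where the cosine is not
  positive.\<close>

lemma high_frequency:
  assumes "\<bar>2 * a\<bar> \<le> int m" "int m \<le> \<bar>4 * a\<bar>"
  shows "2 \<le> \<omega> a"
proof -
  define \<theta> where "\<theta> = 2 * pi * real_of_int a / real m"
  have e: "e (- a) = cis (- \<theta>)"
    by (simp add: e_def \<theta>_def)
  have "\<omega> a = (cos \<theta> - 1)\<^sup>2 + (sin \<theta>)\<^sup>2"
    unfolding \<omega>_def e by (simp add: cmod_power2)
  also have "\<dots> = 2 - 2 * cos \<theta>"
    using sin_cos_squared_add[of \<theta>] by (simp add: power2_eq_square algebra_simps)
  finally have "\<omega> a = 2 - 2 * cos \<bar>\<theta>\<bar>"
    by simp
  moreover have "cos \<bar>\<theta>\<bar> \<le> 0"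
  proof -
    have abs: "\<bar>\<theta>\<bar> = 2 * pi * \<bar>real_of_int a\<bar> / real m"
      by (simp add: \<theta>_def abs_mult)
    have a: "2 * \<bar>real_of_int a\<bar> \<le> real m" "real m \<le> 4 * \<bar>real_of_int a\<bar>"
      using assms by linarith+
    have "pi * (2 * \<bar>real_of_int a\<bar>) \<le> pi * real m" "pi * real m \<le> pi * (4 * \<bar>real_of_int a\<bar>)"
      using a by simp_all
    then have "pi / 2 \<le> \<bar>\<theta>\<bar>" "\<bar>\<theta>\<bar> \<le> pi"
      using m_pos unfolding abs by (simp_all add: field_simps)
    then have "cos \<bar>\<theta>\<bar> \<le> cos (pi / 2)"
      by (intro cos_monotone_0_pi_le) auto
    then show ?thesis
      by simp
  qed
  ultimately show ?thesis
    by simp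
qed

lemma shift_mass:
  assumes "periodic2 f"
  shows "(\<Sum>a\<in>I. \<Sum>b\<in>I. \<omega> a * (norm (F f a b))\<^sup>2)
    = (real m)\<^sup>2 * energy (\<lambda>x y. f (x + 1) y - f x y)"
proof -
  have "\<omega> a * (norm (F f a b))\<^sup>2 = (norm (F (\<lambda>x y. f (x + 1) y - f x y) a b))\<^sup>2" for a b
    unfolding \<omega>_def F_diff F_shift[OF assms] power_mult_distrib[symmetric] norm_mult[symmetric]
    by (simp add: left_diff_distrib)
  then show ?thesis
    unfolding parseval[symmetric] by (simp only: energy_def)
qed

text \<open>Representatives of the residues centred at 0, so that signs and absolute values of
  frequencies make sense.\<close>

definition window :: "int set" where
  "window = {- (int m div 2)..<- (int m div 2) + int m}"

lemma mem_window: "c \<in> window \<longleftrightarrow> - int m \<le> 2 * c \<and> 2 * c < int m"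
proof -
  define k where "k = int m div 2"
  have "int m = 2 * k \<or> int m = 2 * k + 1"
    unfolding k_def by presburger
  then show ?thesis
    unfolding window_def atLeastLessThan_iff k_def[symmetric] by auto
qed

lemma finite_window: "finite window"
  by (simp add: window_def)

lemma sum_window2:
  assumes "periodic2 h"
  shows "(\<Sum>(a, b)\<in>window \<times> window. h a b) = (\<Sum>a\<in>I. \<Sum>b\<in>I. h a b)"
proof -
  have "(\<Sum>(a, b)\<in>window \<times> window. h a b) = (\<Sum>a\<in>window. \<Sum>b\<in>window. h a b)"
    by (rule sum.cartesian_product[symmetric])
  also have "\<dots> = (\<Sum>a\<in>window. \<Sum>b\<in>I. h a b)"
    unfolding window_def by (intro sum.cong refl sum_window periodic2D(2) assms)
  also have "\<dots> = (\<Sum>b\<in>I. \<Sum>a\<in>window. h a b)"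
    by (rule sum.swap)
  also have "\<dots> = (\<Sum>b\<in>I. \<Sum>a\<in>I. h a b)"
    unfolding window_def by (intro sum.cong refl sum_window periodic2D(1) assms)
  also have "\<dots> = (\<Sum>a\<in>I. \<Sum>b\<in>I. h a b)"
    by (rule sum.swap)
  finally show ?thesis .
qed

text \<open>If \<open>f\<close> is almost invariant under translations, then \<open>|F f|\<^sup>2\<close> is concentrated near the
  origin, where the shears act as on the plane without wrapping around. Each of the cones \<open>P\<close> and \<open>N\<close> is
  mapped by two shears into disjoint parts of itself, so almost invariance under shears leaves it little
  mass.\<close>

theorem spectral_gap:
  fixes f :: "int \<Rightarrow> int \<Rightarrow> complex"
  assumes per: "periodic2 f" and mean: "(\<Sum>x\<in>I. \<Sum>y\<in>I. f x y) = 0"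
    and shift: "energy (\<lambda>x y. f (x + 1) y - f x y) \<le> \<delta>" "energy (\<lambda>x y. f x (y + 1) - f x y) \<le> \<delta>"
    and shear: "energy (\<lambda>x y. f (x + y) y - f x y) \<le> \<delta>" "energy (\<lambda>x y. f x (y + x) - f x y) \<le> \<delta>"
  shows "energy f \<le> 68 * \<delta>"
proof -
  define \<mu> where "\<mu> z = (case z of (a, b) \<Rightarrow> (norm (F f a b))\<^sup>2)" for z
  define t where "t = (real m)\<^sup>2 * (8 * \<delta> + energy f / 8)"
  let ?W = "window \<times> window"
  \<comment> \<open>Below \<open>m / 4\<close>, a sum or difference of two frequencies stays below
    \<open>m / 2\<close> and hence in the window.\<close>
  define B where "B = {(a, b). \<bar>4 * a\<bar> < int m \<and> \<bar>4 * b\<bar> < int m}"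
  \<comment> \<open>Opposite quadrants with one half-axis each; \<open>P\<close> and
    \<open>N\<close> partition the window without the origin.\<close>
  define P where "P = {(a, b)\<in>?W. a > 0 \<and> b \<ge> 0 \<or> a < 0 \<and> b \<le> 0}"
  define N where "N = {(a, b)\<in>?W. a \<le> 0 \<and> b > 0 \<or> a \<ge> 0 \<and> b < 0}"
  have finW: "finite ?W"
    by (simp add: finite_window)
  have fin: "finite P" "finite N"
    by (rule finite_subset[OF _ finW], auto simp: P_def N_def)+
  have \<mu>_nonneg: "0 \<le> \<mu> z" for z
    by (simp add: \<mu>_def split: prod.split)
  have perF: "F f (a + int m) b = F f a b" "F f a (b + int m) = F f a b" for a b
    using periodic2_F[of f] by (simp_all add: periodic2_def)
  have perF': "F f (a + int m * k) b = F f a b" "F f a (b + int m * k) = F f a b" for a b k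
    using periodic_mult[OF periodic2D(1)[OF periodic2_F[of f]]]
      periodic_mult[OF periodic2D(2)[OF periodic2_F[of f]]] by simp_all
  have perF'': "F f (a - int m * k) b = F f a b" "F f a (b - int m * k) = F f a b" for a b k
    using perF'(1)[of a "- k" b] perF'(2)[of a b "- k"] by simp_all
  define f' where "f' x y = f y x" for x y
  have per': "periodic2 f'"
    using per by (simp add: periodic2_def f'_def)
  have F': "F f' a b = F f b a" for a b
    unfolding f'_def by (rule F_swap)
  have en': "energy f' = energy f"
    unfolding f'_def by (rule energy_swap)
  have shear': "energy (\<lambda>x y. f (x + k * y) y - f x y) \<le> \<delta>"
    if "k = 1 \<or> k = -1" "periodic2 f" "energy (\<lambda>x y. f (x + y) y - f x y) \<le> \<delta>"
    for k and f :: "int \<Rightarrow> int \<Rightarrow> complex"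
  proof (cases "k = 1")
    case False
    \<comment> \<open>The inverse shear reduces to the shear: replacing \<open>x\<close> by
      \<open>x + y\<close> turns one difference into the negative of the other.\<close>
    define h where "h x y = f (x - y) y - f x y" for x y
    have "periodic2 h"
      using that(2) by (simp add: periodic2_def h_def algebra_simps)
        (metis (no_types, opaque_lifting) add.commute add_diff_eq diff_add_cancel)
    then have "energy h = energy (\<lambda>x y. h (x + 1 * y) y)"
      by (rule energy_shear[symmetric])
    also have "\<dots> = energy (\<lambda>x y. f (x + y) y - f x y)"
      unfolding energy_def h_def by (simp add: norm_minus_commute)
    finally show ?thesis
      using that False by (simp add: h_def[abs_def])
  qed (use that in simp)
  have variation: "(\<Sum>(a, b)\<in>?W. \<bar>\<mu> (a, b) - \<mu> (a, b - k * a)\<bar>) \<le> t"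
      "(\<Sum>(a, b)\<in>?W. \<bar>\<mu> (a, b) - \<mu> (a - k * b, b)\<bar>) \<le> t" if "k = 1 \<or> k = -1" for k
  proof -
    have arg: "a - k * (b + int m) = (a - k * b) + int m * - k" "b - k * (a + int m) = (b - k * a) + int m * - k"
      "a + int m - k * b = (a - k * b) + int m" "b + int m - k * a = (b - k * a) + int m" for a b
      by (simp_all add: algebra_simps)
    have "(\<Sum>(a, b)\<in>?W. \<bar>\<mu> (a, b) - \<mu> (a, b - k * a)\<bar>) =
        (\<Sum>a\<in>I. \<Sum>b\<in>I. \<bar>\<mu> (a, b) - \<mu> (a, b - k * a)\<bar>)"
      by (rule sum_window2) (simp add: periodic2_def \<mu>_def arg perF perF'')
    also have "\<dots> \<le> t"
      using shear_variation[OF per shear'[OF that per shear(1)]] by (simp add: t_def \<mu>_def)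
    finally show "(\<Sum>(a, b)\<in>?W. \<bar>\<mu> (a, b) - \<mu> (a, b - k * a)\<bar>) \<le> t" .
    have sh: "energy (\<lambda>x y. f' (x + y) y - f' x y) \<le> \<delta>"
      using shear(2) energy_swap[of "\<lambda>x y. f x (y + x) - f x y"] by (simp add: f'_def)
    have "(\<Sum>(a, b)\<in>?W. \<bar>\<mu> (a, b) - \<mu> (a - k * b, b)\<bar>) =
        (\<Sum>a\<in>I. \<Sum>b\<in>I. \<bar>\<mu> (a, b) - \<mu> (a - k * b, b)\<bar>)"
      by (rule sum_window2) (simp add: periodic2_def \<mu>_def arg perF perF'')
    also have "\<dots> = (\<Sum>b\<in>I. \<Sum>a\<in>I. \<bar>\<mu> (a, b) - \<mu> (a - k * b, b)\<bar>)"
      by (rule sum.swap)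
    also have "\<dots> \<le> t"
      using shear_variation[OF per' shear'[OF that per' sh]] by (simp add: t_def \<mu>_def F' en')
    finally show "(\<Sum>(a, b)\<in>?W. \<bar>\<mu> (a, b) - \<mu> (a - k * b, b)\<bar>) \<le> t" .
  qed
  have "sum \<mu> P \<le> 2 * sum \<mu> (P - B) + 2 * t"
  proof (rule ping_pong[OF finW _ \<mu>_nonneg])
    \<comment> \<open>In \<open>P\<close> the coordinates do not have opposite signs. After
      \<open>?\<sigma>\<close> the second is at least as large in absolute value as the first, and
      after \<open>?\<tau>\<close> the first is strictly larger. So the images are disjoint.\<close>
    let ?\<sigma> = "\<lambda>(a, b). (a, b - (-1) * a)" and ?\<tau> = "\<lambda>(a, b). (a - (-1) * b, b)"
    show "(\<Sum>z\<in>?W. \<bar>\<mu> z - \<mu> (?\<sigma> z)\<bar>) \<le> t" "(\<Sum>z\<in>?W. \<bar>\<mu> z - \<mu> (?\<tau> z)\<bar>) \<le> t"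
      using variation[of "-1"] by (simp_all add: case_prod_beta)
    show "?\<sigma> ` (P \<inter> B) \<subseteq> P" "?\<tau> ` (P \<inter> B) \<subseteq> P" "?\<sigma> ` (P \<inter> B) \<inter> ?\<tau> ` (P \<inter> B) = {}"
      unfolding P_def B_def by (auto simp: mem_window)
  qed (auto simp: P_def inj_on_def)
  moreover have "sum \<mu> N \<le> 2 * sum \<mu> (N - B) + 2 * t"
  proof (rule ping_pong[OF finW _ \<mu>_nonneg])
    let ?\<sigma> = "\<lambda>(a, b). (a, b - 1 * a)" and ?\<tau> = "\<lambda>(a, b). (a - 1 * b, b)"
    show "(\<Sum>z\<in>?W. \<bar>\<mu> z - \<mu> (?\<sigma> z)\<bar>) \<le> t" "(\<Sum>z\<in>?W. \<bar>\<mu> z - \<mu> (?\<tau> z)\<bar>) \<le> t"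
      using variation[of 1] by (simp_all add: case_prod_beta)
    show "?\<sigma> ` (N \<inter> B) \<subseteq> N" "?\<tau> ` (N \<inter> B) \<subseteq> N" "?\<sigma> ` (N \<inter> B) \<inter> ?\<tau> ` (N \<inter> B) = {}"
      unfolding N_def B_def by (auto simp: mem_window)
  qed (auto simp: N_def inj_on_def)
  moreover have "sum \<mu> ?W = (real m)\<^sup>2 * energy f"
    using sum_window2[of "\<lambda>a b. (norm (F f a b))\<^sup>2"] perF parseval[of f]
    by (simp add: \<mu>_def periodic2_def energy_def)
  moreover have "sum \<mu> ?W = sum \<mu> P + sum \<mu> N"
  proof -
    \<comment> \<open>The zero frequency is the sum of \<open>f\<close>, which vanishes by
      assumption.\<close>
    have "\<mu> (0, 0) = 0"
      using mean by (simp add: \<mu>_def F_def)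
    then have "sum \<mu> ?W = sum \<mu> (P \<union> N)"
    proof (intro sum.mono_neutral_right finW ballI)
      fix z assume "z \<in> ?W - (P \<union> N)"
      then obtain a b where "z = (a, b)" "(a, b) \<in> ?W" "(a, b) \<notin> P" "(a, b) \<notin> N"
        by (cases z) auto
      moreover from this have "a = 0 \<and> b = 0"
        unfolding P_def N_def
        by (cases a "0 :: int" rule: linorder_cases; cases b "0 :: int" rule: linorder_cases) auto
      ultimately show "\<mu> z = 0"
        using \<open>\<mu> (0, 0) = 0\<close> by simp
    qed (auto simp: P_def N_def)
    also have "\<dots> = sum \<mu> P + sum \<mu> N"
      using fin by (intro sum.union_disjoint) (auto simp: P_def N_def)
    finally show ?thesis .
  qed
  moreover have "sum \<mu> (P - B) + sum \<mu> (N - B) \<le> (real m)\<^sup>2 * \<delta>"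
  proof -
    have "sum \<mu> (P - B) + sum \<mu> (N - B) = sum \<mu> ((P - B) \<union> (N - B))"
      using fin by (intro sum.union_disjoint[symmetric]) (auto simp: P_def N_def)
    also have "\<dots> \<le> sum \<mu> (?W - B)"
      using \<mu>_nonneg finW by (intro sum_mono2) (auto simp: P_def N_def)
    \<comment> \<open>Outside \<open>B\<close> a coordinate is a high frequency, so the mass is
      controlled by the energies of the two translation differences.\<close>
    also have "2 * \<dots> \<le> (\<Sum>(a, b)\<in>?W - B. (\<omega> a + \<omega> b) * \<mu> (a, b))"
      unfolding sum_distrib_left
    proof (intro sum_mono, clarify)
      fix a b assume ab: "a \<in> window" "b \<in> window" "(a, b) \<notin> B"
      have "\<bar>2 * a\<bar> \<le> int m" "\<bar>2 * b\<bar> \<le> int m"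
        using ab(1,2) unfolding mem_window by linarith+
      moreover have "int m \<le> \<bar>4 * a\<bar> \<or> int m \<le> \<bar>4 * b\<bar>"
        using ab(3) unfolding B_def by auto
      ultimately have "2 \<le> \<omega> a \<or> 2 \<le> \<omega> b"
        using high_frequency by blast
      then have "2 \<le> \<omega> a + \<omega> b"
        using \<omega>_nonneg[of a] \<omega>_nonneg[of b] by linarith
      then show "2 * \<mu> (a, b) \<le> (\<omega> a + \<omega> b) * \<mu> (a, b)"
        using \<mu>_nonneg by (rule mult_right_mono)
    qed
    also have "\<dots> \<le> (\<Sum>(a, b)\<in>?W. (\<omega> a + \<omega> b) * \<mu> (a, b))"
      using \<mu>_nonneg finW by (intro sum_mono2) auto
    also have "\<dots> = (\<Sum>a\<in>I. \<Sum>b\<in>I. (\<omega> a + \<omega> b) * \<mu> (a, b))"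
    proof (rule sum_window2)
      have "\<omega> (a + int m) = \<omega> a" for a
        using periodic_e[of "-1" 0] by (simp add: periodic_def \<omega>_def)
      then show "periodic2 (\<lambda>a b. (\<omega> a + \<omega> b) * \<mu> (a, b))"
        by (simp add: periodic2_def \<mu>_def perF)
    qed
    also have "\<dots> = (\<Sum>a\<in>I. \<Sum>b\<in>I. \<omega> a * (norm (F f a b))\<^sup>2) +
        (\<Sum>b\<in>I. \<Sum>a\<in>I. \<omega> b * (norm (F f' b a))\<^sup>2)"
      by (subst (3) sum.swap) (simp add: \<mu>_def F' distrib_right sum.distrib)
    also have "\<dots> = (real m)\<^sup>2 * (energy (\<lambda>x y. f (x + 1) y - f x y) + energy (\<lambda>x y. f x (y + 1) - f x y))"
      unfolding shift_mass[OF per] shift_mass[OF per'] ring_distribs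
      using energy_swap[of "\<lambda>x y. f x (y + 1) - f x y"] by (simp add: f'_def)
    also have "\<dots> \<le> (real m)\<^sup>2 * (2 * \<delta>)"
      using shift by (intro mult_left_mono) auto
    finally show ?thesis
      by simp
  qed
  \<comment> \<open>The term \<open>4 * t\<close> contributes \<open>32 * \<delta>\<close> and half
    of the energy, which is absorbed on the left; this leaves \<open>2 * 34 = 68\<close>.\<close>
  ultimately have "(real m)\<^sup>2 * energy f \<le> 2 * ((real m)\<^sup>2 * \<delta>) + 4 * t"
    by linarith
  also have "\<dots> = (real m)\<^sup>2 * (34 * \<delta> + energy f / 2)"
    unfolding t_def by (simp add: algebra_simps)
  finally have "energy f \<le> 34 * \<delta> + energy f / 2"
    using m_pos by simp
  then show ?thesis
    by simp
qed

end

section \<open>Indices of torus points and expansion of sets of indices\<close>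

definition cell :: "nat \<Rightarrow> nat \<Rightarrow> nat \<Rightarrow> nat" where
  "cell m a b = (a mod m) * m + b mod m"

text \<open>The point \<open>(a, b)\<close> of the torus has the index \<open>a * m + b\<close>. Translations and shears connect it
  with neighbours 1 to 4; neighbour 0 is the point itself and stands for the diagonal of the matrix.\<close>

definition neighbour :: "nat \<Rightarrow> nat \<Rightarrow> nat \<Rightarrow> nat" where
  "neighbour m k i = (let a = i div m; b = i mod m in
     if k = 0 then cell m a b else if k = 1 then cell m (a + 1) b else if k = 2 then cell m a (b + 1)
     else if k = 3 then cell m (a + b) b else cell m a (a + b))"

definition boundary :: "nat \<Rightarrow> nat \<Rightarrow> nat set \<Rightarrow> nat set" where
  "boundary m k T = {i. i < m * m \<and> (i \<in> T) \<noteq> (neighbour m k i \<in> T)}"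

lemma cell_less: "0 < m \<Longrightarrow> cell m a b < m * m"
proof -
  assume "0 < m"
  then have "a mod m < m" "b mod m < m"
    by auto
  then have "a mod m * m + m \<le> m * m"
    by (metis Suc_leI add.commute mult_Suc mult_le_mono1)
  then show ?thesis
    using \<open>b mod m < m\<close> by (simp add: cell_def)
qed

lemma cell_div_mod: "0 < m \<Longrightarrow> cell m a b div m = a mod m" "0 < m \<Longrightarrow> cell m a b mod m = b mod m"
  by (simp_all add: cell_def)

lemma cell_eq_iff: "0 < m \<Longrightarrow> cell m a b = cell m a' b' \<longleftrightarrow> a mod m = a' mod m \<and> b mod m = b' mod m"
  using cell_div_mod[of m a b] cell_div_mod[of m a' b'] by (metis cell_def)

lemma div_less_square: "i < m * m \<Longrightarrow> i div m < (m::nat)"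
  by (simp add: less_mult_imp_div_less)

lemma cell_self: "i < m * m \<Longrightarrow> cell m (i div m) (i mod m) = i"
  using div_less_square[of i m] by (simp add: cell_def)

lemma neighbour_0: "i < m * m \<Longrightarrow> neighbour m 0 i = i"
  by (simp add: neighbour_def cell_self)

lemma neighbour_less: "0 < m \<Longrightarrow> neighbour m k i < m * m"
  by (simp add: neighbour_def Let_def cell_less)

lemma mod_add_cancel_left: "(a + b) mod m = (a + c) mod m \<longleftrightarrow> b mod m = c mod (m::nat)"
  using cong_add_lcancel_nat[of a b c m] by (simp add: cong_def)

text \<open>Translations and shears permute the torus. This bounds the nonzero entries in a column
  and the number of points whose \<open>k\<close>-th neighbour is bad.\<close>

lemma inj_on_neighbour: "inj_on (neighbour m k) {..<m * m}"
proof (rule inj_onI)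
  fix i j assume ij: "i \<in> {..<m * m}" "j \<in> {..<m * m}" "neighbour m k i = neighbour m k j"
  then have m: "0 < m"
    by (cases m) auto
  have bounds: "i div m < m" "j div m < m" "i mod m < m" "j mod m < m"
    using ij m by (auto simp: div_less_square)
  have add: "(a + c) mod m = (b + c) mod m \<longleftrightarrow> a mod m = b mod m" for a b c
    using mod_add_cancel_left[of c a m b] by (simp add: add.commute)
  have "i div m = j div m \<and> i mod m = j mod m"
    using ij(3) bounds mod_add_cancel_left[of "j div m" "i mod m" m "j mod m"] add[of _ "j mod m"]
    unfolding neighbour_def Let_def
    by (auto simp: cell_eq_iff[OF m] add add[of _ 1, simplified] mod_add_cancel_left split: if_splits)
  then show "i = j"
    by (metis div_mult_mod_eq)
qed

context torus
begin

lemma sum_grid: "(\<Sum>x\<in>I. \<Sum>y\<in>I. h x y) = (\<Sum>i<m * m. h (int (i div m)) (int (i mod m)))"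
proof -
  have "(\<Sum>x\<in>I. \<Sum>y\<in>I. h x y) = (\<Sum>z\<in>I \<times> I. h (fst z) (snd z))"
    by (simp add: sum.cartesian_product case_prod_beta)
  also have "\<dots> = (\<Sum>i<m * m. h (int (i div m)) (int (i mod m)))"
  proof (rule sum.reindex_bij_witness[of _ "\<lambda>i. (int (i div m), int (i mod m))" "\<lambda>z. cell m (nat (fst z)) (nat (snd z))"])
    fix i assume "i \<in> {..<m * m}"
    then show "(int (i div m), int (i mod m)) \<in> I \<times> I"
      using m_pos by (auto simp: div_less_square)
  next
    fix z assume z: "z \<in> I \<times> I"
    then show "cell m (nat (fst z)) (nat (snd z)) \<in> {..<m * m}"
      using cell_less m_pos by auto
    show "(int (cell m (nat (fst z)) (nat (snd z)) div m), int (cell m (nat (fst z)) (nat (snd z)) mod m)) = z"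
      "h (int (cell m (nat (fst z)) (nat (snd z)) div m)) (int (cell m (nat (fst z)) (nat (snd z)) mod m))
        = h (fst z) (snd z)"
      using z m_pos by (auto simp: cell_div_mod nat_less_iff)
  qed (auto simp: cell_self)
  finally show ?thesis .
qed

text \<open>The spectral gap is applied to the indicator of \<open>T\<close> minus its mean. Its
  energy is \<open>t * (L - t) / L\<close>, and each difference along a neighbour map has the
  boundary size as its energy.\<close>

theorem expander:
  assumes T: "T \<subseteq> {..<m * m}"
    and \<beta>: "\<And>k. k < 5 \<Longrightarrow> card (boundary m k T) \<le> \<beta>"
  shows "card T * (m * m - card T) \<le> 68 * \<beta> * (m * m)"
proof -
  define L where "L = real (m * m)"
  define t where "t = real (card T)"
  have L: "0 < L"
    using m_pos by (simp add: L_def)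
  have "card T \<le> m * m"
    using card_mono[OF _ T] by simp
  define \<phi> where "\<phi> i = of_bool (i \<in> T) - t / L" for i
  define f where "f x y = complex_of_real (\<phi> (cell m (nat (x mod int m)) (nat (y mod int m))))" for x y :: int
  have f_nat: "f (int a) (int b) = complex_of_real (\<phi> (cell m a b))" for a b
    by (simp add: f_def cell_def flip: zmod_int)
  have per: "periodic2 f"
    by (simp add: periodic2_def f_def)
  have energy_eq: "energy (\<lambda>x y. f (u x y) (v x y) - f x y)
      = real (card (boundary m k T))"
    if "\<And>a b. u (int a) (int b) = int (u' a b)" "\<And>a b. v (int a) (int b) = int (v' a b)"
      "\<And>i. neighbour m k i = cell m (u' (i div m) (i mod m)) (v' (i div m) (i mod m))"
    for k and u v :: "int \<Rightarrow> int \<Rightarrow> int" and u' v' :: "nat \<Rightarrow> nat \<Rightarrow> nat"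
  proof -
    have "energy (\<lambda>x y. f (u x y) (v x y) - f x y) = (\<Sum>i<m * m. (\<phi> (neighbour m k i) - \<phi> i)\<^sup>2)"
      unfolding energy_def sum_grid that(1,2) f_nat that(3)
      by (intro sum.cong refl) (simp add: cell_self flip: of_real_diff)
    also have "\<dots> = (\<Sum>i<m * m. if (i \<in> T) \<noteq> (neighbour m k i \<in> T) then 1 else 0)"
      by (intro sum.cong refl) (auto simp: \<phi>_def)
    also have "\<dots> = real (card {i\<in>{..<m * m}. (i \<in> T) \<noteq> (neighbour m k i \<in> T)})"
      by (subst sum.If_cases) (auto simp: Int_def)
    finally show ?thesis
      by (simp add: boundary_def)
  qed
  have sum_T: "(\<Sum>i<m * m. of_bool (i \<in> T)) = t"
    using T by (simp add: t_def of_bool_def sum.If_cases Int_absorb1)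
  have "energy f \<le> 68 * real \<beta>"
  proof (rule spectral_gap[OF per])
    have "(\<Sum>x\<in>I. \<Sum>y\<in>I. f x y) = of_real (\<Sum>i<m * m. \<phi> i)"
      unfolding sum_grid f_nat by (simp add: cell_self)
    also have "(\<Sum>i<m * m. \<phi> i) = 0"
      using m_pos by (simp add: \<phi>_def sum_subtractf sum_T L_def)
    finally show "(\<Sum>x\<in>I. \<Sum>y\<in>I. f x y) = 0"
      by simp
    have "energy (\<lambda>x y. f (x + 1) y - f x y) = real (card (boundary m 1 T))"
      by (rule energy_eq[of _ "\<lambda>a b. a + 1" _ "\<lambda>a b. b"]) (simp_all add: neighbour_def Let_def)
    then show "energy (\<lambda>x y. f (x + 1) y - f x y) \<le> real \<beta>"
      using \<beta>[of 1] by simp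
    have "energy (\<lambda>x y. f x (y + 1) - f x y) = real (card (boundary m 2 T))"
      by (rule energy_eq[of _ "\<lambda>a b. a" _ "\<lambda>a b. b + 1"]) (simp_all add: neighbour_def Let_def)
    then show "energy (\<lambda>x y. f x (y + 1) - f x y) \<le> real \<beta>"
      using \<beta>[of 2] by simp
    have "energy (\<lambda>x y. f (x + y) y - f x y) = real (card (boundary m 3 T))"
      by (rule energy_eq[of _ "\<lambda>a b. a + b" _ "\<lambda>a b. b"]) (simp_all add: neighbour_def Let_def)
    then show "energy (\<lambda>x y. f (x + y) y - f x y) \<le> real \<beta>"
      using \<beta>[of 3] by simp
    have "energy (\<lambda>x y. f x (y + x) - f x y) = real (card (boundary m 4 T))"
      by (rule energy_eq[of _ "\<lambda>a b. a" _ "\<lambda>a b. a + b"]) (simp_all add: neighbour_def Let_def)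
    then show "energy (\<lambda>x y. f x (y + x) - f x y) \<le> real \<beta>"
      using \<beta>[of 4] by simp
  qed
  moreover have "energy f = (\<Sum>i<m * m. (\<phi> i)\<^sup>2)"
    unfolding energy_def sum_grid f_nat by (intro sum.cong refl) (simp add: cell_self)
  moreover have "(\<Sum>i<m * m. (\<phi> i)\<^sup>2) = (\<Sum>i<m * m. of_bool (i \<in> T) * (1 - 2 * (t / L)) + (t / L)\<^sup>2)"
    by (intro sum.cong refl) (auto simp: \<phi>_def power2_eq_square algebra_simps)
  moreover have "\<dots> = t * (1 - 2 * (t / L)) + L * (t / L)\<^sup>2"
    by (simp only: sum.distrib flip: sum_distrib_right) (simp only: sum_T, simp add: L_def)
  moreover have "\<dots> = t * (L - t) / L"
    using L by (simp add: power2_eq_square field_simps)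
  ultimately have "t * (L - t) / L \<le> 68 * real \<beta>"
    by linarith
  then have "t * (L - t) \<le> 68 * real \<beta> * L"
    using L by (simp add: pos_divide_le_eq)
  then have "real (card T * (m * m - card T)) \<le> real (68 * \<beta> * (m * m))"
    using \<open>card T \<le> m * m\<close> by (simp add: t_def L_def of_nat_diff)
  then show ?thesis
    using of_nat_le_iff by blast
qed

end

section \<open>The matrices and their computation\<close>

text \<open>Rows and columns beyond the largest square up to \<open>n\<close> are zero. For positive
  \<open>n\<close> this square is at least \<open>n / 4\<close>, so only a constant factor is
  lost.\<close>

definition torus_matrix :: "nat \<Rightarrow> 'a::field mat" where
  "torus_matrix n = mat n n (\<lambda>(i, j). of_bool
     (i < (floor_sqrt n)\<^sup>2 \<and> (\<exists>k<5. j = neighbour (floor_sqrt n) k i)))"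

fun straight :: "ram \<Rightarrow> bool" where
  "straight (Seq c d) \<longleftrightarrow> straight c \<and> straight d"
| "straight (Cond r c d) \<longleftrightarrow> straight c \<and> straight d"
| "straight (Loop r c) \<longleftrightarrow> False"
| "straight _ \<longleftrightarrow> True"

text \<open>A functional semantics by which the simplifier executes loop-free code. The value at
  \<open>Loop\<close> is a default that \<open>straight\<close> excludes.\<close>

fun run :: "ram \<Rightarrow> ram_state \<Rightarrow> ram_state" where
  "run (Set r k) (s, m) = (s(r := k), m)"
| "run (Add r a b) (s, m) = (s(r := s a + s b), m)"
| "run (Sub r a b) (s, m) = (s(r := s a - s b), m)"
| "run (Load r a) (s, m) = (s(r := m (s a)), m)"
| "run (Store a r) (s, m) = (s, m(s a := s r))"
| "run (Seq c d) st = run d (run c st)"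
| "run (Cond r c d) st = (if fst st r \<noteq> 0 then run c st else run d st)"
| "run (Loop r c) st = st"

fun cost :: "ram \<Rightarrow> nat" where
  "cost (Seq c d) = cost c + cost d"
| "cost (Cond r c d) = cost c + cost d + 1"
| "cost _ = 1"

lemma exec_run: "straight c \<Longrightarrow> \<exists>t\<le>cost c. exec c st t (run c st)"
proof (induction c arbitrary: st)
  case (Seq c d)
  then obtain t u where "t \<le> cost c" "exec c st t (run c st)" "u \<le> cost d"
    "exec d (run c st) u (run d (run c st))"
    by (meson straight.simps(1))
  then show ?case
    using exec.intros(6) by (intro exI[of _ "t + u"]) auto
next
  case (Cond r c d)
  obtain s m where st: "st = (s, m)"
    by (cases st)
  show ?case
  proof (cases "s r = 0")
    case True
    obtain t where "t \<le> cost d" "exec d st t (run d st)"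
      using Cond.IH(2)[of st] Cond.prems by auto
    then show ?thesis
      using True st exec.intros(8)[of s r d m t "run d st" c] by (intro exI[of _ "t + 1"]) auto
  next
    case False
    obtain t where "t \<le> cost c" "exec c st t (run c st)"
      using Cond.IH(1)[of st] Cond.prems by auto
    then show ?thesis
      using False st exec.intros(7)[of s r c m t "run c st" d] by (intro exI[of _ "t + 1"]) auto
  qed
qed (cases st; auto intro: exec.intros[unfolded One_nat_def])+

lemma exec_Loop:
  assumes body: "\<And>i s m. i < N \<Longrightarrow> Inv i (s, m) \<Longrightarrow> s r \<noteq> 0 \<and> Inv (Suc i) (run c (s, m))"
    and exit: "\<And>s m. Inv N (s, m) \<Longrightarrow> s r = 0" and "straight c" "Inv 0 st"
  shows "\<exists>t st'. exec (Loop r c) st t st' \<and> t \<le> N * (cost c + 1) + 1 \<and> Inv N st'"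
proof -
  have "\<exists>t st'. exec (Loop r c) st t st' \<and> t \<le> (N - i) * (cost c + 1) + 1 \<and> Inv N st'"
    if "i \<le> N" "Inv i st" for i st
    using that
  proof (induction "N - i" arbitrary: i st)
    case 0
    obtain s m where st: "st = (s, m)"
      by (cases st)
    have "Inv N (s, m)"
      using 0 st by simp
    then show ?case
      using exit exec.intros(9)[of s r c m] st by (intro exI[of _ 1] exI[of _ st]) auto
  next
    case (Suc l)
    obtain s m where st: "st = (s, m)"
      by (cases st)
    have i: "i < N"
      using Suc.hyps(2) by linarith
    have step: "s r \<noteq> 0" "Inv (Suc i) (run c st)"
      using body[OF i, of s m] Suc.prems st by auto
    obtain t where t: "t \<le> cost c" "exec c st t (run c st)"
      using exec_run[OF assms(3)] by blast
    obtain u st' where u: "exec (Loop r c) (run c st) u st'" "u \<le> (N - Suc i) * (cost c + 1) + 1" "Inv N st'"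
      using Suc.hyps(1)[OF _ _ step(2)] Suc.hyps(2) i by (metis Suc_diff_Suc Suc_leI diff_Suc_1)
    have "exec (Loop r c) st (t + u + 1) st'"
      unfolding st by (rule exec.intros(10)) (use step t u st in auto)
    moreover have "t + u + 1 \<le> (N - i) * (cost c + 1) + 1"
    proof -
      have "N - i = Suc (N - Suc i)"
        using i by linarith
      then show ?thesis
        using t u by simp
    qed
    ultimately show ?case
      using u by blast
  qed
  from this[of 0 st] show ?thesis
    using assms by simp
qed

fun seq :: "ram list \<Rightarrow> ram" where
  "seq [] = Set 9 0"
| "seq [c] = c"
| "seq (c # cs) = Seq c (seq cs)"

text \<open>Registers: 0 holds \<open>n\<close>, 1 and 3 the constants 1 and 0, 4 holds \<open>m = floor_sqrt n\<close> and 5 holds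
  \<open>m * m\<close>. In the last loop, 6 counts down, and for the row \<open>i = a * m + b\<close> the registers 10 to 14
  hold \<open>i * n\<close>, \<open>a\<close>, \<open>a * m\<close>, \<open>b\<close>, \<open>b * m\<close>.\<close>

definition count_init :: ram where
  "count_init = seq [Set 1 1, Load 2 0]"

text \<open>Each unary digit is erased as it is counted, so the memory is zero when the matrix is
  written.\<close>

definition count_body :: ram where
  "count_body = seq [Store 0 3, Add 0 0 1, Load 2 0]"

text \<open>Register 7 holds \<open>(k + 1)\<^sup>2\<close> for the candidate \<open>k\<close>.
  Truncated subtraction from \<open>n + 1\<close> gives a nonzero result exactly if this square is
  at most \<open>n\<close>; the body then reaches the next square by adding an odd number.\<close>

definition sqrt_init :: ram where
  "sqrt_init = seq [Set 7 1, Add 8 0 1, Sub 6 8 7]"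

definition sqrt_body :: ram where
  "sqrt_body = seq [Add 4 4 1, Add 7 7 4, Add 7 7 4, Add 7 7 1, Sub 6 8 7]"

definition rows_init :: ram where
  "rows_init = seq [Sub 5 7 4, Sub 5 5 4, Sub 5 5 1, Add 6 5 3]"

definition put :: "nat \<Rightarrow> nat \<Rightarrow> ram" where
  "put r q = seq [Add 20 10 r, Add 20 20 q, Store 20 1]"

text \<open>The truncated value of \<open>r + 1 - l\<close> is nonzero exactly if
  \<open>l \<le> r\<close>. One subtraction reduces modulo \<open>l\<close>, as the sums that occur
  stay below \<open>2 * l\<close>. Adding register 3, which is zero, does nothing.\<close>

definition sum_mod :: "nat \<Rightarrow> nat \<Rightarrow> nat \<Rightarrow> nat \<Rightarrow> ram" where
  "sum_mod r p q l = seq [Add r p q, Add 19 r 1, Sub 19 19 l, Cond 19 (Sub r r l) (Add r r 3)]"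

definition next_row :: ram where
  "next_row = seq [Add 10 10 0, Add 13 13 1, Add 14 14 4, Sub 19 4 13,
     Cond 19 (Add 13 13 3) (seq [Set 13 0, Set 14 0, Add 11 11 1, Add 12 12 4]), Sub 6 6 1]"

text \<open>For lack of multiplication, a row coordinate is kept multiplied by \<open>m\<close> and
  reduced modulo \<open>m * m\<close>; adding the other coordinate then gives the index of the
  neighbour.\<close>

definition rows_body :: ram where
  "rows_body = seq [sum_mod 17 12 4 5, sum_mod 18 13 1 4, sum_mod 15 11 13 4, sum_mod 16 12 14 5,
     put 12 13, put 17 13, put 12 18, put 16 13, put 12 15, next_row]"

definition torus_program :: ram where
  "torus_program = seq [count_init, Loop 2 count_body, sqrt_init, Loop 6 sqrt_body, rows_init, Loop 6 rows_body]"

section \<open>Invariants of the three loops\<close>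

definition count_inv :: "nat \<Rightarrow> nat \<Rightarrow> ram_state \<Rightarrow> bool" where
  "count_inv n k st \<longleftrightarrow> (case st of (s, m) \<Rightarrow> s 0 = k \<and> s 1 = 1 \<and> s 2 = of_bool (k < n) \<and> (\<forall>r>2. s r = 0) \<and>
     (\<forall>x. m x = of_bool (k \<le> x \<and> x < n)))"

definition sqrt_inv :: "nat \<Rightarrow> nat \<Rightarrow> ram_state \<Rightarrow> bool" where
  "sqrt_inv n k st \<longleftrightarrow> (case st of (s, m) \<Rightarrow> s 0 = n \<and> s 1 = 1 \<and> s 3 = 0 \<and> s 4 = k \<and> s 7 = (k + 1)\<^sup>2 \<and>
     s 8 = n + 1 \<and> s 6 = s 8 - s 7 \<and> (\<forall>r\<ge>10. s r = 0) \<and> (\<forall>x. m x = 0))"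

definition rows_inv :: "nat \<Rightarrow> nat \<Rightarrow> nat \<Rightarrow> ram_state \<Rightarrow> bool" where
  "rows_inv n m i st \<longleftrightarrow> (case st of (s, mem) \<Rightarrow> s 0 = n \<and> s 1 = 1 \<and> s 3 = 0 \<and> s 4 = m \<and> s 5 = m * m \<and> s 6 = m * m - i \<and>
     s 10 = i * n \<and> s 11 = i div m \<and> s 12 = i div m * m \<and> s 13 = i mod m \<and> s 14 = i mod m * m \<and>
     (\<forall>x. mem x = of_bool (\<exists>i'<i. \<exists>k<5. x = i' * n + neighbour m k i')))"

lemma neighbour_arith:
  assumes "a < m" "b < m" "i = a * m + b"
  shows "neighbour m 0 i = a * m + b" (is ?self)
    "neighbour m 1 i = (if m * m \<le> a * m + m then a * m + m - m * m else a * m + m) + b" (is ?right)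
    "neighbour m 2 i = a * m + (if m \<le> b + 1 then b + 1 - m else b + 1)" (is ?up)
    "neighbour m 3 i = (if m * m \<le> a * m + b * m then a * m + b * m - m * m else a * m + b * m) + b" (is ?shear)
    "neighbour m 4 i = a * m + (if m \<le> a + b then a + b - m else a + b)" (is ?shear')
proof -
  have i: "i div m = a" "i mod m = b"
    using assms by auto
  have mod: "c mod m = (if m \<le> c then c - m else c)" if "c < 2 * m" for c
    using that by (simp add: mod_if)
  have mult: "c mod m * m = (if m * m \<le> c * m then c * m - m * m else c * m)" if "c < 2 * m" for c
    using that assms(1) by (simp add: mod diff_mult_distrib)
  show ?self ?right ?up ?shear ?shear'
    using assms mult[of "a + 1"] mult[of "a + b"] mod[of "b + 1"] mod[of "a + b"]
    unfolding neighbour_def Let_def cell_def i by (simp_all add: add_mult_distrib add.commute)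
qed

lemma ex_less_5: "(\<exists>k<5. P k) \<longleftrightarrow> P 0 \<or> P 1 \<or> P 2 \<or> P 3 \<or> P (4::nat)"
  by (auto simp: eval_nat_numeral less_Suc_eq)

lemma update_5:
  fixes f :: "nat \<Rightarrow> nat"
  assumes "f x = of_bool P"
  shows "(f(y0 := 1, y1 := 1, y2 := 1, y3 := 1, y4 := 1)) x =
    of_bool (P \<or> x = y0 \<or> x = y1 \<or> x = y2 \<or> x = y3 \<or> x = y4)"
proof (cases "x = y0 \<or> x = y1 \<or> x = y2 \<or> x = y3 \<or> x = y4")
  case True
  then show ?thesis
    unfolding fun_upd_apply by (elim disjE) simp_all
next
  case False
  then show ?thesis
    unfolding fun_upd_apply using assms by simp
qed

lemma count_body_inv:
  assumes "k < n" "count_inv n k (s, m)"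
  shows "s 2 \<noteq> 0 \<and> count_inv n (Suc k) (run count_body (s, m))"
  using assms by (auto simp: count_inv_def count_body_def)

lemma sqrt_body_inv:
  assumes "k < floor_sqrt n" "sqrt_inv n k (s, m)"
  shows "s 6 \<noteq> 0 \<and> sqrt_inv n (Suc k) (run sqrt_body (s, m))"
proof -
  have "(k + 1)\<^sup>2 \<le> (floor_sqrt n)\<^sup>2"
    using assms(1) by (intro power_mono) auto
  then have "(k + 1)\<^sup>2 \<le> n"
    using floor_sqrt_power2_le le_trans by blast
  then show ?thesis
    using assms(2) by (auto simp: sqrt_inv_def sqrt_body_def power2_eq_square)
qed

lemma run_put:
  assumes "r \<noteq> 20" "q \<noteq> 20"
  shows "run (put r q) (s, m) = (s(20 := s 10 + s r + s q), m(s 10 + s r + s q := s 1))"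
  using assms by (simp add: put_def)

lemma run_sum_mod:
  assumes v: "v = (if z \<le> x + y then x + y - z else x + y)"
    and "p \<noteq> 19" "q \<noteq> 19" "r \<noteq> 19" "r \<noteq> 1" "r \<noteq> 3" "l \<noteq> r" "l \<noteq> 19" "s 1 = 1" "s 3 = 0"
    and "s p = x" "s q = y" "s l = z"
  shows "\<exists>d. run (sum_mod r p q l) (s, m) = (s(19 := d, r := v), m)"
proof (cases "z \<le> x + y")
  case True
  then show ?thesis
    using assms by (intro exI[of _ "x + y + 1 - z"]) (auto simp: sum_mod_def fun_eq_iff Suc_le_eq)
next
  case False
  then show ?thesis
    using assms by (intro exI[of _ 0]) (auto simp: sum_mod_def fun_eq_iff)
qed

lemma run_next_row:
  assumes "s 1 = 1" "s 3 = 0" "s 13 < s 4"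
  shows "\<exists>s'. run next_row (s, m) = (s', m) \<and> (\<forall>r\<in>{0, 1, 3, 4, 5}. s' r = s r) \<and> s' 6 = s 6 - 1 \<and> s' 10 = s 10 + s 0 \<and>
    s' 11 = (if Suc (s 13) = s 4 then Suc (s 11) else s 11) \<and>
    s' 12 = (if Suc (s 13) = s 4 then s 12 + s 4 else s 12) \<and>
    s' 13 = (if Suc (s 13) = s 4 then 0 else Suc (s 13)) \<and>
    s' 14 = (if Suc (s 13) = s 4 then 0 else s 14 + s 4)"
  using assms by (cases "Suc (s 13) = s 4") (auto simp: next_row_def)

lemma div_mod_Suc:
  assumes "0 < (m::nat)"
  shows "Suc i mod m = (if Suc (i mod m) = m then 0 else Suc (i mod m))"
    "Suc i div m = (if Suc (i mod m) = m then Suc (i div m) else i div m)"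
  using assms by (auto simp: mod_Suc div_Suc)

lemma rows_body_inv:
  assumes "i < m * m" "rows_inv n m i (s, mem)"
  shows "s 6 \<noteq> 0 \<and> rows_inv n m (Suc i) (run rows_body (s, mem))"
proof -
  have m: "0 < m"
    using assms(1) by (cases m) auto
  define a b where "a = i div m" and "b = i mod m"
  have ab: "a < m" "b < m" "i = a * m + b"
    using assms(1) m by (auto simp: a_def b_def div_less_square)
  have s: "s 0 = n" "s (Suc 0) = 1" "s 3 = 0" "s 4 = m" "s 5 = m * m" "s 6 = m * m - i" "s 10 = i * n" "s 11 = a"
    "s 12 = a * m" "s 13 = b" "s 14 = b * m"
    and mem: "mem = (\<lambda>x. of_bool (\<exists>i'<i. \<exists>k<5. x = i' * n + neighbour m k i'))"
    using assms(2) by (auto simp: rows_inv_def a_def b_def)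
  define v17 where "v17 = (if m * m \<le> a * m + m then a * m + m - m * m else a * m + m)"
  define v18 where "v18 = (if m \<le> b + 1 then b + 1 - m else b + 1)"
  define v15 where "v15 = (if m \<le> a + b then a + b - m else a + b)"
  define v16 where "v16 = (if m * m \<le> a * m + b * m then a * m + b * m - m * m else a * m + b * m)"
  obtain x1 where x1: "run (sum_mod 17 12 4 5) (s, mem) = (s(19 := x1, 17 := v17), mem)"
    using run_sum_mod[OF v17_def, of 12 4 17 5 s mem] by (auto simp: s   )
  define s1 where "s1 = s(19 := x1, 17 := v17)"
  obtain x2 where x2: "run (sum_mod 18 13 1 4) (s1, mem) = (s1(19 := x2, 18 := v18), mem)"
    using run_sum_mod[OF v18_def, of 13 1 18 4 s1 mem] by (auto simp: s s1_def  )
  define s2 where "s2 = s1(19 := x2, 18 := v18)"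
  obtain x3 where x3: "run (sum_mod 15 11 13 4) (s2, mem) = (s2(19 := x3, 15 := v15), mem)"
    using run_sum_mod[OF v15_def, of 11 13 15 4 s2 mem] by (auto simp: s s1_def s2_def )
  define s3 where "s3 = s2(19 := x3, 15 := v15)"
  obtain x4 where x4: "run (sum_mod 16 12 14 5) (s3, mem) = (s3(19 := x4, 16 := v16), mem)"
    using run_sum_mod[OF v16_def, of 12 14 16 5 s3 mem] by (auto simp: s s1_def s2_def s3_def)
  define s4 where "s4 = s3(19 := x4, 16 := v16)"
  have s4: "s4 r = s r" if "r < 15" for r
    using that by (simp add: s4_def s3_def s2_def s1_def)
  have s4': "s4 15 = v15" "s4 16 = v16" "s4 17 = v17" "s4 18 = v18"
    by (simp_all add: s4_def s3_def s2_def s1_def)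
  define mem' where "mem' = mem(i * n + neighbour m 0 i := 1, i * n + neighbour m 1 i := 1,
      i * n + neighbour m 2 i := 1, i * n + neighbour m 3 i := 1, i * n + neighbour m 4 i := 1)"
  have nb: "neighbour m 0 i = a * m + b" "neighbour m 1 i = v17 + b" "neighbour m 2 i = a * m + v18"
    "neighbour m 3 i = v16 + b" "neighbour m 4 i = a * m + v15"
    using neighbour_arith[OF ab] by (simp_all add: v15_def v16_def v17_def v18_def)
  obtain x5 where "run rows_body (s, mem) = run next_row (s4(20 := x5), mem')"
    unfolding rows_body_def mem'_def nb
    by (simp add: x1[folded s1_def] x2[folded s2_def, unfolded One_nat_def] x3[folded s3_def]
        x4[folded s4_def] run_put s s4 s4' add.assoc)
  then obtain s' where r: "run rows_body (s, mem) = (s', mem')"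
    and s': "\<forall>r\<in>{0, 1, 3, 4, 5}. s' r = s r" "s' 6 = m * m - i - 1" "s' 10 = i * n + n"
    "s' 11 = (if Suc b = m then Suc a else a)" "s' 12 = (if Suc b = m then a * m + m else a * m)"
    "s' 13 = (if Suc b = m then 0 else Suc b)" "s' 14 = (if Suc b = m then 0 else b * m + m)"
    using run_next_row[of "s4(20 := x5)" mem'] ab(2) by (auto simp: s s4)
  have "mem' x = of_bool (\<exists>i'<Suc i. \<exists>k<5. x = i' * n + neighbour m k i')" for x
  proof -
    define old where "old \<longleftrightarrow> (\<exists>i'<i. \<exists>k<5. x = i' * n + neighbour m k i')"
    have split: "(\<exists>i'<Suc i. R i') \<longleftrightarrow> (\<exists>i'<i. R i') \<or> R i" for R
      by (auto simp: less_Suc_eq)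
    have "mem x = of_bool old"
      by (simp add: mem old_def)
    then have "mem' x = of_bool (old \<or> (\<exists>k<5. x = i * n + neighbour m k i))"
      unfolding mem'_def ex_less_5 by (rule update_5)
    then show ?thesis
      unfolding split old_def .
  qed
  then show ?thesis
    using assms(1) s s' unfolding r rows_inv_def
    by (simp add: div_mod_Suc[OF m] a_def b_def add.commute)
qed


theorem exec_torus_program:
  assumes "1 \<le> n"
  defines "m \<equiv> floor_sqrt n"
  shows "\<exists>t s mem. exec torus_program (unary_input n) t (s, mem) \<and> t \<le> 200 + 200 * n \<and>
    (\<forall>x. mem x = of_bool (\<exists>i<m * m. \<exists>k<5. x = i * n + neighbour m k i))"
proof -
  have m: "m * m \<le> n" "n < (m + 1) * (m + 1)"
    using floor_sqrt_power2_le[of n] Suc_floor_sqrt_power2_gt[of n] by (simp_all add: m_def power2_eq_square)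
  then have "m \<le> n"
    by (metis le_square le_trans)
  have straight: "straight count_init" "straight count_body" "straight sqrt_init" "straight sqrt_body"
    "straight rows_init" "straight rows_body"
    and cost: "cost count_init = 2" "cost count_body = 3" "cost sqrt_init = 3" "cost sqrt_body = 5"
    "cost rows_init = 4" "cost rows_body = 50"
    by (simp_all add: count_init_def count_body_def sqrt_init_def sqrt_body_def rows_init_def rows_body_def
        sum_mod_def put_def next_row_def)
  let ?st1 = "run count_init (unary_input n)"
  obtain t1 where t1: "t1 \<le> 2" "exec count_init (unary_input n) t1 ?st1"
    using exec_run[OF straight(1)] unfolding cost by blast
  have "count_inv n 0 ?st1"
    using assms(1) by (auto simp: count_init_def unary_input_def count_inv_def)
  moreover have "s 2 = 0" if "count_inv n n (s, mem)" for s mem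
    using that by (simp add: count_inv_def)
  ultimately obtain t2 st2 where t2: "exec (Loop 2 count_body) ?st1 t2 st2" "t2 \<le> n * 4 + 1" "count_inv n n st2"
    using exec_Loop[of n "count_inv n" 2 count_body ?st1, OF count_body_inv _ straight(2)]
    unfolding cost by auto
  let ?st3 = "run sqrt_init st2"
  obtain t3 where t3: "t3 \<le> 3" "exec sqrt_init st2 t3 ?st3"
    using exec_run[OF straight(3)] unfolding cost by blast
  have "sqrt_inv n 0 ?st3"
    using t2(3) by (cases st2) (auto simp: sqrt_init_def sqrt_inv_def count_inv_def)
  moreover have "s 6 = 0" if "sqrt_inv n m (s, mem)" for s mem
    using that m(2) by (auto simp: sqrt_inv_def power2_eq_square)
  ultimately obtain t4 st4 where t4: "exec (Loop 6 sqrt_body) ?st3 t4 st4" "t4 \<le> m * 6 + 1" "sqrt_inv n m st4"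
    using exec_Loop[of m "sqrt_inv n" 6 sqrt_body ?st3, OF sqrt_body_inv[of _ n, folded m_def] _ straight(4)]
    unfolding cost by auto
  let ?st5 = "run rows_init st4"
  obtain t5 where t5: "t5 \<le> 4" "exec rows_init st4 t5 ?st5"
    using exec_run[OF straight(5)] unfolding cost by blast
  have "rows_inv n m 0 ?st5"
    using t4(3) by (cases st4) (auto simp: rows_init_def sqrt_inv_def rows_inv_def power2_eq_square)
  moreover have "s 6 = 0" if "rows_inv n m (m * m) (s, mem)" for s mem
    using that by (simp add: rows_inv_def)
  ultimately obtain t6 st6 where t6: "exec (Loop 6 rows_body) ?st5 t6 st6" "t6 \<le> m * m * 51 + 1"
    "rows_inv n m (m * m) st6"
    using exec_Loop[of "m * m" "rows_inv n m" 6 rows_body ?st5, OF rows_body_inv _ straight(6)]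
    unfolding cost by auto
  obtain s mem where st6: "st6 = (s, mem)"
    by (cases st6)
  have "exec torus_program (unary_input n) (t1 + (t2 + (t3 + (t4 + (t5 + t6))))) st6"
    unfolding torus_program_def seq.simps
    by (rule exec.intros(6)[OF t1(2) exec.intros(6)[OF t2(1) exec.intros(6)[OF t3(2)
          exec.intros(6)[OF t4(1) exec.intros(6)[OF t5(2) t6(1)]]]]])
  moreover have "t1 + (t2 + (t3 + (t4 + (t5 + t6)))) \<le> 200 + 200 * n"
    using t1 t2(2) t3 t4(2) t5 t6(2) m(1) \<open>m \<le> n\<close> by linarith
  moreover have "\<forall>x. mem x = of_bool (\<exists>i<m * m. \<exists>k<5. x = i * n + neighbour m k i)"
    using t6(3) unfolding st6 rows_inv_def by simp
  ultimately show ?thesis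
    unfolding st6 by blast
qed

theorem explicit_torus_matrix: "explicit (torus_matrix :: nat \<Rightarrow> 'a::{field,finite} mat)"
proof -
  obtain f :: "'a \<Rightarrow> nat" where f: "inj f"
    using finite_imp_inj_to_nat_seg[of "UNIV :: 'a set"] by auto
  \<comment> \<open>The program writes zeros and ones, so these are prescribed; the shift by 2 keeps
    the other codes apart.\<close>
  define code :: "'a \<Rightarrow> nat" where "code a = (if a = 0 then 0 else if a = 1 then 1 else f a + 2)" for a
  have "inj code"
    using f by (auto simp: inj_def code_def)
  moreover have code: "code (of_bool P) = of_bool P" for P
    by (simp add: code_def)
  moreover have "\<exists>t s mem. exec torus_program (unary_input n) t (s, mem) \<and> t \<le> poly [:200, 200:] n \<and>
      (\<forall>i<n. \<forall>j<n. mem (i * n + j) = code (torus_matrix n $$ (i, j)))" if n: "1 \<le> n" for n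
  proof -
    let ?m = "floor_sqrt n"
    obtain t s mem where *: "exec torus_program (unary_input n) t (s, mem)" "t \<le> 200 + 200 * n"
      "\<And>x. mem x = of_bool (\<exists>i<?m * ?m. \<exists>k<5. x = i * n + neighbour ?m k i)"
      using exec_torus_program[OF n] by blast
    have m: "0 < ?m" "?m * ?m \<le> n"
      using n floor_sqrt_power2_le[of n] by (simp_all add: power2_eq_square)
    have "mem (i * n + j) = code (torus_matrix n $$ (i, j))" if ij: "i < n" "j < n" for i j
    proof -
      \<comment> \<open>Both \<open>j\<close> and the neighbour are below \<open>n\<close>, so the
        address determines row and column.\<close>
      have decode: "i * n + j = i' * n + neighbour ?m k i' \<longleftrightarrow> i = i' \<and> j = neighbour ?m k i'" for i' k
      proof
        assume eq: "i * n + j = i' * n + neighbour ?m k i'"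
        have "neighbour ?m k i' < n"
          using neighbour_less[OF m(1), of k i'] m(2) by linarith
        then show "i = i' \<and> j = neighbour ?m k i'"
          using arg_cong[OF eq, of "\<lambda>x. x div n"] arg_cong[OF eq, of "\<lambda>x. x mod n"] ij by simp
      qed simp
      have "mem (i * n + j) = of_bool (i < ?m * ?m \<and> (\<exists>k<5. j = neighbour ?m k i))"
        unfolding *(3) decode by (intro arg_cong[of _ _ of_bool]) blast
      then show ?thesis
        using ij by (simp add: torus_matrix_def code power2_eq_square)
    qed
    then show ?thesis
      using *(1,2) by (intro exI[of _ t] exI[of _ s] exI[of _ mem]) (simp add: mult.commute)
  qed
  ultimately show ?thesis
    unfolding explicit_def by blast
qed

section \<open>The lower bound\<close>

text \<open>Take \<open>K\<close> of greatest size. Every member of \<open>R\<close> then conflicts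
  with some \<open>k\<close> in \<open>K\<close>: its row meets the column of \<open>k\<close>, or
  its column meets the row of \<open>k\<close>. Each of the two kinds offers at most
  \<open>d\<close> lines with at most \<open>d\<close> entries.\<close>

lemma ex_induced_matching:
  fixes nz :: "'i \<Rightarrow> 'j \<Rightarrow> bool"
  assumes "finite R" "R \<subseteq> {(i, j). nz i j}"
    and row: "\<And>i. finite {j. nz i j} \<and> card {j. nz i j} \<le> d"
    and col: "\<And>j. finite {i. nz i j} \<and> card {i. nz i j} \<le> d"
  obtains K where "K \<subseteq> R" "\<And>k l. k \<in> K \<Longrightarrow> l \<in> K \<Longrightarrow> k \<noteq> l \<Longrightarrow> \<not> nz (fst k) (snd l)"
    "card R \<le> 2 * d\<^sup>2 * card K"
proof -
  define good where "good K \<longleftrightarrow> K \<subseteq> R \<and> (\<forall>k\<in>K. \<forall>l\<in>K. k \<noteq> l \<longrightarrow> \<not> nz (fst k) (snd l))" for K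
  have "good {}"
    by (simp add: good_def)
  moreover have "\<forall>K. good K \<longrightarrow> card K \<le> card R"
    using assms(1) by (auto simp: good_def intro: card_mono)
  ultimately have "\<exists>K. good K \<and> (\<forall>K'. good K' \<longrightarrow> card K' \<le> card K)"
    by (intro ex_has_greatest_nat[of good _ card "Suc (card R)"]) (auto simp: less_Suc_eq_le)
  then obtain K where K: "good K" and max: "\<And>K'. good K' \<Longrightarrow> card K' \<le> card K"
    by blast
  have finK: "finite K"
    using K assms(1) finite_subset unfolding good_def by blast
  define U where "U k = Sigma {i. nz i (snd k)} (\<lambda>i. {j. nz i j})" for k :: "'i \<times> 'j"
  define V where "V k = (\<lambda>(j, i). (i, j)) ` Sigma {j. nz (fst k) j} (\<lambda>j. {i. nz i j})" for k :: "'i \<times> 'j"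
  have card_Sigma: "card (Sigma X Y) \<le> d\<^sup>2"
    if "finite X \<and> card X \<le> d" "\<And>x. finite (Y x) \<and> card (Y x) \<le> d" for X :: "'p set" and Y :: "'p \<Rightarrow> 'q set"
  proof -
    have "card (Sigma X Y) = (\<Sum>x\<in>X. card (Y x))"
      using that by (intro card_SigmaI) auto
    also have "\<dots> \<le> card X * d"
      using that sum_bounded_above[of X "\<lambda>x. card (Y x)" d] by simp
    also have "\<dots> \<le> d\<^sup>2"
      using that by (simp add: power2_eq_square)
    finally show ?thesis .
  qed
  have fin_UV: "finite (U k)" "finite (V k)" for k
    unfolding U_def V_def using row col by (auto intro!: finite_SigmaI finite_imageI)
  have cV: "card (V k) \<le> d\<^sup>2" for k
    unfolding V_def by (rule le_trans[OF card_image_le card_Sigma]) (use row col in \<open>auto intro!: finite_SigmaI\<close>)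
  have cU: "card (U k) \<le> d\<^sup>2" for k
    unfolding U_def by (rule card_Sigma) (use row col in auto)
  have UV: "card (U k \<union> V k) \<le> 2 * d\<^sup>2" for k
    using card_Un_le[of "U k" "V k"] cU[of k] cV[of k] by linarith
  have "R \<subseteq> (\<Union>k\<in>K. U k \<union> V k)"
  proof
    fix r assume r: "r \<in> R"
    show "r \<in> (\<Union>k\<in>K. U k \<union> V k)"
    proof (rule ccontr)
      assume "r \<notin> (\<Union>k\<in>K. U k \<union> V k)"
      then have free: "\<not> nz (fst r) (snd k) \<and> \<not> nz (fst k) (snd r)" if "k \<in> K" for k
        using that r assms(2) unfolding U_def V_def by (cases r; cases k) (force simp: image_iff)
      have "r \<notin> K"
        using free[of r] r assms(2) by auto
      moreover have "good (insert r K)"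
        using K free r unfolding good_def by blast
      then have "card (insert r K) \<le> card K"
        by (rule max)
      ultimately show False
        using finK by simp
    qed
  qed
  then have "card R \<le> card (\<Union>k\<in>K. U k \<union> V k)"
    using finK fin_UV by (intro card_mono) auto
  also have "\<dots> \<le> (\<Sum>k\<in>K. card (U k \<union> V k))"
    by (rule card_UN_le[OF finK])
  also have "\<dots> \<le> 2 * d\<^sup>2 * card K"
    using sum_bounded_above[of K "\<lambda>k. card (U k \<union> V k)" "2 * d\<^sup>2"] UV by (simp add: mult.commute)
  finally show thesis
    using that[of K] K unfolding good_def by blast
qed

section \<open>Entries of the torus matrix across a separator\<close>

definition linked :: "nat \<Rightarrow> nat \<Rightarrow> nat \<Rightarrow> bool" where
  "linked m i j \<longleftrightarrow> i < m * m \<and> j < m * m \<and> (\<exists>k<5. j = neighbour m k i)"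

lemma linked_degree:
  "finite {j. linked m i j} \<and> card {j. linked m i j} \<le> 5"
  "finite {i. linked m i j} \<and> card {i. linked m i j} \<le> 5"
proof -
  have sub: "{j. linked m i j} \<subseteq> (\<lambda>k. neighbour m k i) ` {..<5}"
    by (auto simp: linked_def)
  then have "card {j. linked m i j} \<le> card {..<5::nat}"
    by (meson card_image_le card_mono finite_imageI finite_lessThan le_trans)
  then show "finite {j. linked m i j} \<and> card {j. linked m i j} \<le> 5"
    using finite_subset[OF sub] by simp
  define J where "J k = {i \<in> {..<m * m}. neighbour m k i = j}" for k
  have "card (J k) \<le> 1" for k
    unfolding One_nat_def by (subst card_le_Suc0_iff_eq) (auto simp: J_def inj_on_eq_iff[OF inj_on_neighbour])
  then have "(\<Sum>k<5. card (J k)) \<le> 5"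
    using sum_bounded_above[of "{..<5::nat}" "\<lambda>k. card (J k)" 1] by simp
  moreover have "card (\<Union>k<5. J k) \<le> (\<Sum>k<5. card (J k))"
    by (intro card_UN_le) simp
  moreover have sub: "{i. linked m i j} \<subseteq> (\<Union>k<5. J k)"
    by (auto simp: linked_def J_def)
  moreover have "finite (\<Union>k<5. J k)"
    by (auto simp: J_def)
  ultimately show "finite {i. linked m i j} \<and> card {i. linked m i j} \<le> 5"
    using card_mono[of "\<Union>k<5. J k" "{i. linked m i j}"] finite_subset by (metis le_trans)
qed

lemma torus_matrix_index:
  assumes "m = floor_sqrt n" "i < m * m" "j < m * m"
  shows "torus_matrix n $$ (i, j) = of_bool (linked m i j)"
proof -
  have "m * m \<le> n"
    using floor_sqrt_power2_le[of n] assms(1) by (simp add: power2_eq_square)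
  then show ?thesis
    using assms by (simp add: torus_matrix_def linked_def power2_eq_square)
qed

locale torus_circuit =
  fixes C :: "('g, 'w, xy, 'a::field) circuit" and n m :: nat
  assumes n: "1 \<le> n" and m: "m = floor_sqrt n"
    and circuit: "circuit C" and planar: "planar (underlying C)" and read_once: "read_once C"
    and computes: "computes C (bilinear_form n (torus_matrix n))"
begin

lemma m_pos: "0 < m" and square_le: "m * m \<le> n"
  using n floor_sqrt_power2_le[of n] by (simp_all add: m power2_eq_square)

text \<open>The factor is \<open>2 * 5\<^sup>2\<close> for passing to an induced matching of a
  pattern of degree 5, times the 3 of \<open>induced_matching_le\<close>.\<close>

lemma separated_links:
  assumes "separated_circuit C A B S"
    and R: "R \<subseteq> {(i, j). linked m i j}"
    and labels: "\<And>g r. g \<in> verts C \<Longrightarrow> r \<in> R \<Longrightarrow> label C g = Input (X (snd r)) \<Longrightarrow> g \<in> A"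
      "\<And>g r. g \<in> verts C \<Longrightarrow> r \<in> R \<Longrightarrow> label C g = Input (Y (fst r)) \<Longrightarrow> g \<in> B"
  shows "card R \<le> 150 * card S"
proof -
  have sub: "R \<subseteq> {..<m * m} \<times> {..<m * m}"
    using R by (auto simp: linked_def)
  then have "finite R"
    by (rule finite_subset) simp
  then obtain K where K: "K \<subseteq> R" "\<And>k l. k \<in> K \<Longrightarrow> l \<in> K \<Longrightarrow> k \<noteq> l \<Longrightarrow> \<not> linked m (fst k) (snd l)"
    "card R \<le> 2 * 5\<^sup>2 * card K"
    using ex_induced_matching[OF _ R linked_degree] by blast
  have bound: "fst k < m * m" "snd k < m * m" if "k \<in> K" for k
    using that K(1) sub by auto
  have "card K \<le> 3 * card S"
  proof (rule separated_circuit.induced_matching_le[OF assms(1) computes])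
    show "K \<subseteq> {..<n} \<times> {..<n}"
      using bound square_le by (force simp: less_le_trans)
    show "torus_matrix n $$ k \<noteq> (0 :: 'a)" if "k \<in> K" for k
    proof -
      have "linked m (fst k) (snd k)"
        using that K(1) R by (cases k) auto
      then show ?thesis
        by (simp add: torus_matrix_index[OF m bound[OF that], unfolded prod.collapse])
    qed
    show "torus_matrix n $$ (fst k, snd l) = (0 :: 'a)" if "k \<in> K" "l \<in> K" "k \<noteq> l" for k l
      by (simp add: torus_matrix_index[OF m bound(1)[OF that(1)] bound(2)[OF that(2)]] K(2)[OF that])
  qed (use labels K(1) in blast)+
  then show ?thesis
    using K(3) by simp
qed

lemma linked_self: "i < m * m \<Longrightarrow> linked m i i"
  unfolding linked_def using neighbour_0[of i m] by (auto intro!: exI[of _ 0])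

text \<open>If no gate were labelled \<open>X i\<close> or none \<open>Y i\<close>, an empty
  separator with all gates on one side would separate the diagonal entry at \<open>i\<close>, giving
  \<open>1 \<le> 0\<close>.\<close>

lemma ex_input:
  assumes "i < m * m"
  shows "\<exists>g\<in>verts C. label C g = Input (X i)" "\<exists>g\<in>verts C. label C g = Input (Y i)"
proof -
  have R: "{(i, i)} \<subseteq> {(i, j). linked m i j}"
    using linked_self[OF assms] by simp
  have "separated_circuit C {} (verts C) {}" "separated_circuit C (verts C) {} {}"
    using circuit by unfold_locales auto
  note sep = this
  show "\<exists>g\<in>verts C. label C g = Input (X i)"
    using separated_links[OF sep(1) R] by auto
  show "\<exists>g\<in>verts C. label C g = Input (Y i)"
    using separated_links[OF sep(2) R] by auto
qed

theorem size_bound: "(real n)\<^sup>2 \<le> 10 ^ 16 * real (size_circuit C)"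
proof -
  interpret G: fin_digraph "underlying C"
    using circuit by (simp add: circuit_def)
  have verts_u [simp]: "verts (underlying C) = verts C"
    by (simp add: underlying_def)
  have fin: "finite (verts C)"
    using G.finite_verts by simp
  define L where "L = m * m"
  define N where "N = card (verts C)"
  obtain gx where gx: "\<And>i. i < L \<Longrightarrow> gx i \<in> verts C \<and> label C (gx i) = Input (X i)"
    using ex_input(1) unfolding L_def by metis
  obtain gy where gy: "\<And>i. i < L \<Longrightarrow> gy i \<in> verts C \<and> label C (gy i) = Input (Y i)"
    using ex_input(2) unfolding L_def by metis
  have gx_unique: "g = gx i" if "g \<in> verts C" "label C g = Input (X i)" "i < L" for g i
    using that gx[OF that(3)] read_once unfolding read_once_def by metis
  have gy_unique: "g = gy i" if "g \<in> verts C" "label C g = Input (Y i)" "i < L" for g i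
    using that gy[OF that(3)] read_once unfolding read_once_def by metis
  have inj: "inj_on gx {..<L}" "inj_on gy {..<L}"
    using gx gy unfolding inj_on_def by (metis lessThan_iff gate.inject(1) xy.inject(1),
        metis lessThan_iff gate.inject(1) xy.inject(2))
  have xy_disj: "gx ` {..<L} \<inter> gy ` {..<L} = {}"
    using gx gy by fastforce
  define W where "W = gx ` {..<L} \<union> gy ` {..<L}"
  have WV: "W \<subseteq> verts C"
    unfolding W_def using gx gy by auto
  have cardW: "card W = 2 * L"
    unfolding W_def using xy_disj inj by (simp add: card_Un_disjoint card_image)
  have cardW_Int: "card (D \<inter> W) = card {i. i < L \<and> gx i \<in> D} + card {i. i < L \<and> gy i \<in> D}" for D
  proof -
    have "D \<inter> W = gx ` {i. i < L \<and> gx i \<in> D} \<union> gy ` {i. i < L \<and> gy i \<in> D}"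
      unfolding W_def by auto
    also have "card \<dots> = card (gx ` {i. i < L \<and> gx i \<in> D}) + card (gy ` {i. i < L \<and> gy i \<in> D})"
      using xy_disj by (intro card_Un_disjoint) auto
    also have "\<dots> = card {i. i < L \<and> gx i \<in> D} + card {i. i < L \<and> gy i \<in> D}"
      using inj by (simp add: card_image inj_on_subset subset_iff)
    finally show ?thesis .
  qed
  define b where "b = floor_sqrt (6 * N) + 1"
  have "0 < N"
    unfolding N_def using fin gx[of 0] m_pos by (auto simp: L_def card_gt_0_iff)
  have b: "0 < b" "6 * N \<le> b * b"
    using Suc_floor_sqrt_power2_gt[of "6 * N"] by (simp_all add: b_def power2_eq_square)
  obtain A B S where ABS: "verts C = A \<union> B \<union> S" "A \<inter> B = {}" "A \<inter> S = {}" "B \<inter> S = {}"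
    and S: "card S \<le> 7 * b" and no_edge: "\<And>u v. u \<in> A \<Longrightarrow> v \<in> B \<Longrightarrow> (u, v) \<notin> edges (underlying C)"
    and bal: "2 * card (A \<inter> W) \<le> card W" "4 * card (B \<inter> W) \<le> 3 * card W"
    using planar_separator[OF planar G.fin_digraph_axioms b(1)] b(2) WV unfolding N_def verts_u by metis
  have sepAB: "separated_circuit C A B S"
    using circuit ABS no_edge by unfold_locales auto
  have sepBA: "separated_circuit C B A S"
    using circuit ABS no_edge symD[OF sym_edges[of "underlying C"]] by unfold_locales blast+
  define \<sigma> where "\<sigma> = card S"
  have finS: "finite S"
    using ABS fin by simp
  \<comment> \<open>Entries with their two variables on different sides, one set for each
    orientation.\<close>
  define N1 where "N1 = {(i, j). linked m i j \<and> gy i \<in> B \<and> gx j \<in> A}"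
  define N2 where "N2 = {(i, j). linked m i j \<and> gy i \<in> A \<and> gx j \<in> B}"
  have linked_less: "i < L" "j < L" if "linked m i j" for i j
    using that by (auto simp: linked_def L_def)
  have links: "card {(i, j). linked m i j \<and> gy i \<in> Q \<and> gx j \<in> P} \<le> 150 * \<sigma>"
    if "separated_circuit C P Q S" for P Q
    unfolding \<sigma>_def
  proof (rule separated_links[OF that])
    fix g r assume g: "g \<in> verts C" and "r \<in> {(i, j). linked m i j \<and> gy i \<in> Q \<and> gx j \<in> P}"
    then have r: "fst r < L" "snd r < L" "gy (fst r) \<in> Q" "gx (snd r) \<in> P"
      using linked_less[of "fst r" "snd r"] by auto
    show "g \<in> P" if "label C g = Input (X (snd r))"
      using gx_unique[OF g that r(2)] r(4) by simp
    show "g \<in> Q" if "label C g = Input (Y (fst r))"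
      using gy_unique[OF g that r(1)] r(3) by simp
  qed auto
  have N12: "card N1 \<le> 150 * \<sigma>" "card N2 \<le> 150 * \<sigma>"
    unfolding N1_def N2_def by (rule links[OF sepAB] links[OF sepBA])+
  have fin12: "finite N1" "finite N2"
    by (rule finite_subset[of _ "{..<L} \<times> {..<L}"], use linked_less in \<open>auto simp: N1_def N2_def\<close>)+
  have side: "g \<in> A \<or> g \<in> B \<or> g \<in> S" if "g \<in> verts C" for g
    using ABS that by blast
  define I1 I2 where "I1 = fst ` N1" and "I2 = fst ` N2"
  have I12: "card I1 \<le> 150 * \<sigma>" "card I2 \<le> 150 * \<sigma>" "finite I1" "finite I2"
    unfolding I1_def I2_def using card_image_le[OF fin12(1), of fst] card_image_le[OF fin12(2), of fst] N12 fin12 by auto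
  have I1: "i \<in> I1" if "linked m i j" "gy i \<in> B" "gx j \<in> A" for i j
    unfolding I1_def using that by (auto simp: N1_def intro!: image_eqI[of _ fst "(i, j)"])
  have I2: "i \<in> I2" if "linked m i j" "gy i \<in> A" "gx j \<in> B" for i j
    unfolding I2_def using that by (auto simp: N2_def intro!: image_eqI[of _ fst "(i, j)"])
  have pull: "finite {i. i < L \<and> h i \<in> S} \<and> card {i. i < L \<and> h i \<in> S} \<le> \<sigma>" if "inj_on h {..<L}" for h
  proof -
    have "card (h ` {i. i < L \<and> h i \<in> S}) \<le> \<sigma>"
      unfolding \<sigma>_def by (intro card_mono finS) auto
    moreover have "inj_on h {i. i < L \<and> h i \<in> S}"
      using that by (rule inj_on_subset) auto
    ultimately show ?thesis
      by (simp add: card_image)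
  qed
  define Sx Sy where "Sx = {i. i < L \<and> gx i \<in> S}" and "Sy = {i. i < L \<and> gy i \<in> S}"
  have Sxy: "card Sx \<le> \<sigma>" "card Sy \<le> \<sigma>" "finite Sx" "finite Sy"
    unfolding Sx_def Sy_def using pull[OF inj(1)] pull[OF inj(2)] by auto
  define T where "T = {i. i < L \<and> gx i \<in> A}"
  define T' where "T' = {i. i < L \<and> gy i \<in> A}"
  define t where "t = card T"
  define t' where "t' = card T'"
  have finT: "finite T" "finite T'"
    by (simp_all add: T_def T'_def)
  have "card (boundary m k T) \<le> 303 * \<sigma>" if "k < 5" for k
  proof -
    define Sn where "Sn = {i. i < L \<and> (gx \<circ> neighbour m k) i \<in> S}"
    have nb: "neighbour m k i < L" if "i < L" for i
      using neighbour_less[OF m_pos] by (simp add: L_def)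
    have "inj_on (gx \<circ> neighbour m k) {..<L}"
    proof (rule comp_inj_on)
      show "inj_on (neighbour m k) {..<L}"
        using inj_on_neighbour by (simp add: L_def)
      show "inj_on gx (neighbour m k ` {..<L})"
        by (rule inj_on_subset[OF inj(1)]) (use nb in auto)
    qed
    then have Sn: "card Sn \<le> \<sigma>" "finite Sn"
      unfolding Sn_def using pull by blast+
    \<comment> \<open>If \<open>X i\<close> and the x-variable of the neighbour lie on different
      sides, \<open>Y i\<close> lies in \<open>S\<close> or across from one of them. Both entries of
      row \<open>i\<close> are nonzero, so \<open>i\<close> belongs to \<open>I1\<close> or
      \<open>I2\<close>. The sum is \<open>303 = 150 + 150 + 1 + 1 + 1\<close>.\<close>
    have "boundary m k T \<subseteq> I1 \<union> I2 \<union> Sx \<union> Sy \<union> Sn"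
    proof
      fix i assume "i \<in> boundary m k T"
      then have i: "i < L" "(gx i \<in> A) \<noteq> (gx (neighbour m k i) \<in> A)"
        using nb by (auto simp: T_def L_def boundary_def)
      have l: "linked m i i" "linked m i (neighbour m k i)"
        using i(1) nb[OF i(1)] linked_self \<open>k < 5\<close> by (auto simp: L_def linked_def)
      show "i \<in> I1 \<union> I2 \<union> Sx \<union> Sy \<union> Sn"
        using side[of "gx i"] side[of "gy i"] side[of "gx (neighbour m k i)"] gx[OF i(1)] gy[OF i(1)]
          gx[OF nb[OF i(1)]] i I1[OF l(1)] I1[OF l(2)] I2[OF l(1)] I2[OF l(2)] ABS(2)
        unfolding Sx_def Sy_def Sn_def o_def by blast
    qed
    then have "card (boundary m k T) \<le> card (I1 \<union> I2 \<union> Sx \<union> Sy \<union> Sn)"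
      by (intro card_mono) (use I12 Sxy Sn in auto)
    also have "\<dots> \<le> card I1 + card I2 + card Sx + card Sy + card Sn"
      using card_Un_le[of "I1 \<union> I2 \<union> Sx \<union> Sy" Sn] card_Un_le[of "I1 \<union> I2 \<union> Sx" Sy]
        card_Un_le[of "I1 \<union> I2" Sx] card_Un_le[of I1 I2] by linarith
    finally show ?thesis
      using I12 Sxy Sn by linarith
  qed
  then have exp: "t * (L - t) \<le> 68 * (303 * \<sigma>) * L"
    unfolding t_def L_def by (intro torus.expander) (use m_pos in \<open>auto simp: torus_def T_def L_def\<close>)
  \<comment> \<open>Diagonal entries force the x- and y-variables on side \<open>A\<close> to agree
    up to \<open>151 * \<sigma>\<close> indices, so the balance of \<open>W\<close> becomes a
    balance of \<open>T\<close>.\<close>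
  have "T \<subseteq> T' \<union> (I1 \<union> Sy)"
  proof
    fix i assume "i \<in> T"
    then have i: "i < L" "gx i \<in> A"
      by (auto simp: T_def)
    then have "linked m i i"
      using linked_self by (simp add: L_def)
    from I1[OF this] show "i \<in> T' \<union> (I1 \<union> Sy)"
      using i side[of "gy i"] gy[OF i(1)] by (auto simp: T'_def Sy_def)
  qed
  then have "t \<le> card (T' \<union> (I1 \<union> Sy))"
    unfolding t_def by (intro card_mono) (use finT I12 Sxy in auto)
  also have "\<dots> \<le> t' + (card I1 + card Sy)"
    unfolding t'_def using card_Un_le[of T' "I1 \<union> Sy"] card_Un_le[of I1 Sy] by linarith
  finally have tt': "t \<le> t' + 151 * \<sigma>"
    using I12 Sxy by linarith
  have "T' \<subseteq> T \<union> (I2 \<union> Sx)"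
  proof
    fix i assume "i \<in> T'"
    then have i: "i < L" "gy i \<in> A"
      by (auto simp: T'_def)
    then have "linked m i i"
      using linked_self by (simp add: L_def)
    from I2[OF this] show "i \<in> T \<union> (I2 \<union> Sx)"
      using i side[of "gx i"] gx[OF i(1)] by (auto simp: T_def Sx_def)
  qed
  then have "t' \<le> card (T \<union> (I2 \<union> Sx))"
    unfolding t'_def by (intro card_mono) (use finT I12 Sxy in auto)
  also have "\<dots> \<le> t + (card I2 + card Sx)"
    unfolding t_def using card_Un_le[of T "I2 \<union> Sx"] card_Un_le[of I2 Sx] by linarith
  finally have t't: "t' \<le> t + 151 * \<sigma>"
    using I12 Sxy by linarith
  have AW: "card (A \<inter> W) = t + t'"
    unfolding cardW_Int t_def t'_def T_def T'_def ..
  have "W \<subseteq> (A \<inter> W) \<union> ((B \<inter> W) \<union> S)"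
    using WV ABS(1) by blast
  then have "card W \<le> card ((A \<inter> W) \<union> ((B \<inter> W) \<union> S))"
    using finS finite_subset[OF WV fin] by (intro card_mono) auto
  also have "\<dots> \<le> card (A \<inter> W) + (card (B \<inter> W) + card S)"
    using card_Un_le[of "A \<inter> W" "(B \<inter> W) \<union> S"] card_Un_le[of "B \<inter> W" S] by linarith
  finally have "2 * L \<le> (t + t') + (card (B \<inter> W) + \<sigma>)"
    unfolding AW cardW \<sigma>_def .
  moreover have "2 * card (B \<inter> W) \<le> 3 * L" and upper: "t + t' \<le> L"
    using bal unfolding AW cardW by simp_all
  ultimately have lower: "L \<le> 2 * (t + t') + 2 * \<sigma>"
    by presburger
  have "L \<le> 400000 * \<sigma>"
  proof (rule ccontr)
    assume "\<not> ?thesis"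
    then have small: "400000 * \<sigma> < L"
      by simp
    have "L \<le> 2 * t + 2 * t' + 2 * \<sigma>"
      using lower by simp
    \<comment> \<open>Were \<open>\<sigma>\<close> so small, \<open>T\<close> would hold at least
      3/20 and at most 3/5 of the torus, and expansion would give
      \<open>6 * L \<le> 100 * 68 * 303 * \<sigma>\<close>.\<close>
    then have t: "3 * L \<le> 20 * t" "2 * L \<le> 5 * L - 5 * t"
      using small upper tt' t't by linarith+
    have "(3 * L) * (2 * L) \<le> (20 * t) * (5 * L - 5 * t)"
      by (rule mult_le_mono[OF t])
    also have "\<dots> = 100 * (t * (L - t))"
      by (simp add: diff_mult_distrib2)
    also have "\<dots> \<le> 100 * (68 * (303 * \<sigma>) * L)"
      by (rule mult_le_mono2[OF exp])
    finally have "6 * L * L \<le> 2060400 * \<sigma> * L"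
      by simp
    then have "6 * L \<le> 2060400 * \<sigma>"
      using small by simp
    then show False
      using small by linarith
  qed
  then have Lb: "L \<le> 2800000 * b"
    using S unfolding \<sigma>_def by linarith
  have "b \<le> 2 * floor_sqrt (6 * N)"
    using \<open>0 < N\<close> floor_sqrt_greater_zero_iff[of "6 * N"] unfolding b_def by linarith
  then have "b\<^sup>2 \<le> (2 * floor_sqrt (6 * N))\<^sup>2"
    by (rule power_mono) simp
  also have "\<dots> \<le> 24 * N"
    using floor_sqrt_power2_le[of "6 * N"] by (simp add: power_mult_distrib)
  finally have b2: "b\<^sup>2 \<le> 24 * N" .
  have "n < (m + 1) * (m + 1)"
    using Suc_floor_sqrt_power2_gt[of n] by (simp add: m power2_eq_square)
  also have "\<dots> \<le> (2 * m) * (2 * m)"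
    using m_pos by (intro mult_le_mono) auto
  finally have "n \<le> 11200000 * b"
    using Lb by (simp add: L_def)
  then have "n\<^sup>2 \<le> (11200000 * b)\<^sup>2"
    by (rule power_mono) simp
  also have "\<dots> \<le> 11200000\<^sup>2 * (24 * N)"
    using b2 by (simp add: power_mult_distrib)
  \<comment> \<open>The constant \<open>11200000\<close> is \<open>4 * 7 * 400000\<close>, from
    \<open>n \<le> 4 * L\<close>, \<open>card S \<le> 7 * b\<close> and the bound on
    \<open>L\<close>. Its square times 24 is about \<open>3 * 10 ^ 15\<close>.\<close>
  also have "\<dots> \<le> 10 ^ 16 * N"
    by simp
  finally have "real (n\<^sup>2) \<le> real (10 ^ 16 * N)"
    by (rule of_nat_mono)
  then show ?thesis
    by (simp add: N_def size_circuit_def)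
qed

end

theorem theorem3p14:
  fixes p :: nat
  assumes "prime p" and "p \<ge> 17" and "CARD('a::{field,finite}) = p\<^sup>2"
  shows "\<exists>M :: nat \<Rightarrow> 'a mat.
           (\<forall>n\<ge>1. M n \<in> carrier_mat n n) \<and> explicit M \<and>
           (\<exists>c>0. \<forall>\<^sub>F n in sequentially.
              ereal (c * (real n)\<^sup>2)
                \<le> ereal_of_enat (read_once_planar_complexity (bilinear_form n (M n))))"
proof (intro exI conjI)
  show "\<forall>n\<ge>1. (torus_matrix n :: 'a mat) \<in> carrier_mat n n"
    by (simp add: torus_matrix_def)
  show "explicit (torus_matrix :: nat \<Rightarrow> 'a mat)"
    by (rule explicit_torus_matrix)
  show "(1 / 10 ^ 16 :: real) > 0"
    by simp
  have "ereal (1 / 10 ^ 16 * (real n)\<^sup>2)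
      \<le> ereal_of_enat (read_once_planar_complexity (bilinear_form n (torus_matrix n :: 'a mat)))"
    if n: "1 \<le> n" for n
  proof -
    \<comment> \<open>Sizes are integers, so the real bound may be rounded up and compared with the
      infimum in \<open>enat\<close>.\<close>
    define s where "s = nat \<lceil>1 / 10 ^ 16 * (real n)\<^sup>2\<rceil>"
    have "enat s \<le> read_once_planar_complexity (bilinear_form n (torus_matrix n :: 'a mat))"
      unfolding read_once_planar_complexity_def
    proof (rule INF_greatest)
      fix C :: "(nat, nat, xy, 'a) circuit"
      assume "C \<in> {C. circuit C \<and> planar (underlying C) \<and> read_once C \<and>
        computes C (bilinear_form n (torus_matrix n))}"
      then have "torus_circuit C n (floor_sqrt n)"
        using n by (simp add: torus_circuit_def)
      then have "(real n)\<^sup>2 \<le> 10 ^ 16 * real (size_circuit C)"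
        by (rule torus_circuit.size_bound)
      then show "enat s \<le> enat (size_circuit C)"
        by (simp add: s_def nat_le_iff ceiling_le_iff)
    qed
    then have "ereal_of_enat (enat s)
        \<le> ereal_of_enat (read_once_planar_complexity (bilinear_form n (torus_matrix n :: 'a mat)))"
      by (simp only: ereal_of_enat_le_iff)
    moreover have "ereal (1 / 10 ^ 16 * (real n)\<^sup>2) \<le> ereal_of_enat (enat s)"
      unfolding s_def by (simp add: of_nat_ceiling)
    ultimately show ?thesis
      by (rule order_trans[rotated])
  qed
  then show "\<forall>\<^sub>F n in sequentially. ereal (1 / 10 ^ 16 * (real n)\<^sup>2)
      \<le> ereal_of_enat (read_once_planar_complexity (bilinear_form n (torus_matrix n :: 'a mat)))"
    by (intro eventually_sequentiallyI[of 1])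
qed

end
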